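(* Let $\mathcal{C}$ be an essentially small proto-abelian category equipped with a rank function $\operatorname{rk}$, and let $\Lambda$ be a totally ordered, uniquely divisible abelian group. The rule sending a slope filtration $F^{\geq \cdot}$ on $\mathcal{C}$ (indexed by $\Lambda$) to its associated slope function $\mu$ induces a bijection between slope filtrations on $\mathcal{C}$ indexed by $\Lambda$ (up to unique isomorphism) and slope functions on $\mathcal{C}$ with values in $\Lambda$.
   Context: A category with kernels and cokernels has a null object $0$, and every morphism has a kernel and a cokernel. A strict monic is a kernel of some morphism (its domain is a strict subobject); a strict epi is a cokernel of some morphism (its codomain is a strict quotient). A short exact sequence $0\to M\xrightarrow{f} N\xrightarrow{g}P\to 0$ is a pair with $f=\ker g$, $g=\operatorname{coker} f$; one writes $P=N/M$. Epi-monic means both epi and monic. A category with kernels and cokernels is proto-abelian if (i) any morphism with zero kernel (resp. cokernel) is monic (resp. epi), and (ii) the pull-back of a strict epi by a strict monic is a strict epi, and the push-out of a strict monic by a strict epi is a strict monic. A rank function on $\mathcal{C}$ is a function from isomorphism classes of objects to $\mathbb{N}$, additive on short exact sequences and taking the value $0$ only on the zero object. A slope function with values in $\Lambda$ is a map $\mu$ from isomorphism classes of non-zero objects to $\Lambda$ such that (1) $\mu(M)\le\mu(N)$ for any epi-monic $M\to N$ between non-zero objects, and (2) the degree function $\deg=\mu\cdot\operatorname{rk}$ (with $\deg 0=0$) is additive on short exact sequences. A (separated, exhaustive, left continuous, decreasing, functorial) filtration on $\mathcal{C}$ by strict subobjects indexed by $\Lambda$ is a functor $\Lambda^{op}\times\mathcal{C}\to\mathcal{C}$,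 $(\lambda,M)\mapsto F^{\geq\lambda}M$, where $F^{\geq\lambda}M$ is a strict subobject of $M$, such that for every $M\ne0$ there are finitely many elements $\lambda_1>\dots>\lambda_r$ of $\Lambda$ (the breaks of $M$) and a chain of distinct strict subobjects $0=M_0\subset M_1\subset\dots\subset M_r=M$ with $F^{\geq\lambda}M=M$ for $\lambda\le\lambda_r$, $F^{\geq\lambda}M=M_i$ for $\lambda_{i+1}<\lambda\le\lambda_i$, and $F^{\geq\lambda}M=0$ for $\lambda>\lambda_1$. One sets $F^{>\lambda}M=\varinjlim_{\lambda'>\lambda}F^{\geq\lambda'}M$, $\operatorname{gr}^\lambda M=F^{\geq\lambda}M/F^{>\lambda}M$, $\deg M=\sum_\lambda\lambda\cdot\operatorname{rk}\operatorname{gr}^\lambda M$, and $\mu(M)=\deg M/\operatorname{rk}M$ for $M\neq0$. Such a filtration is a slope filtration if (1) for any $\lambda$ and any object $N$, the filtrations of $F^{\geq\lambda}N$ and of $N/F^{\geq\lambda}N$ are induced by the filtration of $N$, and (2) the associated function $\mu$ is a slope function. *)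

theory Defs
  imports Main "HOL-Library.FuncSet"
begin

section \<open>Categories\<close>

text \<open>
  Objects and arrows are the elements of two carrier sets, so every category below is small;
  an essentially small category is treated through a small category equivalent to it.
\<close>

record ('o, 'm) cat =
  Obj :: "'o set"
  Arr :: "'m set"
  Dom :: "'m \<Rightarrow> 'o"
  Cod :: "'m \<Rightarrow> 'o"
  Id  :: "'o \<Rightarrow> 'm"
  Cmp :: "'m \<Rightarrow> 'm \<Rightarrow> 'm"  (infixl "\<odot>\<index>" 70)

definition hom :: "('o, 'm, 'z) cat_scheme \<Rightarrow> 'o \<Rightarrow> 'o \<Rightarrow> 'm set" where
  "hom C a b = {f \<in> Arr C. Dom C f = a \<and> Cod C f = b}"

locale category =
  fixes C :: "('o, 'm, 'z) cat_scheme" (structure)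
  assumes Dom_in: "f \<in> Arr C \<Longrightarrow> Dom C f \<in> Obj C"
    and Cod_in: "f \<in> Arr C \<Longrightarrow> Cod C f \<in> Obj C"
    and Id_in_hom: "a \<in> Obj C \<Longrightarrow> Id C a \<in> hom C a a"
    and Cmp_in_hom: "f \<in> hom C a b \<Longrightarrow> g \<in> hom C b c \<Longrightarrow> g \<odot> f \<in> hom C a c"
    and Cmp_Id: "f \<in> hom C a b \<Longrightarrow> f \<odot> Id C a = f"
    and Id_Cmp: "f \<in> hom C a b \<Longrightarrow> Id C b \<odot> f = f"
    and Cmp_assoc: "f \<in> hom C a b \<Longrightarrow> g \<in> hom C b c \<Longrightarrow> h \<in> hom C c d \<Longrightarrow>
                      (h \<odot> g) \<odot> f = h \<odot> (g \<odot> f)"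

definition iso_arrow :: "('o, 'm, 'z) cat_scheme \<Rightarrow> 'm \<Rightarrow> bool" where
  "iso_arrow C f \<longleftrightarrow> f \<in> Arr C \<and>
     (\<exists>g \<in> hom C (Cod C f) (Dom C f).
        g \<odot>\<^bsub>C\<^esub> f = Id C (Dom C f) \<and> f \<odot>\<^bsub>C\<^esub> g = Id C (Cod C f))"

definition isomorphic :: "('o, 'm, 'z) cat_scheme \<Rightarrow> 'o \<Rightarrow> 'o \<Rightarrow> bool" where
  "isomorphic C a b \<longleftrightarrow> (\<exists>f \<in> hom C a b. iso_arrow C f)"

definition monic :: "('o, 'm, 'z) cat_scheme \<Rightarrow> 'm \<Rightarrow> bool" where
  "monic C f \<longleftrightarrow> f \<in> Arr C \<and>
     (\<forall>x \<in> Obj C. \<forall>g \<in> hom C x (Dom C f). \<forall>h \<in> hom C x (Dom C f).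
        f \<odot>\<^bsub>C\<^esub> g = f \<odot>\<^bsub>C\<^esub> h \<longrightarrow> g = h)"

definition epi :: "('o, 'm, 'z) cat_scheme \<Rightarrow> 'm \<Rightarrow> bool" where
  "epi C f \<longleftrightarrow> f \<in> Arr C \<and>
     (\<forall>x \<in> Obj C. \<forall>g \<in> hom C (Cod C f) x. \<forall>h \<in> hom C (Cod C f) x.
        g \<odot>\<^bsub>C\<^esub> f = h \<odot>\<^bsub>C\<^esub> f \<longrightarrow> g = h)"

definition is_pullback :: "('o, 'm, 'z) cat_scheme \<Rightarrow> 'm \<Rightarrow> 'm \<Rightarrow> 'm \<Rightarrow> 'm \<Rightarrow> bool" where
  "is_pullback C p q f g \<longleftrightarrow>
     f \<in> Arr C \<and> g \<in> Arr C \<and> p \<in> Arr C \<and> q \<in> Arr C \<and>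
     Cod C f = Cod C g \<and> Dom C p = Dom C q \<and> Cod C p = Dom C f \<and> Cod C q = Dom C g \<and>
     f \<odot>\<^bsub>C\<^esub> p = g \<odot>\<^bsub>C\<^esub> q \<and>
     (\<forall>x \<in> Obj C. \<forall>s \<in> hom C x (Dom C f). \<forall>t \<in> hom C x (Dom C g).
        f \<odot>\<^bsub>C\<^esub> s = g \<odot>\<^bsub>C\<^esub> t \<longrightarrow>
        (\<exists>!h. h \<in> hom C x (Dom C p) \<and> p \<odot>\<^bsub>C\<^esub> h = s \<and> q \<odot>\<^bsub>C\<^esub> h = t))"

definition is_pushout :: "('o, 'm, 'z) cat_scheme \<Rightarrow> 'm \<Rightarrow> 'm \<Rightarrow> 'm \<Rightarrow> 'm \<Rightarrow> bool" where
  "is_pushout C p q f g \<longleftrightarrow>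
     f \<in> Arr C \<and> g \<in> Arr C \<and> p \<in> Arr C \<and> q \<in> Arr C \<and>
     Dom C f = Dom C g \<and> Cod C p = Cod C q \<and> Dom C p = Cod C f \<and> Dom C q = Cod C g \<and>
     p \<odot>\<^bsub>C\<^esub> f = q \<odot>\<^bsub>C\<^esub> g \<and>
     (\<forall>x \<in> Obj C. \<forall>s \<in> hom C (Cod C f) x. \<forall>t \<in> hom C (Cod C g) x.
        s \<odot>\<^bsub>C\<^esub> f = t \<odot>\<^bsub>C\<^esub> g \<longrightarrow>
        (\<exists>!h. h \<in> hom C (Cod C p) x \<and> h \<odot>\<^bsub>C\<^esub> p = s \<and> h \<odot>\<^bsub>C\<^esub> q = t))"

section \<open>Functors, natural transformations, colimits\<close>

record ('a, 'f, 'b, 'g) func =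
  Omap :: "'a \<Rightarrow> 'b"
  Amap :: "'f \<Rightarrow> 'g"

definition is_func ::
  "('a, 'f, 'y) cat_scheme \<Rightarrow> ('b, 'g, 'z) cat_scheme \<Rightarrow> ('a, 'f, 'b, 'g, 'w) func_scheme \<Rightarrow> bool"
where
  "is_func A B F \<longleftrightarrow>
     (\<forall>x \<in> Obj A. Omap F x \<in> Obj B \<and> Amap F (Id A x) = Id B (Omap F x)) \<and>
     (\<forall>f \<in> Arr A. Amap F f \<in> hom B (Omap F (Dom A f)) (Omap F (Cod A f))) \<and>
     (\<forall>f \<in> Arr A. \<forall>g \<in> Arr A. Cod A f = Dom A g \<longrightarrow>
        Amap F (g \<odot>\<^bsub>A\<^esub> f) = Amap F g \<odot>\<^bsub>B\<^esub> Amap F f)"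

text \<open>
  Families of arrows are extensional, so that two of them are equal as functions exactly when
  they have the same components.
\<close>

definition nat_trans ::
  "('a, 'f, 'y) cat_scheme \<Rightarrow> ('b, 'g, 'z) cat_scheme \<Rightarrow>
   ('a, 'f, 'b, 'g, 'v) func_scheme \<Rightarrow> ('a, 'f, 'b, 'g, 'w) func_scheme \<Rightarrow> ('a \<Rightarrow> 'g) \<Rightarrow> bool"
where
  "nat_trans A B F G t \<longleftrightarrow>
     t \<in> (\<Pi>\<^sub>E x \<in> Obj A. hom B (Omap F x) (Omap G x)) \<and>
     (\<forall>f \<in> Arr A. t (Cod A f) \<odot>\<^bsub>B\<^esub> Amap F f = Amap G f \<odot>\<^bsub>B\<^esub> t (Dom A f))"

definition prod_cat ::
  "('a, 'f, 'y) cat_scheme \<Rightarrow> ('b, 'g, 'z) cat_scheme \<Rightarrow> ('a \<times> 'b, 'f \<times> 'g) cat"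
where
  "prod_cat A B =
     \<lparr> Obj = Obj A \<times> Obj B, Arr = Arr A \<times> Arr B,
       Dom = map_prod (Dom A) (Dom B), Cod = map_prod (Cod A) (Cod B),
       Id = map_prod (Id A) (Id B),
       Cmp = (\<lambda>g f. (fst g \<odot>\<^bsub>A\<^esub> fst f, snd g \<odot>\<^bsub>B\<^esub> snd f)) \<rparr>"

definition snd_func :: "('a \<times> 'b, 'f \<times> 'g, 'b, 'g) func" where
  "snd_func = \<lparr> Omap = snd, Amap = snd \<rparr>"

text \<open>
  The opposite of a subset of a linear order, as a category: the unique arrow from \<open>a\<close> to \<open>b\<close>,
  present iff \<open>b \<le> a\<close>, is the pair \<open>(a, b)\<close>.
\<close>

definition op_order_cat :: "'l::linorder set \<Rightarrow> ('l, 'l \<times> 'l) cat" where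
  "op_order_cat S =
     \<lparr> Obj = S, Arr = {(a, b). a \<in> S \<and> b \<in> S \<and> b \<le> a},
       Dom = fst, Cod = snd, Id = (\<lambda>a. (a, a)), Cmp = (\<lambda>g f. (fst f, snd g)) \<rparr>"

definition is_cocone ::
  "('a, 'f, 'y) cat_scheme \<Rightarrow> ('b, 'g, 'z) cat_scheme \<Rightarrow> ('a, 'f, 'b, 'g, 'w) func_scheme \<Rightarrow>
   'b \<Rightarrow> ('a \<Rightarrow> 'g) \<Rightarrow> bool"
where
  "is_cocone J C D u c \<longleftrightarrow> u \<in> Obj C \<and> (\<forall>j \<in> Obj J. c j \<in> hom C (Omap D j) u) \<and>
     (\<forall>f \<in> Arr J. c (Cod J f) \<odot>\<^bsub>C\<^esub> Amap D f = c (Dom J f))"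

definition is_colimit ::
  "('a, 'f, 'y) cat_scheme \<Rightarrow> ('b, 'g, 'z) cat_scheme \<Rightarrow> ('a, 'f, 'b, 'g, 'w) func_scheme \<Rightarrow>
   'b \<Rightarrow> ('a \<Rightarrow> 'g) \<Rightarrow> bool"
where
  "is_colimit J C D u c \<longleftrightarrow> is_cocone J C D u c \<and>
     (\<forall>x d. is_cocone J C D x d \<longrightarrow>
        (\<exists>!h. h \<in> hom C u x \<and> (\<forall>j \<in> Obj J. h \<odot>\<^bsub>C\<^esub> c j = d j)))"

section \<open>Kernels, cokernels, proto-abelian categories\<close>

definition null_object :: "('o, 'm, 'z) cat_scheme \<Rightarrow> 'o \<Rightarrow> bool" where
  "null_object C z \<longleftrightarrow> z \<in> Obj C \<and>
     (\<forall>a \<in> Obj C. (\<exists>!f. f \<in> hom C z a) \<and> (\<exists>!f. f \<in> hom C a z))"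

definition nonzero_objects :: "('o, 'm, 'z) cat_scheme \<Rightarrow> 'o set" where
  "nonzero_objects C = {a \<in> Obj C. \<not> null_object C a}"

definition zero_arrow :: "('o, 'm, 'z) cat_scheme \<Rightarrow> 'm \<Rightarrow> bool" where
  "zero_arrow C f \<longleftrightarrow> f \<in> Arr C \<and>
     (\<exists>z g h. null_object C z \<and> g \<in> hom C (Dom C f) z \<and> h \<in> hom C z (Cod C f) \<and> f = h \<odot>\<^bsub>C\<^esub> g)"

definition is_kernel :: "('o, 'm, 'z) cat_scheme \<Rightarrow> 'm \<Rightarrow> 'm \<Rightarrow> bool" where
  "is_kernel C k f \<longleftrightarrow> f \<in> Arr C \<and> k \<in> Arr C \<and> Cod C k = Dom C f \<and> zero_arrow C (f \<odot>\<^bsub>C\<^esub> k) \<and>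
     (\<forall>g \<in> Arr C. Cod C g = Dom C f \<and> zero_arrow C (f \<odot>\<^bsub>C\<^esub> g) \<longrightarrow>
        (\<exists>!h. h \<in> hom C (Dom C g) (Dom C k) \<and> k \<odot>\<^bsub>C\<^esub> h = g))"

definition is_cokernel :: "('o, 'm, 'z) cat_scheme \<Rightarrow> 'm \<Rightarrow> 'm \<Rightarrow> bool" where
  "is_cokernel C q f \<longleftrightarrow> f \<in> Arr C \<and> q \<in> Arr C \<and> Dom C q = Cod C f \<and> zero_arrow C (q \<odot>\<^bsub>C\<^esub> f) \<and>
     (\<forall>g \<in> Arr C. Dom C g = Cod C f \<and> zero_arrow C (g \<odot>\<^bsub>C\<^esub> f) \<longrightarrow>
        (\<exists>!h. h \<in> hom C (Cod C q) (Cod C g) \<and> h \<odot>\<^bsub>C\<^esub> q = g))"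

definition strict_monic :: "('o, 'm, 'z) cat_scheme \<Rightarrow> 'm \<Rightarrow> bool" where
  "strict_monic C k \<longleftrightarrow> (\<exists>f. is_kernel C k f)"

definition strict_epi :: "('o, 'm, 'z) cat_scheme \<Rightarrow> 'm \<Rightarrow> bool" where
  "strict_epi C q \<longleftrightarrow> (\<exists>f. is_cokernel C q f)"

definition short_exact :: "('o, 'm, 'z) cat_scheme \<Rightarrow> 'm \<Rightarrow> 'm \<Rightarrow> bool" where
  "short_exact C f g \<longleftrightarrow> is_kernel C f g \<and> is_cokernel C g f"

locale category_with_kernels_cokernels = category +
  assumes ex_null_object: "\<exists>z. null_object C z"
    and ex_kernel: "f \<in> Arr C \<Longrightarrow> \<exists>k. is_kernel C k f"
    and ex_cokernel: "f \<in> Arr C \<Longrightarrow> \<exists>q. is_cokernel C q f"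

text \<open>
  The pullbacks and pushouts in the last two axioms always exist: if \<open>m\<close> is a kernel of \<open>f\<close>, then
  a kernel of \<open>f \<odot> e\<close> is a pullback of \<open>m\<close> along \<open>e\<close>, and dually.
\<close>

locale proto_abelian = category_with_kernels_cokernels +
  assumes monic_if_zero_kernel:
      "is_kernel C k f \<Longrightarrow> null_object C (Dom C k) \<Longrightarrow> monic C f"
    and epi_if_zero_cokernel:
      "is_cokernel C q f \<Longrightarrow> null_object C (Cod C q) \<Longrightarrow> epi C f"
    and pullback_strict_epi:
      "strict_epi C e \<Longrightarrow> strict_monic C m \<Longrightarrow> is_pullback C m' e' e m \<Longrightarrow> strict_epi C e'"
    and pushout_strict_monic:
      "strict_monic C m \<Longrightarrow> strict_epi C e \<Longrightarrow> is_pushout C e' m' m e \<Longrightarrow> strict_monic C m'"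

text \<open>Subobjects are represented by monics, up to factorization in both directions.\<close>

definition subobject_le :: "('o, 'm, 'z) cat_scheme \<Rightarrow> 'm \<Rightarrow> 'm \<Rightarrow> bool" where
  "subobject_le C m n \<longleftrightarrow> (\<exists>h \<in> hom C (Dom C m) (Dom C n). n \<odot>\<^bsub>C\<^esub> h = m)"

definition same_subobject :: "('o, 'm, 'z) cat_scheme \<Rightarrow> 'm \<Rightarrow> 'm \<Rightarrow> bool" where
  "same_subobject C m n \<longleftrightarrow> subobject_le C m n \<and> subobject_le C n m"

section \<open>Uniquely divisible totally ordered groups\<close>

primrec (in comm_monoid_add) nsmul :: "nat \<Rightarrow> 'a \<Rightarrow> 'a" where
  "nsmul 0 x = 0"
| "nsmul (Suc n) x = x + nsmul n x"

class uniquely_divisible_ordered_group = linordered_ab_group_add +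
  assumes uniquely_divisible: "n > 0 \<Longrightarrow> \<exists>!y. nsmul n y = x"

definition ndiv :: "'a::uniquely_divisible_ordered_group \<Rightarrow> nat \<Rightarrow> 'a" where
  "ndiv x n = (THE y. nsmul n y = x)"

section \<open>Rank functions and slope functions\<close>

text \<open>
  Functions on isomorphism classes are isomorphism-invariant functions on objects. Additivity on
  \<open>0 \<rightarrow> 0 \<rightarrow> 0 \<rightarrow> 0 \<rightarrow> 0\<close> forces null objects to have rank \<open>0\<close>.
\<close>

definition rank_function :: "('o, 'm, 'z) cat_scheme \<Rightarrow> ('o \<Rightarrow> nat) \<Rightarrow> bool" where
  "rank_function C rk \<longleftrightarrow>
     (\<forall>a \<in> Obj C. \<forall>b \<in> Obj C. isomorphic C a b \<longrightarrow> rk a = rk b) \<and>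
     (\<forall>f g. short_exact C f g \<longrightarrow> rk (Cod C f) = rk (Dom C f) + rk (Cod C g)) \<and>
     (\<forall>a \<in> Obj C. rk a = 0 \<longrightarrow> null_object C a)"

definition degree ::
  "('o, 'm, 'z) cat_scheme \<Rightarrow> ('o \<Rightarrow> nat) \<Rightarrow> ('o \<Rightarrow> 'l::uniquely_divisible_ordered_group) \<Rightarrow> 'o \<Rightarrow> 'l"
where
  "degree C rk \<mu> a = (if null_object C a then 0 else nsmul (rk a) (\<mu> a))"

definition slope_functions ::
  "('o, 'm, 'z) cat_scheme \<Rightarrow> ('o \<Rightarrow> nat) \<Rightarrow> ('o \<Rightarrow> 'l::uniquely_divisible_ordered_group) set"
where
  "slope_functions C rk = {\<mu> \<in> extensional (nonzero_objects C).
     (\<forall>a \<in> nonzero_objects C. \<forall>b \<in> nonzero_objects C. isomorphic C a b \<longrightarrow> \<mu> a = \<mu> b) \<and>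
     (\<forall>f. monic C f \<and> epi C f \<and> Dom C f \<in> nonzero_objects C \<and> Cod C f \<in> nonzero_objects C \<longrightarrow>
        \<mu> (Dom C f) \<le> \<mu> (Cod C f)) \<and>
     (\<forall>f g. short_exact C f g \<longrightarrow>
        degree C rk \<mu> (Cod C f) = degree C rk \<mu> (Dom C f) + degree C rk \<mu> (Cod C g))}"

section \<open>Slope filtrations\<close>

text \<open>
  \<open>Omap F (l, M)\<close> is the step \<open>F\<^sup>\<ge>\<^sup>l M\<close>, and \<open>Incl F (l, M)\<close> its embedding into \<open>M\<close>. Naturality of
  \<open>Incl F\<close> makes the steps decreasing in \<open>l\<close> and compatible with the morphisms of the category.
\<close>

record ('l, 'o, 'm) filt = "('l \<times> 'o, ('l \<times> 'l) \<times> 'm, 'o, 'm) func" +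
  Incl :: "'l \<times> 'o \<Rightarrow> 'm"

definition has_breaks ::
  "('o, 'm, 'z) cat_scheme \<Rightarrow> ('l::linorder, 'o, 'm) filt \<Rightarrow> 'o \<Rightarrow> bool"
where
  "has_breaks C F M \<longleftrightarrow> (\<exists>(r::nat) (l :: nat \<Rightarrow> 'l) (m :: nat \<Rightarrow> 'm).
     r \<ge> 1 \<and>
     (\<forall>i \<in> {1..<r}. l (i + 1) < l i) \<and>
     (\<forall>i \<in> {0..r}. strict_monic C (m i) \<and> Cod C (m i) = M) \<and>
     null_object C (Dom C (m 0)) \<and>
     same_subobject C (m r) (Id C M) \<and>
     (\<forall>i \<in> {0..<r}. subobject_le C (m i) (m (i + 1)) \<and> \<not> same_subobject C (m i) (m (i + 1))) \<and>
     (\<forall>t. t \<le> l r \<longrightarrow> same_subobject C (Incl F (t, M)) (Id C M)) \<and>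
     (\<forall>i \<in> {1..<r}. \<forall>t. l (i + 1) < t \<and> t \<le> l i \<longrightarrow> same_subobject C (Incl F (t, M)) (m i)) \<and>
     (\<forall>t. t > l 1 \<longrightarrow> null_object C (Omap F (t, M))))"

definition is_filtration :: "('o, 'm, 'z) cat_scheme \<Rightarrow> ('l::linorder, 'o, 'm) filt \<Rightarrow> bool" where
  "is_filtration C F \<longleftrightarrow>
     is_func (prod_cat (op_order_cat UNIV) C) C F \<and>
     nat_trans (prod_cat (op_order_cat UNIV) C) C F snd_func (Incl F) \<and>
     (\<forall>t. \<forall>M \<in> Obj C. strict_monic C (Incl F (t, M))) \<and>
     (\<forall>M \<in> nonzero_objects C. has_breaks C F M)"

definition step_diagram ::
  "('o, 'm, 'z) cat_scheme \<Rightarrow> ('l, 'o, 'm) filt \<Rightarrow> 'o \<Rightarrow> ('l, 'l \<times> 'l, 'o, 'm) func"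
where
  "step_diagram C F M =
     \<lparr> Omap = (\<lambda>t. Omap F (t, M)), Amap = (\<lambda>a. Amap F (a, Id C M)) \<rparr>"

text \<open>
  The object \<open>U\<close> is a colimit of the steps above \<open>t\<close>, and \<open>u\<close> is its canonical arrow to the step
  at \<open>t\<close>.
\<close>

definition is_graded_piece ::
  "('o, 'm, 'z) cat_scheme \<Rightarrow> ('l::linorder, 'o, 'm) filt \<Rightarrow> 'l \<Rightarrow> 'o \<Rightarrow> 'o \<Rightarrow> bool"
where
  "is_graded_piece C F t M Q \<longleftrightarrow> (\<exists>U c u q.
     is_colimit (op_order_cat {t<..}) C (step_diagram C F M) U c \<and>
     u \<in> hom C U (Omap F (t, M)) \<and>
     (\<forall>s > t. u \<odot>\<^bsub>C\<^esub> c s = Amap F ((s, t), Id C M)) \<and>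
     short_exact C u q \<and> Cod C q = Q)"

definition graded_rank ::
  "('o, 'm, 'z) cat_scheme \<Rightarrow> ('o \<Rightarrow> nat) \<Rightarrow> ('l::linorder, 'o, 'm) filt \<Rightarrow> 'o \<Rightarrow> 'l \<Rightarrow> nat"
where
  "graded_rank C rk F M t = rk (SOME Q. is_graded_piece C F t M Q)"

definition filt_degree ::
  "('o, 'm, 'z) cat_scheme \<Rightarrow> ('o \<Rightarrow> nat) \<Rightarrow>
   ('l::uniquely_divisible_ordered_group, 'o, 'm) filt \<Rightarrow> 'o \<Rightarrow> 'l"
where
  "filt_degree C rk F M =
     (\<Sum>t | graded_rank C rk F M t \<noteq> 0. nsmul (graded_rank C rk F M t) t)"

definition filt_slope ::
  "('o, 'm, 'z) cat_scheme \<Rightarrow> ('o \<Rightarrow> nat) \<Rightarrow>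
   ('l::uniquely_divisible_ordered_group, 'o, 'm) filt \<Rightarrow> 'o \<Rightarrow> 'l"
where
  "filt_slope C rk F = (\<lambda>M \<in> nonzero_objects C. ndiv (filt_degree C rk F M) (rk M))"

text \<open>
  The filtration induced on a strict subobject consists of the intersections (pullbacks) with the
  steps of the ambient object.
\<close>

definition induced_on_sub ::
  "('o, 'm, 'z) cat_scheme \<Rightarrow> ('l, 'o, 'm) filt \<Rightarrow> 'm \<Rightarrow> bool"
where
  "induced_on_sub C F m \<longleftrightarrow>
     (\<forall>s. \<exists>h. is_pullback C (Incl F (s, Dom C m)) h m (Incl F (s, Cod C m)))"

text \<open>
  The filtration induced on a strict quotient consists of the images of the steps of the ambient
  object, where the image of an arrow is the kernel of its cokernel.
\<close>

definition is_image :: "('o, 'm, 'z) cat_scheme \<Rightarrow> 'm \<Rightarrow> 'm \<Rightarrow> bool" where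
  "is_image C k f \<longleftrightarrow> (\<exists>c. is_cokernel C c f \<and> is_kernel C k c)"

definition induced_on_quotient ::
  "('o, 'm, 'z) cat_scheme \<Rightarrow> ('l, 'o, 'm) filt \<Rightarrow> 'm \<Rightarrow> bool"
where
  "induced_on_quotient C F q \<longleftrightarrow>
     (\<forall>s. is_image C (Incl F (s, Cod C q)) (q \<odot>\<^bsub>C\<^esub> Incl F (s, Dom C q)))"

definition slope_filtrations ::
  "('o, 'm, 'z) cat_scheme \<Rightarrow> ('o \<Rightarrow> nat) \<Rightarrow>
   ('l::uniquely_divisible_ordered_group, 'o, 'm) filt set"
where
  "slope_filtrations C rk = {F. is_filtration C F \<and>
     (\<forall>t. \<forall>N \<in> Obj C. induced_on_sub C F (Incl F (t, N)) \<and>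
        (\<forall>q. is_cokernel C q (Incl F (t, N)) \<longrightarrow> induced_on_quotient C F q)) \<and>
     filt_slope C rk F \<in> slope_functions C rk}"

definition filt_iso ::
  "('o, 'm, 'z) cat_scheme \<Rightarrow> ('l::linorder, 'o, 'm) filt \<Rightarrow> ('l, 'o, 'm) filt \<Rightarrow>
   ('l \<times> 'o \<Rightarrow> 'm) \<Rightarrow> bool"
where
  "filt_iso C F G \<phi> \<longleftrightarrow>
     nat_trans (prod_cat (op_order_cat UNIV) C) C F G \<phi> \<and>
     (\<forall>t. \<forall>M \<in> Obj C. iso_arrow C (\<phi> (t, M)) \<and> Incl G (t, M) \<odot>\<^bsub>C\<^esub> \<phi> (t, M) = Incl F (t, M))"

definition slope_filtration_iso_rel ::
  "('o, 'm, 'z) cat_scheme \<Rightarrow> ('o \<Rightarrow> nat) \<Rightarrow>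
   ('l::uniquely_divisible_ordered_group, 'o, 'm) filt rel"
where
  "slope_filtration_iso_rel C rk =
     {(F, G). F \<in> slope_filtrations C rk \<and> G \<in> slope_filtrations C rk \<and> (\<exists>\<phi>. filt_iso C F G \<phi>)}"

end

theory Submission
  imports Defs
begin

text \<open>
  Fix a slope function \<open>\<mu>\<close> and \<open>t\<close> in \<open>\<Lambda>\<close>. The objects all of whose non-zero quotients have
  slope at least \<open>t\<close> are closed under epis and extensions, so they are the torsion class of a
  torsion pair; every object \<open>M\<close> has a largest strict subobject in that class, through which every
  arrow from the class to \<open>M\<close> factors, and the non-zero torsion-free objects have slope less than
  \<open>t\<close>. By induction on the rank every non-zero object has a quotient of least slope; this makes
  the torsion parts left continuous in \<open>t\<close> with finitely many breaks, and the graded pieces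
  at \<open>t\<close> have slope exactly \<open>t\<close>, so that this filtration has slope function \<open>\<mu>\<close>.
  Conversely, the steps of a slope filtration with slope function \<open>\<mu>\<close> are torsion parts, hence
  determined by \<open>\<mu>\<close> up to unique isomorphism: an object with \<open>F\<^sup>\<ge>\<^sup>t M = M\<close> has slope at least \<open>t\<close>,
  and one with \<open>F\<^sup>\<ge>\<^sup>t M = 0\<close> has slope less than \<open>t\<close>.

  Epi-monics need not preserve the rank, so slopes and degrees are only compared along strict
  arrows; inequality (1) of slope functions enters once, in passing from arbitrary to strict quotients.
\<close>

text \<open>The image of an arrow is reached by an epi that need not be strict. The torsion class
  therefore has to be closed under arbitrary epis, and its defining condition ranges over all of
  them; the price is that a quotient violating the condition must be replaced by a strict one before
  additivity of degrees applies. Ranks replace finiteness conditions on lattices of subobjects: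
  nested strict subobjects of equal rank coincide, so greatest subobjects arise by maximizing a
  natural number, and inductions run on the rank. \<open>\<Lambda>\<close> need not be complete, so
  the least slope of a quotient has to be exhibited as an attained value and cannot be taken as an
  infimum. Slopes are compared through their multiples by the rank: degrees add along exact
  sequences and make sense on null objects, where \<open>\<mu>\<close> carries no information. The
  colimits behind the graded pieces are only needed where the steps just above \<open>t\<close> are
  all isomorphic or all null, and there they are read off from the steps.\<close>

section \<open>Multiples in a divisible ordered group, and finite sets in decreasing order\<close>

lemma nsmul_add: "nsmul (m + n) x = nsmul m x + nsmul n (x::'a::comm_monoid_add)"
  by (induction m) (auto simp: ac_simps)

lemma nsmul_mono: "x \<le> y \<Longrightarrow> nsmul n x \<le> nsmul n (y::'a::linordered_ab_group_add)"
  by (induction n) (auto intro: add_mono)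

lemma nsmul_strict_mono: "x < y \<Longrightarrow> n > 0 \<Longrightarrow> nsmul n x < nsmul n (y::'a::linordered_ab_group_add)"
  by (induction n) (auto intro: add_less_le_mono nsmul_mono less_imp_le)

lemma nsmul_le_iff: "n > 0 \<Longrightarrow> nsmul n x \<le> nsmul n y \<longleftrightarrow> x \<le> (y::'a::linordered_ab_group_add)"
  by (meson leD leI nsmul_mono nsmul_strict_mono)

lemma nsmul_eq_iff: "n > 0 \<Longrightarrow> nsmul n x = nsmul n y \<longleftrightarrow> x = (y::'a::linordered_ab_group_add)"
  by (metis nsmul_le_iff order_antisym order_refl)

lemma nsmul_ndiv: "n > 0 \<Longrightarrow> nsmul n (ndiv x n) = x"
  unfolding ndiv_def using uniquely_divisible[of n x] by (rule theI')

lemma nsmul_sum_left: "nsmul (\<Sum>i\<in>A. f i) x = (\<Sum>i\<in>A. nsmul (f i) x)"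
  by (induction A rule: infinite_finite_induct) (auto simp: nsmul_add)

text \<open>Turns a finite set of breaks into the decreasing sequence that \<open>has_breaks\<close>
  asks for.\<close>

lemma enumerate_decreasing:
  fixes B :: "'l::linorder set"
  assumes "finite B" "B \<noteq> {}"
  obtains r :: nat and l where "1 \<le> r" "l ` {1..r} = B"
    "\<And>i j. 1 \<le> i \<Longrightarrow> i < j \<Longrightarrow> j \<le> r \<Longrightarrow> l j < l i"
proof -
  let ?xs = "rev (sorted_list_of_set B)"
  let ?r = "length ?xs"
  \<comment> \<open>Lists are indexed from 0, breaks from 1.\<close>
  let ?l = "\<lambda>i. ?xs ! (i - 1)"
  have "sorted_wrt (>) ?xs"
    using strict_sorted_list_of_set[of B] by (simp add: sorted_wrt_rev)
  then have "?l j < ?l i" if "1 \<le> i" "i < j" "j \<le> ?r" for i j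
    using that by (intro sorted_wrt_nth_less[of "(>)" ?xs]) auto
  moreover have "?l ` {1..?r} = B"
  proof -
    have "?l ` {1..?r} = set ?xs"
      unfolding set_conv_nth by (force intro: image_eqI[of _ _ "Suc _"])
    then show ?thesis using assms by simp
  qed
  moreover have "1 \<le> ?r" using assms by (simp add: Suc_le_eq card_gt_0_iff)
  ultimately show ?thesis using that by blast
qed

section \<open>Arrows, kernels and subobjects\<close>

lemma hom_self: "f \<in> Arr C \<Longrightarrow> f \<in> hom C (Dom C f) (Cod C f)"
  by (simp add: hom_def)

context category
begin

lemma monic_in_Arr: "monic C f \<Longrightarrow> f \<in> Arr C"
  by (simp add: monic_def)

lemma epi_in_Arr: "epi C f \<Longrightarrow> f \<in> Arr C"
  by (simp add: epi_def)

lemma zero_arrow_in_Arr: "zero_arrow C f \<Longrightarrow> f \<in> Arr C"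
  by (simp add: zero_arrow_def)

lemma null_in_Obj: "null_object C z \<Longrightarrow> z \<in> Obj C"
  by (simp add: null_object_def)

lemma kernel_in_hom:
  "is_kernel C k f \<Longrightarrow> k \<in> hom C (Dom C k) (Dom C f)" "is_kernel C k f \<Longrightarrow> f \<in> Arr C"
  by (auto simp: is_kernel_def hom_def)

lemma cokernel_in_hom:
  "is_cokernel C q f \<Longrightarrow> q \<in> hom C (Cod C f) (Cod C q)" "is_cokernel C q f \<Longrightarrow> f \<in> Arr C"
  by (auto simp: is_cokernel_def hom_def)

lemma kernel_zero: "is_kernel C k f \<Longrightarrow> zero_arrow C (f \<odot> k)"
  by (simp add: is_kernel_def)

lemma cokernel_zero: "is_cokernel C q f \<Longrightarrow> zero_arrow C (q \<odot> f)"
  by (simp add: is_cokernel_def)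

lemma kernel_lift:
  assumes "is_kernel C k f" "g \<in> hom C x (Dom C f)" "zero_arrow C (f \<odot> g)"
  obtains h where "h \<in> hom C x (Dom C k)" "k \<odot> h = g"
  using assms unfolding is_kernel_def hom_def by blast

lemma cokernel_desc:
  assumes "is_cokernel C q f" "g \<in> hom C (Cod C f) x" "zero_arrow C (g \<odot> f)"
  obtains h where "h \<in> hom C (Cod C q) x" "h \<odot> q = g"
  using assms unfolding is_cokernel_def hom_def by blast

lemma homD:
  assumes "f \<in> hom C a b"
  shows "f \<in> Arr C" "Dom C f = a" "Cod C f = b" "a \<in> Obj C" "b \<in> Obj C"
  using assms Dom_in Cod_in by (auto simp: hom_def)

lemma Id_simps [simp]:
  assumes "a \<in> Obj C"
  shows "Id C a \<in> Arr C" "Dom C (Id C a) = a" "Cod C (Id C a) = a"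
  using Id_in_hom[OF assms] by (auto simp: hom_def)

lemma Cmp_simps [simp]:
  assumes "f \<in> Arr C" "g \<in> Arr C" "Cod C f = Dom C g"
  shows "g \<odot> f \<in> Arr C" "Dom C (g \<odot> f) = Dom C f" "Cod C (g \<odot> f) = Cod C g"
  using Cmp_in_hom[of f "Dom C f" "Cod C f" g "Cod C g"] assms by (auto simp: hom_def)

lemma Cmp_Id_Dom [simp]: "f \<in> Arr C \<Longrightarrow> f \<odot> Id C (Dom C f) = f"
  and Id_Cod_Cmp [simp]: "f \<in> Arr C \<Longrightarrow> Id C (Cod C f) \<odot> f = f"
  using Cmp_Id[OF hom_self] Id_Cmp[OF hom_self] by auto

lemma Cmp_assoc_Arr:
  assumes "f \<in> Arr C" "g \<in> Arr C" "h \<in> Arr C" "Cod C f = Dom C g" "Cod C g = Dom C h"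
  shows "(h \<odot> g) \<odot> f = h \<odot> (g \<odot> f)"
  using Cmp_assoc[of f "Dom C f" "Dom C g" g "Dom C h" h "Cod C h"] assms by (auto simp: hom_def)

lemma monic_cancel:
  assumes "monic C m" "g \<in> hom C x (Dom C m)" "h \<in> hom C x (Dom C m)" "m \<odot> g = m \<odot> h"
  shows "g = h"
  using assms homD(4)[OF assms(2)] unfolding monic_def by blast

lemma epi_cancel:
  assumes "epi C e" "g \<in> hom C (Cod C e) x" "h \<in> hom C (Cod C e) x" "g \<odot> e = h \<odot> e"
  shows "g = h"
  using assms homD(5)[OF assms(2)] unfolding epi_def by blast

lemma epi_Cmp:
  assumes "epi C f" "epi C g" "Cod C f = Dom C g"
  shows "epi C (g \<odot> f)"
  unfolding epi_def
proof (intro conjI ballI impI)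
  note [simp] = epi_in_Arr[OF assms(1)] epi_in_Arr[OF assms(2)] assms(3)
  show "g \<odot> f \<in> Arr C" by simp
  fix x s t
  assume "x \<in> Obj C" "s \<in> hom C (Cod C (g \<odot> f)) x" "t \<in> hom C (Cod C (g \<odot> f)) x"
    and eq: "s \<odot> (g \<odot> f) = t \<odot> (g \<odot> f)"
  then have s: "s \<in> hom C (Cod C g) x" and t: "t \<in> hom C (Cod C g) x" by auto
  have "(s \<odot> g) \<odot> f = (t \<odot> g) \<odot> f"
    using eq homD(1-3)[OF s] homD(1-3)[OF t] by (simp add: Cmp_assoc_Arr)
  then have "s \<odot> g = t \<odot> g"
    using epi_cancel[OF assms(1), of "s \<odot> g" x "t \<odot> g"] homD(1-3)[OF s] homD(1-3)[OF t]
    by (simp add: hom_def)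
  then show "s = t" using epi_cancel[OF assms(2) s t] by blast
qed

lemma epi_CmpD:
  assumes "epi C (g \<odot> f)" "f \<in> Arr C" "g \<in> Arr C" "Cod C f = Dom C g"
  shows "epi C g"
  unfolding epi_def
proof (intro conjI ballI impI)
  note [simp] = assms(2-4)
  show "g \<in> Arr C" by simp
  fix x s t
  assume "x \<in> Obj C" and s: "s \<in> hom C (Cod C g) x" and t: "t \<in> hom C (Cod C g) x"
    and eq: "s \<odot> g = t \<odot> g"
  have "s \<odot> (g \<odot> f) = t \<odot> (g \<odot> f)"
    using eq homD(1-3)[OF s] homD(1-3)[OF t] by (simp flip: Cmp_assoc_Arr)
  then show "s = t" using epi_cancel[OF assms(1), of s x t] s t by simp
qed

lemma monic_CmpD:
  assumes "monic C (g \<odot> f)" "f \<in> Arr C" "g \<in> Arr C" "Cod C f = Dom C g"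
  shows "monic C f"
  unfolding monic_def
proof (intro conjI ballI impI)
  note [simp] = assms(2-4)
  show "f \<in> Arr C" by simp
  fix x s t
  assume "x \<in> Obj C" and s: "s \<in> hom C x (Dom C f)" and t: "t \<in> hom C x (Dom C f)"
    and eq: "f \<odot> s = f \<odot> t"
  have "(g \<odot> f) \<odot> s = (g \<odot> f) \<odot> t"
    using eq homD(1-3)[OF s] homD(1-3)[OF t] by (simp add: Cmp_assoc_Arr)
  then show "s = t" using monic_cancel[OF assms(1), of s x t] s t by simp
qed

lemma iso_arrowI:
  assumes "f \<in> hom C a b" "g \<in> hom C b a" "g \<odot> f = Id C a" "f \<odot> g = Id C b"
  shows "iso_arrow C f"
  using assms unfolding iso_arrow_def hom_def by auto

lemma iso_arrowE:
  assumes "iso_arrow C f"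
  obtains g where "g \<in> hom C (Cod C f) (Dom C f)"
    "g \<odot> f = Id C (Dom C f)" "f \<odot> g = Id C (Cod C f)"
  using assms unfolding iso_arrow_def by auto

lemma epi_Id: "a \<in> Obj C \<Longrightarrow> epi C (Id C a)"
  unfolding epi_def using Cmp_Id by auto

lemma monic_Id: "a \<in> Obj C \<Longrightarrow> monic C (Id C a)"
  unfolding monic_def using Id_Cmp by auto

lemma iso_epi: "iso_arrow C f \<Longrightarrow> epi C f"
  by (metis epi_CmpD epi_Id homD iso_arrowE iso_arrow_def)

section \<open>Null objects and zero arrows\<close>

lemma null_from:
  assumes "null_object C z" "a \<in> Obj C" obtains f where "f \<in> hom C z a"
  using assms unfolding null_object_def by blast

lemma null_to:
  assumes "null_object C z" "a \<in> Obj C" obtains f where "f \<in> hom C a z"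
  using assms unfolding null_object_def by blast

lemma null_terminal: "null_object C z \<Longrightarrow> f \<in> hom C a z \<Longrightarrow> g \<in> hom C a z \<Longrightarrow> f = g"
  using homD(4)[of f a z] unfolding null_object_def by blast

lemma null_initial: "null_object C z \<Longrightarrow> f \<in> hom C z a \<Longrightarrow> g \<in> hom C z a \<Longrightarrow> f = g"
  using homD(5)[of f z a] unfolding null_object_def by blast

text \<open>The two factorizations may pass through different null objects; the arrow
  \<open>k\<close> between these carries one factorization to the other.\<close>

lemma zero_arrow_unique:
  assumes "zero_arrow C f" "zero_arrow C f'" "f \<in> hom C a b" "f' \<in> hom C a b"
  shows "f = f'"
proof -
  obtain z g h where z: "null_object C z" and g: "g \<in> hom C a z" and h: "h \<in> hom C z b"
    and f: "f = h \<odot> g"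
    using assms(1,3) unfolding zero_arrow_def hom_def by auto
  obtain z' g' h' where z': "null_object C z'" and g': "g' \<in> hom C a z'" and h': "h' \<in> hom C z' b"
    and f': "f' = h' \<odot> g'"
    using assms(2,4) unfolding zero_arrow_def hom_def by auto
  obtain k where k: "k \<in> hom C z z'" using null_from[OF z] null_in_Obj[OF z'] by blast
  have "g' = k \<odot> g" using null_terminal[OF z' g'] Cmp_in_hom[OF g k] by blast
  moreover have "h = h' \<odot> k" using null_initial[OF z h] Cmp_in_hom[OF k h'] by blast
  ultimately show ?thesis using f f' Cmp_assoc[OF g k h'] by simp
qed

lemma zero_arrow_null_Dom:
  assumes "f \<in> Arr C" "null_object C (Dom C f)" shows "zero_arrow C f"
  unfolding zero_arrow_def using assms
  by (metis Cmp_Id_Dom Id_in_hom null_in_Obj hom_self)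

lemma zero_arrow_null_Cod:
  assumes "f \<in> Arr C" "null_object C (Cod C f)" shows "zero_arrow C f"
  unfolding zero_arrow_def using assms
  by (metis Id_Cod_Cmp Id_in_hom null_in_Obj hom_self)

lemma zero_arrow_Cmp_left:
  assumes "zero_arrow C f" "g \<in> Arr C" "Cod C f = Dom C g"
  shows "zero_arrow C (g \<odot> f)"
proof -
  obtain z u v where z: "null_object C z" and u: "u \<in> hom C (Dom C f) z"
    and v: "v \<in> hom C z (Cod C f)" and f: "f = v \<odot> u" and fA: "f \<in> Arr C"
    using assms(1) unfolding zero_arrow_def by auto
  have "g \<odot> f = (g \<odot> v) \<odot> u"
    unfolding f using homD(1-3)[OF u] homD(1-3)[OF v] assms(2,3) by (simp add: Cmp_assoc_Arr)
  moreover have "g \<odot> v \<in> hom C z (Cod C g)"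
    using homD(1-3)[OF v] assms(2,3) by (simp add: hom_def)
  ultimately show ?thesis
    unfolding zero_arrow_def using z u fA assms(2,3) Cmp_simps by metis
qed

lemma zero_arrow_Cmp_right:
  assumes "zero_arrow C g" "f \<in> Arr C" "Cod C f = Dom C g"
  shows "zero_arrow C (g \<odot> f)"
proof -
  obtain z u v where z: "null_object C z" and u: "u \<in> hom C (Dom C g) z"
    and v: "v \<in> hom C z (Cod C g)" and g: "g = v \<odot> u" and gA: "g \<in> Arr C"
    using assms(1) unfolding zero_arrow_def by auto
  have "g \<odot> f = v \<odot> (u \<odot> f)"
    unfolding g using homD(1-3)[OF u] homD(1-3)[OF v] assms(2,3) by (simp add: Cmp_assoc_Arr)
  moreover have "u \<odot> f \<in> hom C (Dom C f) z"
    using homD(1-3)[OF u] assms(2,3) by (simp add: hom_def)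
  ultimately show ?thesis
    unfolding zero_arrow_def using z v gA assms(2,3) Cmp_simps by metis
qed

lemma zero_arrow_exists:
  assumes "null_object C z" "a \<in> Obj C" "b \<in> Obj C"
  obtains f where "f \<in> hom C a b" "zero_arrow C f"
proof -
  obtain g where g: "g \<in> hom C a z" using null_to assms by blast
  obtain h where h: "h \<in> hom C z b" using null_from assms by blast
  have "zero_arrow C h" using zero_arrow_null_Dom homD[OF h] assms(1) by blast
  then have "zero_arrow C (h \<odot> g)" using zero_arrow_Cmp_right homD[OF g] homD[OF h] by simp
  then show ?thesis using that Cmp_in_hom[OF g h] by blast
qed

lemma zero_arrow_null:
  assumes "zero_arrow C f" obtains z where "null_object C z"
  using assms unfolding zero_arrow_def by blast

text \<open>Cancellation is applied to \<open>f\<close> and a parallel zero arrow \<open>o'\<close>: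
  after composition with \<open>m\<close> both become zero arrows, hence equal.\<close>

lemma monic_zero_cancel:
  assumes "monic C m" "f \<in> hom C a (Dom C m)" "zero_arrow C (m \<odot> f)"
  shows "zero_arrow C f"
proof -
  note m = monic_in_Arr[OF assms(1)]
  obtain z where "null_object C z" using zero_arrow_null[OF assms(3)] .
  then obtain o' where o': "o' \<in> hom C a (Dom C m)" "zero_arrow C o'"
    using zero_arrow_exists homD(4,5)[OF assms(2)] by blast
  have "m \<odot> o' = m \<odot> f"
    using zero_arrow_unique[OF zero_arrow_Cmp_left[OF o'(2) m] assms(3)] homD[OF o'(1)]
      Cmp_in_hom[OF o'(1) hom_self[OF m]] Cmp_in_hom[OF assms(2) hom_self[OF m]] by simp
  then show ?thesis using monic_cancel[OF assms(1) o'(1) assms(2)] o'(2) by simp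
qed

lemma epi_zero_cancel:
  assumes "epi C e" "f \<in> hom C (Cod C e) b" "zero_arrow C (f \<odot> e)"
  shows "zero_arrow C f"
proof -
  note e = epi_in_Arr[OF assms(1)]
  obtain z where "null_object C z" using zero_arrow_null[OF assms(3)] .
  then obtain o' where o': "o' \<in> hom C (Cod C e) b" "zero_arrow C o'"
    using zero_arrow_exists homD(4,5)[OF assms(2)] by blast
  have "zero_arrow C (o' \<odot> e)" using zero_arrow_Cmp_right o' e homD(2) by metis
  then have "o' \<odot> e = f \<odot> e"
    using zero_arrow_unique[OF _ assms(3) Cmp_in_hom[OF hom_self[OF e] o'(1)]
      Cmp_in_hom[OF hom_self[OF e] assms(2)]] by blast
  then show ?thesis using epi_cancel[OF assms(1) o'(1) assms(2)] o'(2) by simp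
qed

text \<open>An arrow into or out of \<open>a\<close> is its own composite with the identity, hence a
  zero arrow, and parallel zero arrows are equal.\<close>

lemma null_if_zero_Id:
  assumes "a \<in> Obj C" "zero_arrow C (Id C a)" shows "null_object C a"
proof -
  obtain z where z: "null_object C z" using zero_arrow_null[OF assms(2)] .
  have from_a: "zero_arrow C f" if "f \<in> hom C a b" for f b
    using zero_arrow_Cmp_right[OF assms(2), of f] zero_arrow_Cmp_left[OF assms(2), of f] homD[OF that] assms
    by auto
  have to_a: "zero_arrow C f" if "f \<in> hom C b a" for f b
    using zero_arrow_Cmp_right[OF assms(2), of f] homD[OF that] assms by auto
  show ?thesis
    unfolding null_object_def
  proof (intro conjI ballI ex_ex1I)
    fix b assume b: "b \<in> Obj C"
    show "\<exists>f. f \<in> hom C a b" using zero_arrow_exists[OF z assms(1) b] by blast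
    show "\<exists>f. f \<in> hom C b a" using zero_arrow_exists[OF z b assms(1)] by blast
    show "f = g" if "f \<in> hom C a b" "g \<in> hom C a b" for f g
      using zero_arrow_unique[OF from_a[OF that(1)] from_a[OF that(2)] that] .
    show "f = g" if "f \<in> hom C b a" "g \<in> hom C b a" for f g
      using zero_arrow_unique[OF to_a[OF that(1)] to_a[OF that(2)] that] .
  qed (fact assms)
qed

lemma zero_monic_null:
  assumes "zero_arrow C f" "monic C f" shows "null_object C (Dom C f)"
proof -
  have f: "f \<in> Arr C" using assms zero_arrow_in_Arr by blast
  have "zero_arrow C (Id C (Dom C f))"
    by (rule monic_zero_cancel[OF assms(2) Id_in_hom]) (use f assms Dom_in in auto)
  then show ?thesis using null_if_zero_Id f Dom_in by blast
qed

lemma zero_epi_null: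
  assumes "zero_arrow C f" "epi C f" shows "null_object C (Cod C f)"
proof -
  have f: "f \<in> Arr C" using assms zero_arrow_in_Arr by blast
  have "zero_arrow C (Id C (Cod C f))"
    by (rule epi_zero_cancel[OF assms(2) Id_in_hom]) (use f assms Cod_in in auto)
  then show ?thesis using null_if_zero_Id f Cod_in by blast
qed

lemma epi_null_Cod: "epi C f \<Longrightarrow> null_object C (Dom C f) \<Longrightarrow> null_object C (Cod C f)"
  using zero_epi_null zero_arrow_null_Dom epi_in_Arr by blast

lemma null_isomorphic:
  assumes "isomorphic C a b" shows "null_object C a \<longleftrightarrow> null_object C b"
proof -
  obtain f g where f: "f \<in> hom C a b" and g: "g \<in> hom C b a" and "g \<odot> f = Id C a" "f \<odot> g = Id C b"
    using assms unfolding isomorphic_def using iso_arrowE homD by metis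
  then have "epi C f" "epi C g" using iso_epi iso_arrowI by blast+
  then show ?thesis using epi_null_Cod homD[OF f] homD[OF g] by metis
qed

section \<open>Kernels, cokernels and strict arrows\<close>

text \<open>Only existence of lifts has to be checked; their uniqueness is the monicity of
  \<open>k\<close>.\<close>

lemma is_kernelI:
  assumes "f \<in> Arr C" "monic C k" "Cod C k = Dom C f" "zero_arrow C (f \<odot> k)"
    and lift: "\<And>x g. g \<in> hom C x (Dom C f) \<Longrightarrow> zero_arrow C (f \<odot> g) \<Longrightarrow>
      \<exists>h \<in> hom C x (Dom C k). k \<odot> h = g"
  shows "is_kernel C k f"
  unfolding is_kernel_def
proof (intro conjI ballI impI)
  fix g assume g: "g \<in> Arr C" "Cod C g = Dom C f \<and> zero_arrow C (f \<odot> g)"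
  then have "g \<in> hom C (Dom C g) (Dom C f)" by (simp add: hom_def)
  with lift g show "\<exists>!h. h \<in> hom C (Dom C g) (Dom C k) \<and> k \<odot> h = g"
    using monic_cancel[OF assms(2)] by metis
qed (use assms monic_in_Arr in auto)

lemma is_cokernelI:
  assumes "f \<in> Arr C" "epi C q" "Dom C q = Cod C f" "zero_arrow C (q \<odot> f)"
    and desc: "\<And>x g. g \<in> hom C (Cod C f) x \<Longrightarrow> zero_arrow C (g \<odot> f) \<Longrightarrow>
      \<exists>h \<in> hom C (Cod C q) x. h \<odot> q = g"
  shows "is_cokernel C q f"
  unfolding is_cokernel_def
proof (intro conjI ballI impI)
  fix g assume g: "g \<in> Arr C" "Dom C g = Cod C f \<and> zero_arrow C (g \<odot> f)"
  then have "g \<in> hom C (Cod C f) (Cod C g)" by (simp add: hom_def)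
  with desc g show "\<exists>!h. h \<in> hom C (Cod C q) (Cod C g) \<and> h \<odot> q = g"
    using epi_cancel[OF assms(2)] by metis
qed (use assms epi_in_Arr in auto)

lemma kernel_monic: assumes "is_kernel C k f" shows "monic C k"
  unfolding monic_def
proof (intro conjI ballI impI)
  have k: "k \<in> Arr C" "Cod C k = Dom C f" "f \<in> Arr C" using assms by (auto simp: is_kernel_def)
  then show "k \<in> Arr C" by simp
  fix x g h
  assume g: "g \<in> hom C x (Dom C k)" and h: "h \<in> hom C x (Dom C k)" and eq: "k \<odot> g = k \<odot> h"
  note gs = homD(1-3)[OF g]
  have "zero_arrow C (f \<odot> (k \<odot> g))"
    using zero_arrow_Cmp_right[OF kernel_zero[OF assms], of g] gs k by (simp add: Cmp_assoc_Arr)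
  moreover have "k \<odot> g \<in> Arr C" "Cod C (k \<odot> g) = Dom C f" "Dom C (k \<odot> g) = x" using gs k by auto
  ultimately have "\<exists>!h. h \<in> hom C x (Dom C k) \<and> k \<odot> h = k \<odot> g"
    using assms unfolding is_kernel_def by metis
  then show "g = h" using g h eq by metis
qed

lemma cokernel_epi: assumes "is_cokernel C q f" shows "epi C q"
  unfolding epi_def
proof (intro conjI ballI impI)
  have q: "q \<in> Arr C" "Dom C q = Cod C f" "f \<in> Arr C" using assms by (auto simp: is_cokernel_def)
  then show "q \<in> Arr C" by simp
  fix x g h
  assume g: "g \<in> hom C (Cod C q) x" and h: "h \<in> hom C (Cod C q) x" and eq: "g \<odot> q = h \<odot> q"
  note gs = homD(1-3)[OF g]
  have "zero_arrow C ((g \<odot> q) \<odot> f)"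
    using zero_arrow_Cmp_left[OF cokernel_zero[OF assms], of g] gs q by (simp add: Cmp_assoc_Arr)
  moreover have "g \<odot> q \<in> Arr C" "Dom C (g \<odot> q) = Cod C f" "Cod C (g \<odot> q) = x" using gs q by auto
  ultimately have "\<exists>!h. h \<in> hom C (Cod C q) x \<and> h \<odot> q = g \<odot> q"
    using assms unfolding is_cokernel_def by metis
  then show "g = h" using g h eq by metis
qed

lemma strict_monic_monic: "strict_monic C m \<Longrightarrow> monic C m"
  using kernel_monic unfolding strict_monic_def by blast

lemma strict_epi_epi: "strict_epi C q \<Longrightarrow> epi C q"
  using cokernel_epi unfolding strict_epi_def by blast

text \<open>If \<open>m\<close> is a kernel of \<open>f\<close>, then \<open>f\<close> factors
  through the cokernel \<open>c\<close>, so whatever \<open>c\<close> kills is killed by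
  \<open>f\<close> and lifts to \<open>m\<close>. This is what makes every strict monic part of a
  short exact sequence.\<close>

lemma strict_monic_kernel_cokernel:
  assumes "strict_monic C m" "is_cokernel C c m" shows "is_kernel C m c"
proof -
  obtain f where f: "is_kernel C m f" using assms(1) strict_monic_def by metis
  have m: "m \<in> Arr C" "f \<in> hom C (Cod C m) (Cod C f)"
    using kernel_in_hom[OF f] by (auto simp: hom_def)
  obtain h where h: "h \<in> hom C (Cod C c) (Cod C f)" "h \<odot> c = f"
    using cokernel_desc[OF assms(2) m(2) kernel_zero[OF f]] .
  note c = cokernel_in_hom[OF assms(2)]
  show ?thesis
  proof (rule is_kernelI)
    fix x g assume "g \<in> hom C x (Dom C c)" and z: "zero_arrow C (c \<odot> g)"
    then have g: "g \<in> hom C x (Dom C f)" using homD[OF c(1)] homD[OF m(2)] by simp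
    have "f \<odot> g = h \<odot> (c \<odot> g)"
      using h homD[OF c(1)] homD[OF g] homD[OF h(1)] homD[OF m(2)] Cmp_assoc_Arr[of g c h] by simp
    then have "zero_arrow C (f \<odot> g)"
      using zero_arrow_Cmp_left[OF z, of h] h homD[OF c(1)] homD[OF g] homD[OF h(1)] homD[OF m(2)]
      by simp
    then show "\<exists>h \<in> hom C x (Dom C m). m \<odot> h = g" using kernel_lift[OF f g] by blast
  qed (use homD[OF c(1)] assms cokernel_zero strict_monic_monic in auto)
qed

lemma strict_epi_cokernel_kernel:
  assumes "strict_epi C e" "is_kernel C k e" shows "is_cokernel C e k"
proof -
  obtain f where f: "is_cokernel C e f" using assms(1) strict_epi_def by metis
  have e: "e \<in> Arr C" "f \<in> hom C (Dom C f) (Dom C e)"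
    using cokernel_in_hom[OF f] by (auto simp: hom_def)
  obtain h where h: "h \<in> hom C (Dom C f) (Dom C k)" "k \<odot> h = f"
    using kernel_lift[OF assms(2) e(2) cokernel_zero[OF f]] .
  note k = kernel_in_hom[OF assms(2)]
  show ?thesis
  proof (rule is_cokernelI)
    fix x g assume "g \<in> hom C (Cod C k) x" and z: "zero_arrow C (g \<odot> k)"
    then have g: "g \<in> hom C (Cod C f) x" using homD[OF k(1)] homD[OF e(2)] by simp
    have "g \<odot> f = (g \<odot> k) \<odot> h"
      using h homD[OF k(1)] homD[OF g] homD[OF h(1)] homD[OF e(2)] Cmp_assoc_Arr[of h k g] by simp
    then have "zero_arrow C (g \<odot> f)"
      using zero_arrow_Cmp_right[OF z, of h] homD[OF k(1)] homD[OF g] homD[OF h(1)] homD[OF e(2)]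
      by simp
    then show "\<exists>h \<in> hom C (Cod C e) x. h \<odot> e = g" using cokernel_desc[OF f g] by blast
  qed (use homD[OF k(1)] assms kernel_zero strict_epi_epi in auto)
qed

text \<open>A kernel of \<open>f\<close> that factors as \<open>n \<odot> m\<close> with
  \<open>n\<close> monic makes \<open>m\<close> a kernel of \<open>f \<odot> n\<close>. Hence the
  arrow between nested strict subobjects is again strict, and they have a quotient.\<close>

lemma strict_monic_CmpD:
  assumes "strict_monic C (n \<odot> m)" "monic C n" "m \<in> Arr C" "Cod C m = Dom C n"
  shows "strict_monic C m"
proof -
  obtain f where f: "is_kernel C (n \<odot> m) f" using assms(1) strict_monic_def by metis
  note n = monic_in_Arr[OF assms(2)]
  note [simp] = n assms(3,4)
  have fs: "f \<in> Arr C" "Dom C f = Cod C n" using f by (auto simp: is_kernel_def)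
  have "is_kernel C m (f \<odot> n)"
  proof (rule is_kernelI)
    show "monic C m" using monic_CmpD[OF strict_monic_monic[OF assms(1)]] by simp
    show "zero_arrow C (f \<odot> n \<odot> m)" using kernel_zero[OF f] fs by (simp add: Cmp_assoc_Arr)
    fix x g assume "g \<in> hom C x (Dom C (f \<odot> n))" and z: "zero_arrow C (f \<odot> n \<odot> g)"
    then have g: "g \<in> hom C x (Dom C n)" using fs by simp
    note gs = homD(1-3)[OF g]
    have "n \<odot> g \<in> hom C x (Dom C f)" using gs fs by (simp add: hom_def)
    moreover have "zero_arrow C (f \<odot> (n \<odot> g))" using z gs fs by (simp add: Cmp_assoc_Arr)
    ultimately obtain h where h: "h \<in> hom C x (Dom C (n \<odot> m))" "n \<odot> m \<odot> h = n \<odot> g"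
      using kernel_lift[OF f] by blast
    then have "m \<odot> h = g"
      using monic_cancel[OF assms(2), of "m \<odot> h" x g] g homD[OF h(1)]
      by (simp add: Cmp_assoc_Arr hom_def)
    then show "\<exists>h \<in> hom C x (Dom C m). m \<odot> h = g" using h by auto
  qed (use fs in auto)
  then show ?thesis unfolding strict_monic_def by blast
qed

text \<open>The identity lifts through \<open>k\<close>; this right inverse is two-sided because
  \<open>k\<close> is monic.\<close>

lemma kernel_of_zero:
  assumes "is_kernel C k f" "zero_arrow C f"
  obtains h where "h \<in> hom C (Cod C k) (Dom C k)" "k \<odot> h = Id C (Cod C k)" "h \<odot> k = Id C (Dom C k)"
proof -
  have k: "k \<in> Arr C" "Cod C k = Dom C f" "f \<in> Arr C" using assms by (auto simp: is_kernel_def)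
  obtain h where h: "h \<in> hom C (Cod C k) (Dom C k)" "k \<odot> h = Id C (Cod C k)"
    using kernel_lift[OF assms(1), of "Id C (Cod C k)" "Cod C k"] assms(2) k Dom_in Id_in_hom
    by (metis Cmp_Id_Dom)
  note hs = homD(1-3)[OF h(1)]
  have "h \<odot> k = Id C (Dom C k)"
  proof (rule monic_cancel[OF kernel_monic[OF assms(1)], of _ "Dom C k"])
    show "k \<odot> (h \<odot> k) = k \<odot> Id C (Dom C k)"
      using h(2) hs k(1) by (simp flip: Cmp_assoc_Arr)
  qed (use hs k Dom_in Id_in_hom in \<open>auto simp: hom_def\<close>)
  then show ?thesis using that h by blast
qed

text \<open>An arrow out of a null object is a kernel of the identity of its target.\<close>

lemma null_strict_monic:
  assumes "null_object C z" "a \<in> Obj C" "f \<in> hom C z a" shows "strict_monic C f"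
proof -
  have "is_kernel C f (Id C a)"
  proof (rule is_kernelI)
    show "monic C f" unfolding monic_def
      using null_terminal[OF assms(1)] homD[OF assms(3)] by blast
    have "Id C a \<odot> f = f" using assms Id_Cmp by blast
    then show "zero_arrow C (Id C a \<odot> f)"
      using zero_arrow_null_Dom[of f] homD[OF assms(3)] assms(1) by simp
    fix x g assume g: "g \<in> hom C x (Dom C (Id C a))" "zero_arrow C (Id C a \<odot> g)"
    then have ga: "g \<in> hom C x a" using assms by simp
    then have zg: "zero_arrow C g" using g Id_Cmp[of g x a] by simp
    obtain h where h: "h \<in> hom C x z" using null_to assms(1) homD[OF ga] by blast
    have "zero_arrow C (f \<odot> h)"
      using zero_arrow_null_Dom[of f] zero_arrow_Cmp_right[of f h] homD[OF assms(3)] assms(1) homD[OF h]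
      by simp
    then show "\<exists>h \<in> hom C x (Dom C f). f \<odot> h = g"
      using zero_arrow_unique[OF _ zg _ ga] h Cmp_in_hom[OF h assms(3)] homD[OF assms(3)] by metis
  qed (use assms homD[OF assms(3)] in auto)
  then show ?thesis unfolding strict_monic_def by blast
qed

text \<open>The identity is a kernel of the arrow to a null object.\<close>

lemma strict_monic_Id: "a \<in> Obj C \<Longrightarrow> null_object C z \<Longrightarrow> strict_monic C (Id C a)"
proof -
  assume a: "a \<in> Obj C" and z: "null_object C z"
  obtain f where f: "f \<in> hom C a z" using null_to[OF z a] .
  have fz: "zero_arrow C f" using zero_arrow_null_Cod homD[OF f] z by blast
  have "is_kernel C (Id C a) f"
  proof (rule is_kernelI)
    fix x g assume "g \<in> hom C x (Dom C f)"
    then show "\<exists>h \<in> hom C x (Dom C (Id C a)). Id C a \<odot> h = g"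
      using homD[OF f] a Id_Cmp[of g x a] by auto
  qed (use a homD[OF f] monic_Id fz Cmp_Id[OF f] in auto)
  then show ?thesis unfolding strict_monic_def by blast
qed

section \<open>Comparison of subobjects\<close>

lemma subobject_leE:
  assumes "subobject_le C m n"
  obtains h where "h \<in> hom C (Dom C m) (Dom C n)" "n \<odot> h = m"
  using assms unfolding subobject_le_def by blast

lemma subobject_le_trans:
  assumes "subobject_le C m n" "subobject_le C n p" "n \<in> Arr C" "p \<in> Arr C" "Cod C m = Cod C n" "Cod C n = Cod C p"
  shows "subobject_le C m p"
proof -
  obtain h where h: "h \<in> hom C (Dom C m) (Dom C n)" "n \<odot> h = m" using assms(1) by (rule subobject_leE)
  obtain k where k: "k \<in> hom C (Dom C n) (Dom C p)" "p \<odot> k = n" using assms(2) by (rule subobject_leE)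
  have "p \<odot> (k \<odot> h) = m" using h(2) k(2) homD(1-3)[OF h(1)] homD(1-3)[OF k(1)] assms(3-6) Cmp_assoc_Arr[of h k p] by simp
  then show ?thesis unfolding subobject_le_def using Cmp_in_hom[OF h(1) k(1)] by blast
qed

lemma subobject_le_refl: "m \<in> Arr C \<Longrightarrow> subobject_le C m m"
  unfolding subobject_le_def using Id_in_hom[OF Dom_in] Cmp_Id_Dom by blast

lemma subobject_le_Id: "m \<in> Arr C \<Longrightarrow> Cod C m = a \<Longrightarrow> subobject_le C m (Id C a)"
  unfolding subobject_le_def using Id_Cod_Cmp Cod_in hom_self by (metis Id_simps(2))

lemma subobject_le_null:
  assumes "null_object C (Dom C m)" "m \<in> Arr C" "n \<in> Arr C" "Cod C m = Cod C n"
  shows "subobject_le C m n"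
proof -
  obtain h where h: "h \<in> hom C (Dom C m) (Dom C n)" using null_from[OF assms(1) Dom_in[OF assms(3)]] .
  have "n \<odot> h = m"
    by (rule null_initial[OF assms(1), of _ "Cod C n"]) (use homD[OF h] assms in \<open>auto simp: hom_def\<close>)
  then show ?thesis unfolding subobject_le_def using h by blast
qed

lemma same_subobject_iso:
  assumes "same_subobject C m n" "monic C m" "monic C n" "Cod C m = Cod C n"
  obtains h where "h \<in> hom C (Dom C m) (Dom C n)" "n \<odot> h = m" "iso_arrow C h"
proof -
  have A: "m \<in> Arr C" "n \<in> Arr C" using assms monic_in_Arr by blast+
  obtain h k where h: "h \<in> hom C (Dom C m) (Dom C n)" "n \<odot> h = m"
    and k: "k \<in> hom C (Dom C n) (Dom C m)" "m \<odot> k = n"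
    using assms(1) unfolding same_subobject_def subobject_le_def by auto
  note hs = homD(1-3)[OF h(1)] and ks = homD(1-3)[OF k(1)]
  have "k \<odot> h = Id C (Dom C m)"
  proof (rule monic_cancel[OF assms(2) Cmp_in_hom[OF h(1) k(1)]])
    show "m \<odot> (k \<odot> h) = m \<odot> Id C (Dom C m)"
      using A hs ks h(2) k(2) Cmp_assoc_Arr[of h k m] by simp
  qed (use A Dom_in Id_in_hom in auto)
  moreover have "h \<odot> k = Id C (Dom C n)"
  proof (rule monic_cancel[OF assms(3) Cmp_in_hom[OF k(1) h(1)]])
    show "n \<odot> (h \<odot> k) = n \<odot> Id C (Dom C n)"
      using A hs ks h(2) k(2) Cmp_assoc_Arr[of k h n] by simp
  qed (use A Dom_in Id_in_hom in auto)
  ultimately show ?thesis using that h iso_arrowI[OF h(1) k(1)] by blast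
qed

lemma same_subobject_isomorphic:
  assumes "same_subobject C m n" "monic C m" "monic C n" "Cod C m = Cod C n"
  shows "isomorphic C (Dom C m) (Dom C n)"
  using same_subobject_iso[OF assms] unfolding isomorphic_def by metis

lemma same_subobject_sym: "same_subobject C m n \<Longrightarrow> same_subobject C n m"
  unfolding same_subobject_def by blast

lemma same_subobject_trans:
  assumes "same_subobject C m n" "same_subobject C n p" "m \<in> Arr C" "n \<in> Arr C" "p \<in> Arr C" "Cod C m = Cod C n" "Cod C n = Cod C p"
  shows "same_subobject C m p"
  using assms subobject_le_trans unfolding same_subobject_def by metis

lemma kernel_same_subobject:
  assumes "is_kernel C m f" "same_subobject C m n" "monic C n" "Cod C n = Cod C m"
  shows "is_kernel C n f"
proof -
  have A: "m \<in> Arr C" "n \<in> Arr C" using assms monic_in_Arr kernel_monic by blast+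
  have f: "f \<in> Arr C" "Dom C f = Cod C m" using assms(1) by (auto simp: is_kernel_def)
  obtain h k where h: "h \<in> hom C (Dom C m) (Dom C n)" "n \<odot> h = m"
    and k: "k \<in> hom C (Dom C n) (Dom C m)" "m \<odot> k = n"
    using assms(2) unfolding same_subobject_def subobject_le_def by auto
  show ?thesis
  proof (rule is_kernelI)
    have "f \<odot> n = (f \<odot> m) \<odot> k" using k A f homD[OF k(1)] Cmp_assoc_Arr[of k m f] by simp
    then show "zero_arrow C (f \<odot> n)"
      using zero_arrow_Cmp_right[OF kernel_zero[OF assms(1)], of k] homD[OF k(1)] f A by simp
    fix x g assume g: "g \<in> hom C x (Dom C f)" "zero_arrow C (f \<odot> g)"
    obtain y where y: "y \<in> hom C x (Dom C m)" "m \<odot> y = g" using kernel_lift[OF assms(1) g] .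
    have "n \<odot> (h \<odot> y) = g"
      using y h A homD[OF y(1)] homD[OF h(1)] assms(4) Cmp_assoc_Arr[of y h n] by simp
    then show "\<exists>h \<in> hom C x (Dom C n). n \<odot> h = g" using Cmp_in_hom[OF y(1) h(1)] by blast
  qed (use A f assms in auto)
qed

text \<open>Shows that the rank of a graded piece does not depend on the colimit chosen to form
  it.\<close>

lemma colimit_isomorphic:
  assumes "is_colimit J C D U c" "is_colimit J C D U' c'" shows "isomorphic C U U'"
proof -
  have co: "is_cocone J C D U c" "is_cocone J C D U' c'" using assms by (auto simp: is_colimit_def)
  have c: "c j \<in> hom C (Omap D j) U" "c' j \<in> hom C (Omap D j) U'" if "j \<in> Obj J" for j
    using co that by (auto simp: is_cocone_def)
  obtain h where h: "h \<in> hom C U U'" "\<And>j. j \<in> Obj J \<Longrightarrow> h \<odot> c j = c' j"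
    using assms(1) co(2) unfolding is_colimit_def by metis
  obtain k where k: "k \<in> hom C U' U" "\<And>j. j \<in> Obj J \<Longrightarrow> k \<odot> c' j = c j"
    using assms(2) co(1) unfolding is_colimit_def by metis
  have U: "U \<in> Obj C" "U' \<in> Obj C" using homD[OF h(1)] by auto
  have "\<exists>!x. x \<in> hom C U U \<and> (\<forall>j \<in> Obj J. x \<odot> c j = c j)"
    using assms(1) co(1) unfolding is_colimit_def by blast
  moreover have "k \<odot> h \<odot> c j = c j" if "j \<in> Obj J" for j
    using Cmp_assoc[OF c(1)[OF that] h(1) k(1)] h(2) k(2) that by simp
  moreover have "Id C U \<odot> c j = c j" if "j \<in> Obj J" for j using Id_Cmp c(1) that by blast
  ultimately have 1: "k \<odot> h = Id C U" using Cmp_in_hom[OF h(1) k(1)] Id_in_hom U by metis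
  have "\<exists>!x. x \<in> hom C U' U' \<and> (\<forall>j \<in> Obj J. x \<odot> c' j = c' j)"
    using assms(2) co(2) unfolding is_colimit_def by blast
  moreover have "h \<odot> k \<odot> c' j = c' j" if "j \<in> Obj J" for j
    using Cmp_assoc[OF c(2)[OF that] k(1) h(1)] h(2) k(2) that by simp
  moreover have "Id C U' \<odot> c' j = c' j" if "j \<in> Obj J" for j using Id_Cmp c(2) that by blast
  ultimately have 2: "h \<odot> k = Id C U'" using Cmp_in_hom[OF k(1) h(1)] Id_in_hom U by metis
  show ?thesis unfolding isomorphic_def using h(1) iso_arrowI[OF h(1) k(1) 1 2] by blast
qed

end

section \<open>Short exact sequences, pullbacks of kernels and pushouts of cokernels\<close>

context category_with_kernels_cokernels
begin

lemma short_exact_strict_monic: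
  assumes "strict_monic C m" obtains q where "short_exact C m q"
proof -
  have "m \<in> Arr C" using monic_in_Arr[OF strict_monic_monic[OF assms]] .
  then obtain q where "is_cokernel C q m" using ex_cokernel by blast
  then show ?thesis
    using that strict_monic_kernel_cokernel[OF assms] unfolding short_exact_def by blast
qed

lemma short_exactD:
  assumes "short_exact C k q"
  shows "is_kernel C k q" "is_cokernel C q k" "k \<in> Arr C" "q \<in> Arr C" "Dom C q = Cod C k"
    "strict_monic C k" "strict_epi C q" "monic C k" "epi C q" "zero_arrow C (q \<odot> k)"
proof -
  show 1: "is_kernel C k q" "is_cokernel C q k" using assms by (auto simp: short_exact_def)
  show "k \<in> Arr C" "q \<in> Arr C" "Dom C q = Cod C k" using 1 by (auto simp: is_kernel_def)
  show s: "strict_monic C k" "strict_epi C q" using 1 by (auto simp: strict_monic_def strict_epi_def)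
  show "monic C k" "epi C q" using s strict_monic_monic strict_epi_epi by auto
  show "zero_arrow C (q \<odot> k)" using 1 kernel_zero by auto
qed

text \<open>The pullback is also returned as a kernel of \<open>f \<odot> e\<close>: this makes
  \<open>m'\<close> strict, and it identifies \<open>m'\<close> when \<open>f \<odot> e\<close> is
  the arrow being factored.\<close>

lemma kernel_pullback:
  assumes m: "is_kernel C m f" and e: "e \<in> Arr C" "Cod C e = Cod C m"
  obtains m' e' where "is_kernel C m' (f \<odot> e)" "is_pullback C m' e' e m"
proof -
  have mA: "m \<in> Arr C" "f \<in> Arr C" "Dom C f = Cod C m" using m by (auto simp: is_kernel_def)
  obtain m' where m': "is_kernel C m' (f \<odot> e)" using ex_kernel[of "f \<odot> e"] e mA by auto
  have m'A: "m' \<in> Arr C" "Cod C m' = Dom C e" using m' e mA by (auto simp: is_kernel_def)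
  have "zero_arrow C (f \<odot> (e \<odot> m'))"
    using kernel_zero[OF m'] m'A mA e Cmp_assoc_Arr[of m' e f] by simp
  moreover have "e \<odot> m' \<in> hom C (Dom C m') (Dom C f)" using m'A mA e by (simp add: hom_def)
  ultimately obtain e' where e': "e' \<in> hom C (Dom C m') (Dom C m)" "m \<odot> e' = e \<odot> m'"
    using kernel_lift[OF m] by blast
  have "is_pullback C m' e' e m"
    unfolding is_pullback_def
  proof (intro conjI ballI impI)
    fix x s t
    assume s: "s \<in> hom C x (Dom C e)" and t: "t \<in> hom C x (Dom C m)" and eq: "e \<odot> s = m \<odot> t"
    note st = homD(1-3)[OF s] homD(1-3)[OF t]
    have "f \<odot> e \<odot> s = (f \<odot> m) \<odot> t" using st e mA eq by (simp add: Cmp_assoc_Arr)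
    then have "zero_arrow C (f \<odot> e \<odot> s)"
      using zero_arrow_Cmp_right[OF kernel_zero[OF m], of t] st mA by simp
    moreover have "s \<in> hom C x (Dom C (f \<odot> e))" using s e mA by simp
    ultimately obtain h where h: "h \<in> hom C x (Dom C m')" "m' \<odot> h = s"
      using kernel_lift[OF m'] by blast
    note hs = homD(1-3)[OF h(1)] homD(1-3)[OF e'(1)]
    have "m \<odot> (e' \<odot> h) = (e \<odot> m') \<odot> h" using hs mA e'(2) by (simp flip: Cmp_assoc_Arr)
    also have "\<dots> = m \<odot> t" using hs e m'A h(2) eq by (simp add: Cmp_assoc_Arr)
    finally have "e' \<odot> h = t"
      using monic_cancel[OF kernel_monic[OF m] Cmp_in_hom[OF h(1) e'(1)] t] by simp
    then show "\<exists>!h. h \<in> hom C x (Dom C m') \<and> m' \<odot> h = s \<and> e' \<odot> h = t"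
      using h monic_cancel[OF kernel_monic[OF m']] by metis
  qed (use e mA m'A homD[OF e'(1)] e'(2) in auto)
  with that m' show ?thesis by blast
qed

lemma cokernel_pushout:
  assumes e: "is_cokernel C e f" and m: "m \<in> Arr C" "Dom C m = Dom C e"
  obtains e' m' where "is_cokernel C e' (m \<odot> f)" "is_pushout C e' m' m e"
proof -
  have eA: "e \<in> Arr C" "f \<in> Arr C" "Cod C f = Dom C e" using e by (auto simp: is_cokernel_def)
  obtain e' where e': "is_cokernel C e' (m \<odot> f)" using ex_cokernel[of "m \<odot> f"] m eA by auto
  have e'A: "e' \<in> Arr C" "Dom C e' = Cod C m" using e' m eA by (auto simp: is_cokernel_def)
  have "zero_arrow C (e' \<odot> m \<odot> f)"
    using cokernel_zero[OF e'] e'A eA m Cmp_assoc_Arr[of f m e'] by simp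
  moreover have "e' \<odot> m \<in> hom C (Cod C f) (Cod C e')" using e'A eA m by (simp add: hom_def)
  ultimately obtain m' where m': "m' \<in> hom C (Cod C e) (Cod C e')" "m' \<odot> e = e' \<odot> m"
    using cokernel_desc[OF e] by blast
  have "is_pushout C e' m' m e"
    unfolding is_pushout_def
  proof (intro conjI ballI impI)
    fix x s t
    assume s: "s \<in> hom C (Cod C m) x" and t: "t \<in> hom C (Cod C e) x" and eq: "s \<odot> m = t \<odot> e"
    note st = homD(1-3)[OF s] homD(1-3)[OF t]
    have "s \<odot> (m \<odot> f) = t \<odot> (e \<odot> f)" using st m eA eq by (simp flip: Cmp_assoc_Arr)
    then have "zero_arrow C (s \<odot> (m \<odot> f))"
      using zero_arrow_Cmp_left[OF cokernel_zero[OF e], of t] st eA by simp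
    moreover have "s \<in> hom C (Cod C (m \<odot> f)) x" using s m eA by simp
    ultimately obtain h where h: "h \<in> hom C (Cod C e') x" "h \<odot> e' = s"
      using cokernel_desc[OF e'] by blast
    note hs = homD(1-3)[OF h(1)] homD(1-3)[OF m'(1)]
    have "h \<odot> m' \<odot> e = h \<odot> (e' \<odot> m)" using hs eA m'(2) by (simp add: Cmp_assoc_Arr)
    also have "\<dots> = t \<odot> e" using hs m e'A h(2) eq by (simp flip: Cmp_assoc_Arr)
    finally have "h \<odot> m' = t"
      using epi_cancel[OF cokernel_epi[OF e] Cmp_in_hom[OF m'(1) h(1)] t] by simp
    then show "\<exists>!h. h \<in> hom C (Cod C e') x \<and> h \<odot> e' = s \<and> h \<odot> m' = t"
      using h epi_cancel[OF cokernel_epi[OF e']] by metis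
  qed (use m eA e'A homD[OF m'(1)] m'(2) in auto)
  with that e' show ?thesis by blast
qed

end

section \<open>Proto-abelian categories\<close>

context proto_abelian
begin

text \<open>A kernel \<open>i\<close> of \<open>g\<close> pulls back along \<open>q\<close> to a
  kernel \<open>i'\<close> of \<open>f\<close>, which factors through \<open>k\<close> and is
  therefore killed by \<open>q\<close>. So \<open>i \<odot> e'\<close> is zero, hence
  \<open>e'\<close> is zero. Axiom (ii) makes \<open>e'\<close> epi, so its target, the source of
  \<open>i\<close>, is null, and axiom (i) makes \<open>g\<close> monic.\<close>

lemma coimage_factorization:
  assumes f: "f \<in> Arr C" and k: "is_kernel C k f" and q: "is_cokernel C q k"
  obtains g where "g \<in> hom C (Cod C q) (Cod C f)" "g \<odot> q = f" "monic C g"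
proof -
  have kA: "k \<in> Arr C" "Cod C k = Dom C f" using k by (auto simp: is_kernel_def)
  have qA: "q \<in> Arr C" "Dom C q = Cod C k" using q by (auto simp: is_cokernel_def)
  have "f \<in> hom C (Cod C k) (Cod C f)" using f kA by (simp add: hom_def)
  then obtain g where g: "g \<in> hom C (Cod C q) (Cod C f)" "g \<odot> q = f"
    using cokernel_desc[OF q] kernel_zero[OF k] by blast
  note gA = homD(1-3)[OF g(1)]
  obtain i where i: "is_kernel C i g" using ex_kernel gA by blast
  have iA: "i \<in> Arr C" "Cod C i = Dom C g" using i by (auto simp: is_kernel_def)
  obtain i' e' where i': "is_kernel C i' (g \<odot> q)" and pb: "is_pullback C i' e' q i"
    using kernel_pullback[OF i qA(1)] iA gA by auto
  have "strict_epi C q" "strict_monic C i" using q i unfolding strict_epi_def strict_monic_def by auto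
  then have e'e: "epi C e'" using pullback_strict_epi[OF _ _ pb] strict_epi_epi by blast
  have e'A: "e' \<in> hom C (Dom C i') (Dom C i)" and i'A: "i' \<in> Arr C" "Cod C i' = Dom C q"
    and eq: "q \<odot> i' = i \<odot> e'" using pb unfolding is_pullback_def by (auto simp: hom_def)
  have "i' \<in> hom C (Dom C i') (Dom C f)" using i'A qA kA by (simp add: hom_def)
  moreover have "zero_arrow C (f \<odot> i')" using kernel_zero[OF i'] g(2) by simp
  ultimately obtain h where h: "h \<in> hom C (Dom C i') (Dom C k)" "k \<odot> h = i'"
    using kernel_lift[OF k] by blast
  have "i \<odot> e' = q \<odot> k \<odot> h" using h eq homD(1-3)[OF h(1)] qA kA by (simp add: Cmp_assoc_Arr)
  then have "zero_arrow C (i \<odot> e')"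
    using zero_arrow_Cmp_right[OF cokernel_zero[OF q], of h] homD(1-3)[OF h(1)] qA kA by simp
  then have "zero_arrow C e'" using monic_zero_cancel[OF kernel_monic[OF i] e'A] by blast
  then have "null_object C (Dom C i)" using zero_epi_null[OF _ e'e] homD(3)[OF e'A] by simp
  then have "monic C g" using monic_if_zero_kernel[OF i] by blast
  with that g show ?thesis by blast
qed

text \<open>Dual to the coimage: \<open>m\<close> is pushed out along the cokernel \<open>e\<close>
  of \<open>g\<close>. Only \<open>epi C g\<close> results, not strictness.\<close>

lemma image_factorization:
  assumes f: "f \<in> Arr C" and c: "is_cokernel C c f" and m: "is_kernel C m c"
  obtains g where "g \<in> hom C (Dom C f) (Dom C m)" "m \<odot> g = f" "epi C g"
proof -
  have cA: "c \<in> Arr C" "Dom C c = Cod C f" using c by (auto simp: is_cokernel_def)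
  have mA: "m \<in> Arr C" "Cod C m = Dom C c" using m by (auto simp: is_kernel_def)
  have "f \<in> hom C (Dom C f) (Dom C c)" using f cA by (simp add: hom_def)
  then obtain g where g: "g \<in> hom C (Dom C f) (Dom C m)" "m \<odot> g = f"
    using kernel_lift[OF m] cokernel_zero[OF c] by blast
  note gA = homD(1-3)[OF g(1)]
  obtain e where e: "is_cokernel C e g" using ex_cokernel gA by blast
  have eA: "e \<in> Arr C" "Dom C e = Cod C g" using e by (auto simp: is_cokernel_def)
  obtain e' m' where e': "is_cokernel C e' (m \<odot> g)" and po: "is_pushout C e' m' m e"
    using cokernel_pushout[OF e mA(1)] eA gA by auto
  have "strict_epi C e" "strict_monic C m" using e m unfolding strict_epi_def strict_monic_def by auto
  then have m'm: "monic C m'" using pushout_strict_monic[OF _ _ po] strict_monic_monic by blast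
  have m'A: "m' \<in> hom C (Cod C e) (Cod C e')" and e'A: "e' \<in> Arr C" "Dom C e' = Cod C m"
    and eq: "e' \<odot> m = m' \<odot> e" using po unfolding is_pushout_def by (auto simp: hom_def)
  have "e' \<in> hom C (Cod C f) (Cod C e')" using e'A mA cA by (simp add: hom_def)
  moreover have "zero_arrow C (e' \<odot> f)" using cokernel_zero[OF e'] g(2) by simp
  ultimately obtain h where h: "h \<in> hom C (Cod C c) (Cod C e')" "h \<odot> c = e'"
    using cokernel_desc[OF c] by blast
  have "m' \<odot> e = h \<odot> (c \<odot> m)" using h eq homD(1-3)[OF h(1)] cA mA by (simp flip: Cmp_assoc_Arr)
  then have "zero_arrow C (m' \<odot> e)"
    using zero_arrow_Cmp_left[OF kernel_zero[OF m], of h] homD(1-3)[OF h(1)] cA mA by simp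
  then have "zero_arrow C m'"
    using epi_zero_cancel[OF cokernel_epi[OF e] m'A] by blast
  then have "null_object C (Cod C e)" using zero_monic_null[OF _ m'm] homD(2)[OF m'A] by simp
  then have "epi C g" using epi_if_zero_cokernel[OF e] by blast
  with that g show ?thesis by blast
qed

text \<open>Here \<open>p\<close> is the preimage of the subobject \<open>i\<close> under the
  quotient \<open>q\<close>; axiom (ii) makes \<open>e\<close> a strict epi, which exhibits the
  preimage as an extension of \<open>Dom C i\<close> by \<open>Dom C n\<close>.\<close>

lemma preimage_short_exact:
  assumes nq: "short_exact C n q" and i: "strict_monic C i" and cod: "Cod C i = Cod C q"
  obtains p e k where "strict_monic C p" "Cod C p = Cod C n" "short_exact C k e"
    "Dom C k = Dom C n" "Cod C k = Dom C p" "Cod C e = Dom C i" "q \<odot> p = i \<odot> e" "p \<odot> k = n"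
proof -
  note nqD = short_exactD[OF nq]
  obtain f where f: "is_kernel C i f" using i strict_monic_def by metis
  have fA: "f \<in> Arr C" "Dom C f = Cod C i" "i \<in> Arr C" using f by (auto simp: is_kernel_def)
  obtain p e where p: "is_kernel C p (f \<odot> q)" and pb: "is_pullback C p e q i"
    using kernel_pullback[OF f nqD(4)] cod by auto
  have e: "strict_epi C e" using pullback_strict_epi[OF nqD(7) i pb] .
  have pA: "p \<in> Arr C" "Cod C p = Dom C q" and eA: "e \<in> Arr C" "Dom C e = Dom C p" "Cod C e = Dom C i"
    and eq: "q \<odot> p = i \<odot> e"
    using pb unfolding is_pullback_def by auto
  have univ: "x \<in> Obj C \<Longrightarrow> s \<in> hom C x (Dom C q) \<Longrightarrow> t \<in> hom C x (Dom C i) \<Longrightarrow>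
        q \<odot> s = i \<odot> t \<Longrightarrow> \<exists>!h. h \<in> hom C x (Dom C p) \<and> p \<odot> h = s \<and> e \<odot> h = t" for x s t
    using pb unfolding is_pullback_def by blast
  \<comment> \<open>The arrow \<open>k\<close> is the lift of \<open>n\<close> to the pullback with
    the zero arrow \<open>w\<close> as its other component.\<close>
  obtain z where "null_object C z" using ex_null_object by blast
  then obtain w where w: "w \<in> hom C (Dom C n) (Dom C i)" "zero_arrow C w"
    using zero_arrow_exists Dom_in nqD(3) fA(3) by metis
  note wA = homD(1-3)[OF w(1)]
  have "zero_arrow C (i \<odot> w)" using zero_arrow_Cmp_left[OF w(2) fA(3)] wA by simp
  then have "q \<odot> n = i \<odot> w"
    using zero_arrow_unique[OF nqD(10), of "i \<odot> w" "Dom C n" "Cod C q"] wA fA nqD cod by (auto simp: hom_def)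
  moreover have "n \<in> hom C (Dom C n) (Dom C q)" using nqD by (simp add: hom_def)
  ultimately obtain k where k: "k \<in> hom C (Dom C n) (Dom C p)" "p \<odot> k = n" "e \<odot> k = w"
    using univ[OF Dom_in[OF nqD(3)] _ w(1)] by blast
  note kA = homD(1-3)[OF k(1)]
  have "is_kernel C k e"
  proof (rule is_kernelI)
    show "monic C k" using monic_CmpD[of p k] k(2) nqD(8) kA pA by simp
    show "zero_arrow C (e \<odot> k)" using k w by simp
    fix x g assume "g \<in> hom C x (Dom C e)" and z: "zero_arrow C (e \<odot> g)"
    then have g: "g \<in> hom C x (Dom C p)" using eA by simp
    note gA = homD(1-3)[OF g]
    have "q \<odot> (p \<odot> g) = i \<odot> (e \<odot> g)"
      using gA pA eA nqD fA eq by (simp flip: Cmp_assoc_Arr)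
    then have "zero_arrow C (q \<odot> (p \<odot> g))" using zero_arrow_Cmp_left[OF z fA(3)] gA eA by simp
    moreover have "p \<odot> g \<in> hom C x (Dom C q)" using gA pA by (simp add: hom_def)
    ultimately obtain y where y: "y \<in> hom C x (Dom C n)" "n \<odot> y = p \<odot> g"
      using kernel_lift[OF nqD(1)] by blast
    note yA = homD(1-3)[OF y(1)]
    have "p \<odot> (k \<odot> y) = p \<odot> g" using y(2) k(2) yA kA pA Cmp_assoc_Arr[of y k p] by simp
    then have "k \<odot> y = g"
      using monic_cancel[OF kernel_monic[OF p] Cmp_in_hom[OF y(1) k(1)] g] by simp
    then show "\<exists>h \<in> hom C x (Dom C k). k \<odot> h = g" using y kA by auto
  qed (use kA eA in auto)
  then have "short_exact C k e"
    unfolding short_exact_def using strict_epi_cokernel_kernel[OF e] by blast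
  moreover have "strict_monic C p" using p unfolding strict_monic_def by blast
  ultimately show ?thesis using that kA k(2) eA eq pA nqD by simp
qed

lemma image_exists:
  assumes f: "f \<in> Arr C"
  obtains m g c where "short_exact C m c" "Cod C m = Cod C f" "is_cokernel C c f"
    "g \<in> hom C (Dom C f) (Dom C m)" "m \<odot> g = f" "epi C g"
proof -
  obtain c where c: "is_cokernel C c f" using ex_cokernel f by blast
  have cA: "c \<in> Arr C" "Dom C c = Cod C f" using c by (auto simp: is_cokernel_def)
  obtain m where m: "is_kernel C m c" using ex_kernel cA by blast
  have "strict_epi C c" using c unfolding strict_epi_def by blast
  then have "short_exact C m c"
    using m strict_epi_cokernel_kernel[OF _ m] unfolding short_exact_def by blast
  moreover have "Cod C m = Cod C f" using m cA by (simp add: is_kernel_def)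
  moreover obtain g where "g \<in> hom C (Dom C f) (Dom C m)" "m \<odot> g = f" "epi C g"
    using image_factorization[OF f c m] .
  ultimately show ?thesis using that c by blast
qed

end

lemma (in category) null_null_isomorphic:
  assumes "null_object C a" "null_object C b" shows "isomorphic C a b"
proof -
  obtain f where f: "f \<in> hom C a b" using null_from assms null_in_Obj by metis
  obtain g where g: "g \<in> hom C b a" using null_from assms null_in_Obj by metis
  have "g \<odot> f = Id C a" "f \<odot> g = Id C b"
    using null_initial[OF assms(1) Cmp_in_hom[OF f g]] null_initial[OF assms(2) Cmp_in_hom[OF g f]]
      Id_in_hom null_in_Obj assms by blast+
  then show ?thesis unfolding isomorphic_def using f iso_arrowI[OF f g] by blast
qed

section \<open>Rank as a measure of strict subobjects\<close>

locale ranked_category = proto_abelian +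
  fixes rk :: "'a \<Rightarrow> nat"
  assumes rank_function: "rank_function C rk"
begin

lemma rk_isomorphic: "isomorphic C a b \<Longrightarrow> rk a = rk b"
  using rank_function homD(4,5) unfolding rank_function_def isomorphic_def by blast

lemma rk_exact: "short_exact C f g \<Longrightarrow> rk (Cod C f) = rk (Dom C f) + rk (Cod C g)"
  using rank_function unfolding rank_function_def by blast

lemma rk_null: assumes "null_object C z" shows "rk z = 0"
proof -
  have z: "z \<in> Obj C" using null_in_Obj[OF assms] .
  obtain q where q: "short_exact C (Id C z) q"
    using short_exact_strict_monic null_strict_monic[OF assms z Id_in_hom[OF z]] by blast
  have "null_object C (Cod C q)"
    using epi_null_Cod[of q] short_exactD[OF q] assms z by simp
  then have "rk (Cod C q) = rk z" using rk_isomorphic null_null_isomorphic assms by blast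
  then show ?thesis using rk_exact[OF q] z by simp
qed

lemma rk_eq_0_iff: "a \<in> Obj C \<Longrightarrow> rk a = 0 \<longleftrightarrow> null_object C a"
  using rank_function rk_null unfolding rank_function_def by blast

lemma rk_strict_monic: assumes "strict_monic C m" shows "rk (Dom C m) \<le> rk (Cod C m)"
  using short_exact_strict_monic[OF assms] rk_exact by (metis le_add1)

text \<open>The cokernel has rank 0, hence is null, and \<open>m\<close> is a kernel of a zero
  arrow.\<close>

lemma strict_monic_iso_if_rk:
  assumes "strict_monic C m" "rk (Dom C m) = rk (Cod C m)"
  obtains h where "h \<in> hom C (Cod C m) (Dom C m)" "m \<odot> h = Id C (Cod C m)" "h \<odot> m = Id C (Dom C m)"
proof -
  obtain q where q: "short_exact C m q" using short_exact_strict_monic[OF assms(1)] .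
  note qD = short_exactD[OF q]
  have "rk (Cod C q) = 0" using rk_exact[OF q] assms(2) by simp
  then have "zero_arrow C q" using rk_eq_0_iff zero_arrow_null_Cod Cod_in qD(4) by blast
  then show ?thesis using kernel_of_zero[OF qD(1)] that by blast
qed

lemma subobject_le_strict:
  assumes "subobject_le C m n" "strict_monic C m" "strict_monic C n" "Cod C m = Cod C n"
  obtains h where "h \<in> hom C (Dom C m) (Dom C n)" "n \<odot> h = m" "strict_monic C h"
proof -
  have A: "m \<in> Arr C" "n \<in> Arr C" "monic C n" using assms strict_monic_monic monic_in_Arr by blast+
  obtain h where h: "h \<in> hom C (Dom C m) (Dom C n)" "n \<odot> h = m" using assms(1) by (rule subobject_leE)
  have "strict_monic C h" using strict_monic_CmpD[of n h] h(2) assms(2) A homD(1-3)[OF h(1)] by simp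
  with that h show ?thesis by blast
qed

lemma rk_subobject_le:
  assumes "subobject_le C m n" "strict_monic C m" "strict_monic C n" "Cod C m = Cod C n"
  shows "rk (Dom C m) \<le> rk (Dom C n)"
  using subobject_le_strict[OF assms] rk_strict_monic homD(2,3) by metis

text \<open>Reduces equality of nested strict subobjects to an equality of natural numbers.\<close>

lemma same_subobject_if_rk:
  assumes "subobject_le C m n" "strict_monic C m" "strict_monic C n" "Cod C m = Cod C n"
    "rk (Dom C m) = rk (Dom C n)"
  shows "same_subobject C m n"
proof -
  obtain h where h: "h \<in> hom C (Dom C m) (Dom C n)" "n \<odot> h = m" "strict_monic C h"
    using subobject_le_strict[OF assms(1-4)] .
  note hA = homD(1-3)[OF h(1)]
  have A: "n \<in> Arr C" using assms strict_monic_monic monic_in_Arr by blast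
  obtain k where k: "k \<in> hom C (Dom C n) (Dom C m)" "h \<odot> k = Id C (Dom C n)"
    using strict_monic_iso_if_rk[OF h(3)] assms(5) hA by metis
  have "m \<odot> k = n" using h(2) k(2) A hA homD(1-3)[OF k(1)] Cmp_assoc_Arr[of k h n] by simp
  then show ?thesis unfolding same_subobject_def using assms(1) k(1) unfolding subobject_le_def by blast
qed

lemma rk_same_subobject:
  assumes "same_subobject C m n" "monic C m" "monic C n" "Cod C m = Cod C n"
  shows "rk (Dom C m) = rk (Dom C n)"
  using same_subobject_isomorphic[OF assms] rk_isomorphic by blast

end

section \<open>The torsion pair at a given slope\<close>

locale sloped_category = ranked_category +
  fixes \<mu> :: "'a \<Rightarrow> 'l::uniquely_divisible_ordered_group"
  assumes slope_function: "\<mu> \<in> slope_functions C rk"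
begin

abbreviation "deg \<equiv> degree C rk \<mu>"

lemma deg_exact: "short_exact C f g \<Longrightarrow> deg (Cod C f) = deg (Dom C f) + deg (Cod C g)"
  using slope_function unfolding slope_functions_def by blast

lemma deg_rk_0: "a \<in> Obj C \<Longrightarrow> rk a = 0 \<Longrightarrow> deg a = 0"
  using rk_eq_0_iff unfolding degree_def by simp

lemma slope_epi_monic:
  "monic C f \<Longrightarrow> epi C f \<Longrightarrow> \<not> null_object C (Dom C f) \<Longrightarrow> \<not> null_object C (Cod C f) \<Longrightarrow>
    \<mu> (Dom C f) \<le> \<mu> (Cod C f)"
  using slope_function monic_in_Arr Dom_in Cod_in
  unfolding slope_functions_def nonzero_objects_def by simp

lemma deg_ge_iff:
  assumes "a \<in> Obj C" "\<not> null_object C a"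
  shows "nsmul (rk a) t \<le> deg a \<longleftrightarrow> t \<le> \<mu> a"
  using assms rk_eq_0_iff nsmul_le_iff unfolding degree_def by auto

definition slopes_ge :: "'l \<Rightarrow> 'a \<Rightarrow> bool" where
  "slopes_ge t a \<longleftrightarrow> a \<in> Obj C \<and>
     (\<forall>f. epi C f \<and> Dom C f = a \<longrightarrow> nsmul (rk (Cod C f)) t \<le> deg (Cod C f))"

text \<open>The torsion-free class is taken as the right orthogonal of the torsion class, which
  passes to subobjects at once; the slope inequality suggested by the name is derived in
  \<open>slopes_less_deg\<close>.\<close>

definition slopes_less :: "'l \<Rightarrow> 'a \<Rightarrow> bool" where
  "slopes_less t a \<longleftrightarrow> a \<in> Obj C \<and>
     (\<forall>f \<in> Arr C. Cod C f = a \<and> slopes_ge t (Dom C f) \<longrightarrow> zero_arrow C f)"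

text \<open>The last clause concerns arrows rather than subobjects: it is the universal property of
  a coreflection, and it is what makes torsion parts functorial.\<close>

definition torsion_part :: "'l \<Rightarrow> 'b \<Rightarrow> bool" where
  "torsion_part t n \<longleftrightarrow> strict_monic C n \<and> slopes_ge t (Dom C n) \<and>
     (\<forall>f \<in> Arr C. Cod C f = Cod C n \<and> slopes_ge t (Dom C f) \<longrightarrow> subobject_le C f n)"

lemma slopes_ge_deg: "slopes_ge t a \<Longrightarrow> nsmul (rk a) t \<le> deg a"
  unfolding slopes_ge_def using epi_Id by (metis Id_simps(2,3))

lemma slopes_ge_epi:
  assumes "slopes_ge t (Dom C f)" "epi C f" shows "slopes_ge t (Cod C f)"
proof -
  have f: "f \<in> Arr C" using epi_in_Arr[OF assms(2)] .
  have "nsmul (rk (Cod C g)) t \<le> deg (Cod C g)" if g: "epi C g" "Dom C g = Cod C f" for g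
  proof -
    have "epi C (g \<odot> f)" using epi_Cmp[OF assms(2) g(1)] g(2) by simp
    then show ?thesis using assms(1) f g epi_in_Arr[OF g(1)] unfolding slopes_ge_def
      by (metis Cmp_simps(2,3))
  qed
  then show ?thesis unfolding slopes_ge_def using Cod_in[OF f] by simp
qed

lemma slopes_ge_null: "null_object C a \<Longrightarrow> slopes_ge t a"
  unfolding slopes_ge_def
  using epi_null_Cod null_in_Obj rk_eq_0_iff deg_rk_0 by (metis nsmul.simps(1) order_refl)

lemma slopes_ge_antimono: "slopes_ge t a \<Longrightarrow> s \<le> t \<Longrightarrow> slopes_ge s a"
  unfolding slopes_ge_def using nsmul_mono order_trans by blast

lemma slopes_ge_isomorphic:
  assumes "slopes_ge t a" "isomorphic C a b" shows "slopes_ge t b"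
  using assms slopes_ge_epi iso_epi homD unfolding isomorphic_def by metis

text \<open>An epi \<open>f\<close> out of the middle term cuts its target in two: the image of
  \<open>f \<odot> a\<close> is an epi quotient of the left term, and the cokernel of
  \<open>f \<odot> a\<close> is one of the right term. The two degree inequalities add up.\<close>

lemma slopes_ge_extension:
  assumes ab: "short_exact C a b" and A: "slopes_ge t (Dom C a)" and B: "slopes_ge t (Cod C b)"
  shows "slopes_ge t (Cod C a)"
proof -
  note D = short_exactD[OF ab]
  have "nsmul (rk (Cod C f)) t \<le> deg (Cod C f)" if f: "epi C f" "Dom C f = Cod C a" for f
  proof -
    have fA: "f \<in> Arr C" using epi_in_Arr[OF f(1)] .
    have fa: "f \<odot> a \<in> Arr C" using fA f D by simp
    obtain m g c where mc: "short_exact C m c" "Cod C m = Cod C (f \<odot> a)"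
      and c: "is_cokernel C c (f \<odot> a)"
      and g: "g \<in> hom C (Dom C (f \<odot> a)) (Dom C m)" "epi C g"
      using image_exists[OF fa] by metis
    note mcD = short_exactD[OF mc(1)]
    have m: "Cod C m = Cod C f" using mc(2) fA D f by simp
    have "slopes_ge t (Dom C m)"
      using slopes_ge_epi[OF _ g(2)] A homD(2,3)[OF g(1)] fA D f by simp
    note 1 = slopes_ge_deg[OF this]
    have cf: "c \<odot> f \<in> hom C (Cod C a) (Cod C c)" using mcD m fA f by (simp add: hom_def)
    have "zero_arrow C (c \<odot> f \<odot> a)"
      using cokernel_zero[OF c] mcD m fA f D by (simp add: Cmp_assoc_Arr)
    then obtain h where h: "h \<in> hom C (Cod C b) (Cod C c)" "h \<odot> b = c \<odot> f"
      using cokernel_desc[OF D(2) cf] by blast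
    have "epi C (c \<odot> f)" using epi_Cmp[OF f(1) mcD(9)] mcD m by simp
    then have "epi C h" using epi_CmpD[of h b] h(2) D homD(1-3)[OF h(1)] by simp
    then have "slopes_ge t (Cod C c)" using slopes_ge_epi[of t h] B homD(2,3)[OF h(1)] by simp
    note 2 = slopes_ge_deg[OF this]
    show ?thesis
      using add_mono[OF 1 2] deg_exact[OF mc(1)] rk_exact[OF mc(1)] m by (simp add: nsmul_add)
  qed
  then show ?thesis unfolding slopes_ge_def using Cod_in D(3) by blast
qed

text \<open>The epi \<open>f\<close> factors as its coimage \<open>q\<close> followed by an
  epi-monic \<open>g\<close>, along which the slope cannot decrease; so the strict quotient
  \<open>Cod C q\<close> has slope below \<open>t\<close> as well. The ranks of
  \<open>Cod C q\<close> and \<open>Cod C f\<close> may differ, which is why the argument passes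
  from degrees to slopes and back.\<close>

lemma not_slopes_ge:
  assumes "a \<in> Obj C" "\<not> slopes_ge t a"
  obtains k q where "short_exact C k q" "Cod C k = a" "deg (Cod C q) < nsmul (rk (Cod C q)) t"
proof -
  obtain f where f: "epi C f" "Dom C f = a" "\<not> nsmul (rk (Cod C f)) t \<le> deg (Cod C f)"
    using assms unfolding slopes_ge_def by auto
  have fA: "f \<in> Arr C" using epi_in_Arr[OF f(1)] .
  obtain k where k: "is_kernel C k f" using ex_kernel[OF fA] by blast
  have kA: "Cod C k = Dom C f" using k by (simp add: is_kernel_def)
  have "strict_monic C k" using k unfolding strict_monic_def by blast
  then obtain q where q: "short_exact C k q" using short_exact_strict_monic by blast
  note qD = short_exactD[OF q]
  obtain g where g: "g \<in> hom C (Cod C q) (Cod C f)" "g \<odot> q = f" "monic C g"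
    using coimage_factorization[OF fA k qD(2)] .
  note gA = homD(1-3)[OF g(1)]
  have ge: "epi C g" using epi_CmpD[of g q] f(1) g(2) qD gA by simp
  have nz: "\<not> null_object C (Cod C f)"
    using f(3) deg_rk_0[OF Cod_in[OF fA]] rk_eq_0_iff[OF Cod_in[OF fA]] by auto
  then have nzq: "\<not> null_object C (Cod C q)" using epi_null_Cod[OF ge] gA by auto
  have "\<mu> (Cod C q) \<le> \<mu> (Cod C f)" using slope_epi_monic[OF g(3) ge] nz nzq gA by simp
  moreover have "\<not> t \<le> \<mu> (Cod C f)" using deg_ge_iff[OF Cod_in[OF fA] nz] f(3) by blast
  ultimately have "\<not> t \<le> \<mu> (Cod C q)" by simp
  then have "\<not> nsmul (rk (Cod C q)) t \<le> deg (Cod C q)"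
    using deg_ge_iff[OF Cod_in[OF qD(4)] nzq] by blast
  then show ?thesis using that q kA f(2) by simp
qed

lemma slopes_less_monic:
  assumes "slopes_less t (Cod C m)" "monic C m" shows "slopes_less t (Dom C m)"
  unfolding slopes_less_def
proof (intro conjI ballI impI)
  have m: "m \<in> Arr C" using monic_in_Arr[OF assms(2)] .
  then show "Dom C m \<in> Obj C" using Dom_in by blast
  fix f assume f: "f \<in> Arr C" "Cod C f = Dom C m \<and> slopes_ge t (Dom C f)"
  then have "m \<odot> f \<in> Arr C" "Cod C (m \<odot> f) = Cod C m" "slopes_ge t (Dom C (m \<odot> f))" using m by auto
  then have "zero_arrow C (m \<odot> f)" using assms(1) unfolding slopes_less_def by blast
  then show "zero_arrow C f"
    using monic_zero_cancel[OF assms(2)] f hom_self by metis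
qed

lemma slopes_less_mono: "slopes_less s a \<Longrightarrow> s \<le> t \<Longrightarrow> slopes_less t a"
  unfolding slopes_less_def using slopes_ge_antimono by blast

lemma slopes_less_ge_null: "slopes_less t a \<Longrightarrow> slopes_ge t a \<Longrightarrow> null_object C a"
  unfolding slopes_less_def using null_if_zero_Id Id_simps by metis

text \<open>A non-null torsion-free object is outside the torsion class, hence has a strict quotient
  of slope below \<open>t\<close>. The kernel is torsion-free of smaller rank. It may be null, so it
  contributes only a weak inequality; strictness comes from the quotient.\<close>

lemma slopes_less_deg:
  assumes "slopes_less t a" "\<not> null_object C a" shows "deg a < nsmul (rk a) t"
  using assms
proof (induction "rk a" arbitrary: a rule: less_induct)
  case less
  have a: "a \<in> Obj C" using less.prems unfolding slopes_less_def by blast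
  have "\<not> slopes_ge t a" using less.prems slopes_less_ge_null by blast
  then obtain k q where kq: "short_exact C k q" "Cod C k = a" "deg (Cod C q) < nsmul (rk (Cod C q)) t"
    using not_slopes_ge[OF a] by blast
  note D = short_exactD[OF kq(1)]
  \<comment> \<open>In rank 0 both sides of the strict inequality would vanish.\<close>
  have "rk (Cod C q) > 0" using kq(3) deg_rk_0[OF Cod_in[OF D(4)]] by (cases "rk (Cod C q)") auto
  then have rk: "rk (Dom C k) < rk a" using rk_exact[OF kq(1)] kq(2) by simp
  have k: "slopes_less t (Dom C k)" using slopes_less_monic[OF _ D(8)] less.prems kq(2) by simp
  have "deg (Dom C k) \<le> nsmul (rk (Dom C k)) t"
  proof (cases "null_object C (Dom C k)")
    case True
    then show ?thesis using rk_null deg_rk_0 null_in_Obj by fastforce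
  next
    case False
    then show ?thesis using less.hyps[OF rk k] by simp
  qed
  then show ?case
    using add_le_less_mono[OF _ kq(3)] deg_exact[OF kq(1)] rk_exact[OF kq(1)] kq(2)
    by (simp add: nsmul_add)
qed

text \<open>The image of \<open>a\<close> is non-null and in the torsion class; its preimage is an
  extension of this image by \<open>Dom C n\<close>, so it is in the class too and has larger
  rank.\<close>

lemma slopes_ge_enlarge:
  assumes nq: "short_exact C n q" and n: "slopes_ge t (Dom C n)"
    and a: "a \<in> Arr C" "Cod C a = Cod C q" "slopes_ge t (Dom C a)" "\<not> zero_arrow C a"
  obtains p where "strict_monic C p" "Cod C p = Cod C n" "slopes_ge t (Dom C p)"
    "rk (Dom C n) < rk (Dom C p)"
proof -
  note D = short_exactD[OF nq]
  obtain m g c where mc: "short_exact C m c" "Cod C m = Cod C a"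
    and g: "g \<in> hom C (Dom C a) (Dom C m)" "m \<odot> g = a" "epi C g"
    using image_exists[OF a(1)] by metis
  note mcD = short_exactD[OF mc(1)] and gA = homD(1-3)[OF g(1)]
  have m: "slopes_ge t (Dom C m)" using slopes_ge_epi[OF _ g(3)] a gA by simp
  have "\<not> null_object C (Dom C m)"
  proof
    assume "null_object C (Dom C m)"
    then have "zero_arrow C g" using zero_arrow_null_Cod[of g] gA by simp
    then have "zero_arrow C (m \<odot> g)" using zero_arrow_Cmp_left gA mcD by metis
    then show False using a g by simp
  qed
  then have rk: "rk (Dom C m) > 0" using rk_eq_0_iff Dom_in mcD by blast
  have "Cod C m = Cod C q" using mc a by simp
  then obtain p e k where p: "strict_monic C p" "Cod C p = Cod C n" and ke: "short_exact C k e"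
    "Dom C k = Dom C n" "Cod C k = Dom C p" "Cod C e = Dom C m"
    using preimage_short_exact[OF nq mcD(6)] by metis
  have "slopes_ge t (Dom C p)" using slopes_ge_extension[OF ke(1)] ke n m by simp
  moreover have "rk (Dom C n) < rk (Dom C p)" using rk_exact[OF ke(1)] ke rk by simp
  ultimately show ?thesis using that p by blast
qed

lemma torsion_partI:
  assumes nq: "short_exact C n q" and n: "slopes_ge t (Dom C n)" and q: "slopes_less t (Cod C q)"
  shows "torsion_part t n"
  unfolding torsion_part_def
proof (intro conjI ballI impI n)
  note D = short_exactD[OF nq]
  show "strict_monic C n" using D by simp
  fix f assume f: "f \<in> Arr C" "Cod C f = Cod C n \<and> slopes_ge t (Dom C f)"
  have "zero_arrow C (q \<odot> f)" using q f D unfolding slopes_less_def by simp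
  moreover have "f \<in> hom C (Dom C f) (Dom C q)" using f D by (simp add: hom_def)
  ultimately show "subobject_le C f n"
    using kernel_lift[OF D(1)] unfolding subobject_le_def by metis
qed

lemma torsion_part_cokernel:
  assumes n: "torsion_part t n" and nq: "short_exact C n q" shows "slopes_less t (Cod C q)"
proof (rule ccontr)
  note D = short_exactD[OF nq]
  assume "\<not> slopes_less t (Cod C q)"
  then obtain a where a: "a \<in> Arr C" "Cod C a = Cod C q" "slopes_ge t (Dom C a)" "\<not> zero_arrow C a"
    unfolding slopes_less_def using D Cod_in by blast
  moreover have "slopes_ge t (Dom C n)" using n unfolding torsion_part_def by simp
  ultimately obtain p where p: "strict_monic C p" "Cod C p = Cod C n" "slopes_ge t (Dom C p)"
    "rk (Dom C n) < rk (Dom C p)"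
    using slopes_ge_enlarge[OF nq] by metis
  have "subobject_le C p n" using n p monic_in_Arr[OF strict_monic_monic[OF p(1)]]
    unfolding torsion_part_def by simp
  then show False using rk_subobject_le[of p n] p D by simp
qed

text \<open>Among the strict subobjects in the class, which include the null one, one of greatest
  rank cannot be enlarged, so its quotient is torsion-free.\<close>

lemma torsion_part_exists:
  assumes a: "a \<in> Obj C" obtains n where "torsion_part t n" "Cod C n = a"
proof -
  let ?P = "\<lambda>n. strict_monic C n \<and> Cod C n = a \<and> slopes_ge t (Dom C n)"
  obtain z where z: "null_object C z" using ex_null_object by blast
  obtain f where f: "f \<in> hom C z a" using null_from[OF z a] .
  have "?P f" using null_strict_monic[OF z a f] homD(1-3)[OF f] slopes_ge_null[OF z] by simp
  moreover have "\<forall>n. ?P n \<longrightarrow> rk (Dom C n) < Suc (rk a)" using rk_strict_monic by (metis le_imp_less_Suc)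
  ultimately obtain n where n: "?P n" "\<And>p. ?P p \<Longrightarrow> rk (Dom C p) \<le> rk (Dom C n)"
    using ex_has_greatest_nat[of ?P f "\<lambda>n. rk (Dom C n)"] by blast
  then obtain q where q: "short_exact C n q" using short_exact_strict_monic by blast
  note D = short_exactD[OF q]
  have "slopes_less t (Cod C q)"
  proof (rule ccontr)
    assume "\<not> slopes_less t (Cod C q)"
    then obtain b where b: "b \<in> Arr C" "Cod C b = Cod C q" "slopes_ge t (Dom C b)" "\<not> zero_arrow C b"
      unfolding slopes_less_def using D Cod_in by blast
    then obtain p where "strict_monic C p" "Cod C p = Cod C n" "slopes_ge t (Dom C p)"
      "rk (Dom C n) < rk (Dom C p)"
      using slopes_ge_enlarge[OF q] n by metis
    with n show False by (metis not_le)
  qed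
  then have "torsion_part t n" using torsion_partI[OF q] n by simp
  with that n show ?thesis by blast
qed

lemma torsion_part_same:
  assumes "torsion_part t m" "torsion_part t n" "Cod C m = Cod C n" shows "same_subobject C m n"
  using assms unfolding torsion_part_def same_subobject_def by (metis monic_in_Arr strict_monic_monic)

text \<open>Here \<open>s\<close> is the least slope of a non-null quotient. If \<open>a\<close> is
  in the class at \<open>\<mu> a\<close>, that value is attained by \<open>a\<close> itself.
  Otherwise the quotient by the torsion part at \<open>\<mu> a\<close> has smaller rank, and its
  least slope is also that of \<open>a\<close>. The attained minimum is the source of left
  continuity.\<close>

lemma min_slope_exists:
  assumes "a \<in> Obj C" "\<not> null_object C a"
  obtains s where "\<And>t. slopes_ge t a \<longleftrightarrow> t \<le> s"
proof -
  have "\<exists>s. \<forall>t. slopes_ge t a \<longleftrightarrow> t \<le> s" using assms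
  proof (induction "rk a" arbitrary: a rule: less_induct)
    case less
    note a = less.prems
    show ?case
    proof (cases "slopes_ge (\<mu> a) a")
      case True
      have "t \<le> \<mu> a" if "slopes_ge t a" for t using slopes_ge_deg[OF that] deg_ge_iff[OF a] by simp
      then show ?thesis using slopes_ge_antimono[OF True] by blast
    next
      case False
      obtain n where n: "torsion_part (\<mu> a) n" "Cod C n = a" using torsion_part_exists[OF a(1)] .
      have ns: "strict_monic C n" "slopes_ge (\<mu> a) (Dom C n)" using n unfolding torsion_part_def by auto
      obtain q where q: "short_exact C n q" using short_exact_strict_monic[OF ns(1)] .
      note D = short_exactD[OF q]
      have F: "slopes_less (\<mu> a) (Cod C q)" using torsion_part_cokernel[OF n(1) q] .
      have qO: "Cod C q \<in> Obj C" using D Cod_in by blast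
      have nz: "\<not> null_object C (Cod C q)"
      proof
        assume "null_object C (Cod C q)"
        then have "slopes_ge (\<mu> a) (Cod C q)" using slopes_ge_null by blast
        then show False using slopes_ge_extension[OF q ns(2)] n(2) False by simp
      qed
      have d: "deg (Cod C q) < nsmul (rk (Cod C q)) (\<mu> a)" using slopes_less_deg[OF F nz] .
      \<comment> \<open>A torsion part of rank 0 would leave a quotient with the rank and degree of
        \<open>a\<close>, yet of slope below \<open>\<mu> a\<close>.\<close>
      have "rk (Dom C n) > 0"
      proof (rule ccontr)
        assume "\<not> rk (Dom C n) > 0"
        then have "rk (Dom C n) = 0" "deg (Dom C n) = 0" using deg_rk_0 Dom_in D by auto
        then have "rk (Cod C q) = rk a" "deg (Cod C q) = deg a" using rk_exact[OF q] deg_exact[OF q] n by auto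
        with d show False using a unfolding degree_def by simp
      qed
      then have "rk (Cod C q) < rk a" using rk_exact[OF q] n by simp
      then obtain s where s: "\<And>t. slopes_ge t (Cod C q) \<longleftrightarrow> t \<le> s" using less.hyps[OF _ qO nz] by blast
      have "slopes_ge s (Cod C q)" using s by simp
      then have "nsmul (rk (Cod C q)) s < nsmul (rk (Cod C q)) (\<mu> a)"
        using slopes_ge_deg d by (meson le_less_trans)
      \<comment> \<open>Consequently \<open>Dom C n\<close> is in the class for every
        \<open>t \<le> s\<close>, and closure under extensions carries the condition from the
        quotient to \<open>a\<close>.\<close>
      then have "s \<le> \<mu> a" by (meson leD le_cases nsmul_mono)
      then have "slopes_ge t a" if "t \<le> s" for t
        using slopes_ge_extension[OF q, of t] slopes_ge_antimono[OF ns(2), of t] s[of t] that n(2) by simp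
      moreover have "t \<le> s" if "slopes_ge t a" for t
        using slopes_ge_epi[of t q] that D n(2) s by simp
      ultimately show ?thesis by blast
    qed
  qed
  with that show ?thesis by blast
qed

end

section \<open>Breaks and degrees of filtrations\<close>

text \<open>The body of \<open>has_breaks\<close> with its witnesses as parameters, so that breaks
  and chain members can be named and carried from one filtration to another.\<close>

definition break_data ::
  "('o, 'm, 'z) cat_scheme \<Rightarrow> ('l::linorder, 'o, 'm) filt \<Rightarrow> 'o \<Rightarrow> nat \<Rightarrow> (nat \<Rightarrow> 'l) \<Rightarrow> (nat \<Rightarrow> 'm) \<Rightarrow> bool"
where
  "break_data C F M r l m \<longleftrightarrow>
     r \<ge> 1 \<and>
     (\<forall>i \<in> {1..<r}. l (i + 1) < l i) \<and>
     (\<forall>i \<in> {0..r}. strict_monic C (m i) \<and> Cod C (m i) = M) \<and>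
     null_object C (Dom C (m 0)) \<and>
     same_subobject C (m r) (Id C M) \<and>
     (\<forall>i \<in> {0..<r}. subobject_le C (m i) (m (i + 1)) \<and> \<not> same_subobject C (m i) (m (i + 1))) \<and>
     (\<forall>t. t \<le> l r \<longrightarrow> same_subobject C (Incl F (t, M)) (Id C M)) \<and>
     (\<forall>i \<in> {1..<r}. \<forall>t. l (i + 1) < t \<and> t \<le> l i \<longrightarrow> same_subobject C (Incl F (t, M)) (m i)) \<and>
     (\<forall>t. t > l 1 \<longrightarrow> null_object C (Omap F (t, M)))"

lemma has_breaks_iff: "has_breaks C F M \<longleftrightarrow> (\<exists>r l m. break_data C F M r l m)"
  unfolding has_breaks_def break_data_def ..

lemma op_order_cat_simps [simp]:
  "Obj (op_order_cat S) = S" "Arr (op_order_cat S) = {(a, b). a \<in> S \<and> b \<in> S \<and> b \<le> a}"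
  "Dom (op_order_cat S) = fst" "Cod (op_order_cat S) = snd" "Id (op_order_cat S) = (\<lambda>a. (a, a))"
  "Cmp (op_order_cat S) g f = (fst f, snd g)"
  by (simp_all add: op_order_cat_def)

lemma prod_cat_simps [simp]:
  "Obj (prod_cat A B) = Obj A \<times> Obj B" "Arr (prod_cat A B) = Arr A \<times> Arr B"
  "Dom (prod_cat A B) = map_prod (Dom A) (Dom B)" "Cod (prod_cat A B) = map_prod (Cod A) (Cod B)"
  "Id (prod_cat A B) = map_prod (Id A) (Id B)"
  "Cmp (prod_cat A B) g f = (Cmp A (fst g) (fst f), Cmp B (snd g) (snd f))"
  by (simp_all add: prod_cat_def)

lemma snd_func_simps [simp]: "Omap snd_func = snd" "Amap snd_func = snd"
  by (simp_all add: snd_func_def)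

lemma step_diagram_simps [simp]:
  "Omap (step_diagram C F M) t = Omap F (t, M)" "Amap (step_diagram C F M) a = Amap F (a, Id C M)"
  by (simp_all add: step_diagram_def)

context proto_abelian
begin

lemma filtration_arrow:
  assumes "is_filtration C F" "f \<in> hom C M N" "t \<le> s"
  shows "Amap F ((s, t), f) \<in> hom C (Omap F (s, M)) (Omap F (t, N))"
    "Incl F (t, N) \<odot> Amap F ((s, t), f) = f \<odot> Incl F (s, M)"
proof -
  note fA = homD[OF assms(2)]
  have 1: "((s, t), f) \<in> Arr (prod_cat (op_order_cat UNIV) C)" using fA assms(3) by simp
  have "\<forall>a \<in> Arr (prod_cat (op_order_cat UNIV) C). Amap F a \<in>
      hom C (Omap F (Dom (prod_cat (op_order_cat UNIV) C) a)) (Omap F (Cod (prod_cat (op_order_cat UNIV) C) a))"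
    using assms(1) unfolding is_filtration_def is_func_def by blast
  then show "Amap F ((s, t), f) \<in> hom C (Omap F (s, M)) (Omap F (t, N))" using 1 fA by fastforce
  have "\<forall>a \<in> Arr (prod_cat (op_order_cat UNIV) C).
      Incl F (Cod (prod_cat (op_order_cat UNIV) C) a) \<odot> Amap F a =
      snd a \<odot> Incl F (Dom (prod_cat (op_order_cat UNIV) C) a)"
    using assms(1) unfolding is_filtration_def nat_trans_def by simp
  then show "Incl F (t, N) \<odot> Amap F ((s, t), f) = f \<odot> Incl F (s, M)" using 1 fA by fastforce
qed

lemma filtration_Incl:
  assumes "is_filtration C F" "M \<in> Obj C"
  shows "Incl F (t, M) \<in> hom C (Omap F (t, M)) M" "strict_monic C (Incl F (t, M))"
    "monic C (Incl F (t, M))" "Omap F (t, M) \<in> Obj C"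
proof -
  have "Incl F \<in> (\<Pi>\<^sub>E x \<in> UNIV \<times> Obj C. hom C (Omap F x) (snd x))"
    using assms(1) unfolding is_filtration_def nat_trans_def by simp
  then show 1: "Incl F (t, M) \<in> hom C (Omap F (t, M)) M"
    using assms(2) PiE_mem[of "Incl F" "UNIV \<times> Obj C" _ "(t, M)"] by fastforce
  show "strict_monic C (Incl F (t, M))" using assms unfolding is_filtration_def by simp
  then show "monic C (Incl F (t, M))" using strict_monic_monic by blast
  show "Omap F (t, M) \<in> Obj C" using homD[OF 1] by simp
qed

lemma filtration_step:
  assumes "is_filtration C F" "M \<in> Obj C" "t \<le> s"
  shows "Amap F ((s, t), Id C M) \<in> hom C (Omap F (s, M)) (Omap F (t, M))"
    "Incl F (t, M) \<odot> Amap F ((s, t), Id C M) = Incl F (s, M)"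
    "strict_monic C (Amap F ((s, t), Id C M))"
proof -
  note I = filtration_Incl[OF assms(1,2)]
  show 1: "Amap F ((s, t), Id C M) \<in> hom C (Omap F (s, M)) (Omap F (t, M))"
    using filtration_arrow[OF assms(1) Id_in_hom assms(3)] assms(2) by simp
  show 2: "Incl F (t, M) \<odot> Amap F ((s, t), Id C M) = Incl F (s, M)"
    using filtration_arrow[OF assms(1) Id_in_hom assms(3), of M] assms(2) Id_Cmp[OF I(1)] by simp
  show "strict_monic C (Amap F ((s, t), Id C M))"
    using strict_monic_CmpD[of "Incl F (t, M)" "Amap F ((s, t), Id C M)"] 2 I homD[OF 1]
      homD[OF I(1)] by simp
qed

text \<open>On the interval from \<open>t\<close> (excluded) to \<open>s0\<close> all transitions
  are isomorphisms, and this interval is cofinal in the diagram, whose arrows run downwards in the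
  index.\<close>

lemma steady_colimit:
  assumes F: "is_filtration C F" and M: "M \<in> Obj C" and t: "t < s0"
    and steady: "\<And>s. t < s \<Longrightarrow> s \<le> s0 \<Longrightarrow> subobject_le C (Incl F (s, M)) (Incl F (s0, M))"
  obtains c where "is_colimit (op_order_cat {t<..}) C (step_diagram C F M) (Omap F (s0, M)) c"
    "\<And>s. t < s \<Longrightarrow> Amap F ((s0, t), Id C M) \<odot> c s = Amap F ((s, t), Id C M)"
proof -
  note I = filtration_Incl[OF F M]
  note IA = homD[OF I(1)]
  note S = filtration_step[OF F M]
  note SA = homD[OF S(1)]
  \<comment> \<open>Below \<open>s0\<close> the leg inverts a transition, above \<open>s0\<close> it
    is the transition itself.\<close>
  have "\<exists>h. h \<in> hom C (Omap F (s, M)) (Omap F (s0, M)) \<and> Incl F (s0, M) \<odot> h = Incl F (s, M)" if "t < s" for s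
  proof (cases "s \<le> s0")
    case True
    then show ?thesis using steady[OF that True] IA(2) unfolding subobject_le_def by auto
  next
    case False
    then have "s0 \<le> s" by simp
    then show ?thesis using S(1,2) by blast
  qed
  then obtain c where c: "\<And>s. t < s \<Longrightarrow> c s \<in> hom C (Omap F (s, M)) (Omap F (s0, M))"
    "\<And>s. t < s \<Longrightarrow> Incl F (s0, M) \<odot> c s = Incl F (s, M)" by metis
  have cancel: "g = h" if "Incl F (s, M) \<odot> g = Incl F (s, M) \<odot> h"
    "g \<in> hom C x (Omap F (s, M))" "h \<in> hom C x (Omap F (s, M))" for s g h x
    using monic_cancel[OF I(3), of g x s h] that IA(2) by simp
  have co: "c s' \<odot> Amap F ((s, s'), Id C M) = c s" if "t < s'" "s' \<le> s" for s s'
  proof (rule cancel[of s0])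
    have ts: "t < s" using that by simp
    show "Incl F (s0, M) \<odot> (c s' \<odot> Amap F ((s, s'), Id C M)) = Incl F (s0, M) \<odot> c s"
      using c(2)[OF that(1)] c(2)[OF ts] S(2)[OF that(2)]
        Cmp_assoc[OF S(1)[OF that(2)] c(1)[OF that(1)] I(1)] by simp
    show "c s' \<odot> Amap F ((s, s'), Id C M) \<in> hom C (Omap F (s, M)) (Omap F (s0, M))"
      using Cmp_in_hom[OF S(1)[OF that(2)] c(1)[OF that(1)]] .
    show "c s \<in> hom C (Omap F (s, M)) (Omap F (s0, M))" using c(1)[OF ts] .
  qed
  \<comment> \<open>Since \<open>s0\<close> is an index of the diagram, the leg there forces the
    mediating arrow to be \<open>d s0\<close>.\<close>
  have cs0: "c s0 = Id C (Omap F (s0, M))"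
    by (rule cancel[of s0]) (use c[OF t] Cmp_Id[OF I(1)] Id_in_hom[OF I(4)] in auto)
  have cinv: "Amap F ((s0, s), Id C M) \<odot> c s = Id C (Omap F (s, M))" if "t < s" "s \<le> s0" for s
  proof (rule cancel[of s])
    show "Incl F (s, M) \<odot> (Amap F ((s0, s), Id C M) \<odot> c s) = Incl F (s, M) \<odot> Id C (Omap F (s, M))"
      using Cmp_assoc[OF c(1)[OF that(1)] S(1)[OF that(2)] I(1)] S(2)[OF that(2)] c(2)[OF that(1)]
        Cmp_Id[OF I(1)] by simp
  qed (use Cmp_in_hom[OF c(1)[OF that(1)] S(1)[OF that(2)]] Id_in_hom[OF I(4)] in auto)
  have cone: "is_cocone (op_order_cat {t<..}) C (step_diagram C F M) (Omap F (s0, M)) c"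
    unfolding is_cocone_def using c(1) co I(4) by auto
  have "is_colimit (op_order_cat {t<..}) C (step_diagram C F M) (Omap F (s0, M)) c"
    unfolding is_colimit_def
  proof (intro conjI allI impI cone)
    fix x d assume "is_cocone (op_order_cat {t<..}) C (step_diagram C F M) x d"
    then have d: "\<And>s. t < s \<Longrightarrow> d s \<in> hom C (Omap F (s, M)) x"
      "\<And>s s'. t < s' \<Longrightarrow> s' \<le> s \<Longrightarrow> d s' \<odot> Amap F ((s, s'), Id C M) = d s"
      unfolding is_cocone_def by auto
    show "\<exists>!h. h \<in> hom C (Omap F (s0, M)) x \<and> (\<forall>j \<in> Obj (op_order_cat {t<..}). h \<odot> c j = d j)"
    proof (rule ex1I[of _ "d s0"], intro conjI ballI)
      show "d s0 \<in> hom C (Omap F (s0, M)) x" using d(1)[OF t] .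
      fix s assume "s \<in> Obj (op_order_cat {t<..})"
      then have s: "t < s" by simp
      show "d s0 \<odot> c s = d s"
      proof (cases "s \<le> s0")
        case True
        have "d s0 \<odot> c s = d s \<odot> (Amap F ((s0, s), Id C M) \<odot> c s)"
          using Cmp_assoc[OF c(1)[OF s] S(1)[OF True] d(1)[OF s]] d(2)[OF s True] by simp
        then show ?thesis using cinv[OF s True] Cmp_Id[OF d(1)[OF s]] by simp
      next
        case False
        then have s0: "s0 \<le> s" by simp
        have "c s = Amap F ((s, s0), Id C M)"
          using co[OF t s0] cs0 Id_Cmp[OF S(1)[OF s0]] by simp
        then show ?thesis using d(2)[OF t s0] by simp
      qed
    next
      fix h assume "h \<in> hom C (Omap F (s0, M)) x \<and> (\<forall>j \<in> Obj (op_order_cat {t<..}). h \<odot> c j = d j)"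
      then have "h \<in> hom C (Omap F (s0, M)) x" "h \<odot> c s0 = d s0" using t by auto
      then show "h = d s0" using cs0 Cmp_Id by simp
    qed
  qed
  moreover have "Amap F ((s0, t), Id C M) \<odot> c s = Amap F ((s, t), Id C M)" if "t < s" for s
  proof (rule cancel[of t])
    have ts: "t \<le> s" "t \<le> s0" using that t by auto
    show "Incl F (t, M) \<odot> (Amap F ((s0, t), Id C M) \<odot> c s) = Incl F (t, M) \<odot> Amap F ((s, t), Id C M)"
      using Cmp_assoc[OF c(1)[OF that] S(1)[OF ts(2)] I(1)] S(2)[OF ts(1)] S(2)[OF ts(2)] c(2)[OF that]
      by simp
    show "Amap F ((s0, t), Id C M) \<odot> c s \<in> hom C (Omap F (s, M)) (Omap F (t, M))"
      using Cmp_in_hom[OF c(1)[OF that] S(1)[OF ts(2)]] .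
    show "Amap F ((s, t), Id C M) \<in> hom C (Omap F (s, M)) (Omap F (t, M))" using S(1)[OF ts(1)] .
  qed
  ultimately show ?thesis using that by blast
qed

text \<open>The hypothesis is vacuous if nothing lies above \<open>t\<close>, as for trivial
  \<open>\<Lambda>\<close>; the diagram is then empty and its colimit is initial, hence
  null.\<close>

lemma null_colimit:
  assumes F: "is_filtration C F" and M: "M \<in> Obj C" and z: "null_object C z"
    and null: "\<And>s. t < s \<Longrightarrow> null_object C (Omap F (s, M))"
  obtains c where "is_colimit (op_order_cat {t<..}) C (step_diagram C F M) z c"
    "\<And>s. t < s \<Longrightarrow> c s \<in> hom C (Omap F (s, M)) z"
proof -
  have "\<exists>f. f \<in> hom C (Omap F (s, M)) z" if "t < s" for s
    using null_from[OF null[OF that] null_in_Obj[OF z]] by blast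
  then obtain c where c: "\<And>s. t < s \<Longrightarrow> c s \<in> hom C (Omap F (s, M)) z" by metis
  have S: "Amap F ((s, s'), Id C M) \<in> hom C (Omap F (s, M)) (Omap F (s', M))" if "s' \<le> s" for s s'
    using filtration_step(1)[OF F M that] .
  have "c s' \<odot> Amap F ((s, s'), Id C M) = c s" if "t < s'" "s' \<le> s" for s s'
    using null_terminal[OF z Cmp_in_hom[OF S[OF that(2)] c[OF that(1)]] c] that by simp
  then have cone: "is_cocone (op_order_cat {t<..}) C (step_diagram C F M) z c"
    unfolding is_cocone_def using c null_in_Obj[OF z] by auto
  have "is_colimit (op_order_cat {t<..}) C (step_diagram C F M) z c"
    unfolding is_colimit_def
  proof (intro conjI allI impI cone)
    fix x d assume "is_cocone (op_order_cat {t<..}) C (step_diagram C F M) x d"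
    then have d: "\<And>s. t < s \<Longrightarrow> d s \<in> hom C (Omap F (s, M)) x" and x: "x \<in> Obj C"
      unfolding is_cocone_def by auto
    obtain h where h: "h \<in> hom C z x" using null_from[OF z x] .
    have "h \<odot> c s = d s" if "t < s" for s
      using null_initial[OF null[OF that] Cmp_in_hom[OF c[OF that] h] d[OF that]] .
    then show "\<exists>!h. h \<in> hom C z x \<and> (\<forall>j \<in> Obj (op_order_cat {t<..}). h \<odot> c j = d j)"
      using h null_initial[OF z] by (intro ex1I[of _ h]) auto
  qed
  with that c show ?thesis by blast
qed

end

section \<open>Graded ranks, and their relation to the breaks\<close>

context ranked_category
begin

text \<open>The choice in \<open>graded_rank\<close> is harmless: two colimits are isomorphic, so
  additivity of the rank gives every graded piece the same rank. It suffices to exhibit one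
  colimit.\<close>

lemma graded_rank_eq:
  assumes F: "is_filtration C F" and M: "M \<in> Obj C"
    and col: "is_colimit (op_order_cat {t<..}) C (step_diagram C F M) U c"
    and u: "u \<in> hom C U (Omap F (t, M))" "strict_monic C u"
    and uc: "\<And>s. t < s \<Longrightarrow> u \<odot> c s = Amap F ((s, t), Id C M)"
  shows "rk (Omap F (t, M)) = rk U + graded_rank C rk F M t"
proof -
  obtain q where q: "short_exact C u q" using short_exact_strict_monic[OF u(2)] .
  have "is_graded_piece C F t M (Cod C q)"
    unfolding is_graded_piece_def using col u(1) uc q by blast
  then have "is_graded_piece C F t M (SOME Q. is_graded_piece C F t M Q)" by (rule someI)
  then obtain U' c' u' q' where
    col': "is_colimit (op_order_cat {t<..}) C (step_diagram C F M) U' c'"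
    and u': "u' \<in> hom C U' (Omap F (t, M))"
    and q': "short_exact C u' q'" "Cod C q' = (SOME Q. is_graded_piece C F t M Q)"
    unfolding is_graded_piece_def by blast
  have "rk U' = rk U" using colimit_isomorphic[OF col' col] rk_isomorphic by blast
  then show ?thesis
    unfolding graded_rank_def using rk_exact[OF q'(1)] homD(2,3)[OF u'] q'(2) by simp
qed

lemma graded_rank_steady:
  assumes F: "is_filtration C F" and M: "M \<in> Obj C" and t: "t < s0"
    and steady: "\<And>s. t < s \<Longrightarrow> s \<le> s0 \<Longrightarrow> subobject_le C (Incl F (s, M)) (Incl F (s0, M))"
  shows "rk (Omap F (t, M)) = rk (Omap F (s0, M)) + graded_rank C rk F M t"
proof -
  obtain c where c: "is_colimit (op_order_cat {t<..}) C (step_diagram C F M) (Omap F (s0, M)) c"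
    "\<And>s. t < s \<Longrightarrow> Amap F ((s0, t), Id C M) \<odot> c s = Amap F ((s, t), Id C M)"
    using steady_colimit[OF F M t steady] by blast
  show ?thesis
    using graded_rank_eq[OF F M c(1) _ _ c(2)] filtration_step(1,3)[OF F M, of t s0] t by simp
qed

lemma graded_rank_null:
  assumes F: "is_filtration C F" and M: "M \<in> Obj C"
    and null: "\<And>s. t < s \<Longrightarrow> null_object C (Omap F (s, M))"
  shows "graded_rank C rk F M t = rk (Omap F (t, M))"
proof -
  obtain z where z: "null_object C z" using ex_null_object by blast
  obtain c where c: "is_colimit (op_order_cat {t<..}) C (step_diagram C F M) z c"
    "\<And>s. t < s \<Longrightarrow> c s \<in> hom C (Omap F (s, M)) z"
    using null_colimit[OF F M z null] by blast
  have O: "Omap F (t, M) \<in> Obj C" using filtration_Incl(4)[OF F M] .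
  obtain u where u: "u \<in> hom C z (Omap F (t, M))" using null_from[OF z O] .
  have "u \<odot> c s = Amap F ((s, t), Id C M)" if "t < s" for s
    using null_initial[OF null[OF that] Cmp_in_hom[OF c(2)[OF that] u]]
      filtration_step(1)[OF F M less_imp_le[OF that]] by blast
  then show ?thesis
    using graded_rank_eq[OF F M c(1) u null_strict_monic[OF z O u]] rk_null[OF z] by simp
qed

context
  fixes F :: "('l::linorder, 'a, 'b) filt" and M r l m
  assumes F: "is_filtration C F" and M: "M \<in> Obj C" and br: "break_data C F M r l m"
begin

lemma break_less: "1 \<le> i \<Longrightarrow> i < j \<Longrightarrow> j \<le> r \<Longrightarrow> l j < l i"
proof (induction j)
  case (Suc j)
  have "l (j + 1) < l j" using br Suc.prems unfolding break_data_def by simp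
  then show ?case using Suc by (cases "i = j") auto
qed simp

lemma break_mono: "1 \<le> i \<Longrightarrow> i \<le> j \<Longrightarrow> j \<le> r \<Longrightarrow> l j \<le> l i"
  using break_less by (metis le_neq_implies_less less_imp_le order_refl)

lemma break_inj: "inj_on l {1..r}"
  by (rule linorder_inj_onI) (use break_less in force)+

lemma break_r: "1 \<le> r"
  using br unfolding break_data_def by simp

lemma break_monic:
  assumes "i \<le> r"
  shows "strict_monic C (m i)" "Cod C (m i) = M" "monic C (m i)" "m i \<in> Arr C"
proof -
  show "strict_monic C (m i)" "Cod C (m i) = M" using br assms unfolding break_data_def by auto
  then show "monic C (m i)" "m i \<in> Arr C" using strict_monic_monic monic_in_Arr by blast+
qed

text \<open>Puts the last interval, unbounded below, on the same footing as the bounded ones; hence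
  the lower bound on \<open>t\<close> is conditional on \<open>i < r\<close>.\<close>

lemma break_step_same:
  assumes "i \<in> {1..r}" "t \<le> l i" "i < r \<Longrightarrow> l (i + 1) < t"
  shows "same_subobject C (Incl F (t, M)) (m i)"
proof (cases "i < r")
  case True
  then show ?thesis using br assms unfolding break_data_def by simp
next
  case False
  then have i: "i = r" using assms by simp
  have 1: "same_subobject C (Incl F (t, M)) (Id C M)" "same_subobject C (m r) (Id C M)"
    using br assms(2) i unfolding break_data_def by auto
  show ?thesis
    using same_subobject_trans[OF 1(1) same_subobject_sym[OF 1(2)]] break_monic(2,4)[OF order_refl]
      homD(1-3)[OF filtration_Incl(1)[OF F M]] M i by simp
qed

lemma break_locate:
  assumes "t \<le> l 1" obtains i where "i \<in> {1..r}" "t \<le> l i" "i < r \<Longrightarrow> l (i + 1) < t"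
proof -
  define A where "A = {i \<in> {1..r}. t \<le> l i}"
  have A: "finite A" "A \<noteq> {}" unfolding A_def using assms break_r by auto
  let ?i = "Max A"
  have "?i \<in> A" using Max_in[OF A] .
  moreover have "l (?i + 1) < t" if "?i < r"
  proof (rule ccontr)
    assume "\<not> l (?i + 1) < t"
    then have "?i + 1 \<in> A" using that unfolding A_def by auto
    then show False using Max_ge[OF A(1)] by fastforce
  qed
  ultimately show ?thesis using that unfolding A_def by blast
qed

lemma break_step_null: "l 1 < t \<Longrightarrow> null_object C (Omap F (t, M))"
  using br unfolding break_data_def by blast

lemma break_step_rk:
  assumes "i \<in> {1..r}" "t \<le> l i" "i < r \<Longrightarrow> l (i + 1) < t"
  shows "rk (Omap F (t, M)) = rk (Dom C (m i))"
  using rk_same_subobject[OF break_step_same[OF assms]] filtration_Incl[OF F M] break_monic(2,3)[of i]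
    homD(2,3)[OF filtration_Incl(1)[OF F M]] assms(1) by simp

text \<open>Includes \<open>i = 1\<close>, where no break lies above and both subobjects are
  null.\<close>

lemma break_above_same:
  assumes "i \<in> {1..r}" "l i < s" "2 \<le> i \<Longrightarrow> s \<le> l (i - 1)"
  shows "same_subobject C (Incl F (s, M)) (m (i - 1))"
proof (cases "2 \<le> i")
  case True
  then have "i - 1 \<in> {1..r}" using assms(1) by auto
  then show ?thesis using break_step_same[of "i - 1" s] assms True by simp
next
  case False
  then have i: "i = 1" using assms by simp
  have I: "Incl F (s, M) \<in> hom C (Omap F (s, M)) M" using filtration_Incl(1)[OF F M] .
  have "null_object C (Dom C (m 0))" using br unfolding break_data_def by blast
  moreover have "null_object C (Dom C (Incl F (s, M)))"
    using break_step_null assms(2) i homD(2)[OF I] by simp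
  ultimately show ?thesis
    unfolding same_subobject_def using subobject_le_null homD(1,3)[OF I] break_monic[of 0] i by simp
qed

lemma break_rk_less:
  assumes "i < r" shows "rk (Dom C (m i)) < rk (Dom C (m (i + 1)))"
proof -
  have le: "subobject_le C (m i) (m (i + 1))" "\<not> same_subobject C (m i) (m (i + 1))"
    using br assms unfolding break_data_def by auto
  have M: "strict_monic C (m i)" "strict_monic C (m (i + 1))" "Cod C (m i) = Cod C (m (i + 1))"
    using break_monic[of i] break_monic[of "i + 1"] assms by auto
  show ?thesis
    using rk_subobject_le[OF le(1) M] same_subobject_if_rk[OF le(1) M] le(2) by linarith
qed

lemma break_rk_0: "rk (Dom C (m 0)) = 0"
  using br rk_null unfolding break_data_def by blast

lemma break_rk_r: "rk (Dom C (m r)) = rk M"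
proof -
  have "same_subobject C (m r) (Id C M)" using br unfolding break_data_def by blast
  then show ?thesis
    using rk_same_subobject[of "m r" "Id C M"] break_monic[of r] monic_Id[OF M] M by simp
qed

text \<open>Just above \<open>l i\<close> the steps are constantly \<open>m (i - 1)\<close>, or null
  if \<open>i = 1\<close>, so this is also the colimit of the steps above
  \<open>l i\<close>.\<close>

lemma graded_rank_break:
  assumes i: "i \<in> {1..r}"
  shows "rk (Dom C (m i)) = rk (Dom C (m (i - 1))) + graded_rank C rk F M (l i)"
proof -
  have nxt: "i < r \<Longrightarrow> l (i + 1) < l i" using break_less[of i "i + 1"] i by simp
  have rki: "rk (Omap F (l i, M)) = rk (Dom C (m i))" using break_step_rk[OF i order_refl nxt] .
  show ?thesis
  proof (cases "2 \<le> i")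
    case True
    have i1: "i - 1 \<le> r" "1 \<le> i - 1" using i True by auto
    have li: "l i < l (i - 1)" using break_less[of "i - 1" i] i i1 by simp
    have same: "same_subobject C (Incl F (s, M)) (m (i - 1))" if "l i < s" "s \<le> l (i - 1)" for s
      using break_above_same[OF i that] .
    have "subobject_le C (Incl F (s, M)) (Incl F (l (i - 1), M))" if "l i < s" "s \<le> l (i - 1)" for s
      using same_subobject_trans[OF same[OF that] same_subobject_sym[OF same[OF li order_refl]]]
        homD(1-3)[OF filtration_Incl(1)[OF F M]] break_monic[OF i1(1)]
      unfolding same_subobject_def by simp
    note 1 = graded_rank_steady[OF F M li this]
    have "rk (Omap F (l (i - 1), M)) = rk (Dom C (m (i - 1)))"
      using break_step_rk[of "i - 1" "l (i - 1)"] li i i1 by simp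
    with 1 rki show ?thesis by simp
  next
    case False
    then have i1: "i = 1" using i by simp
    then show ?thesis using graded_rank_null[OF F M, of "l 1"] break_step_null rki break_rk_0 by simp
  qed
qed

text \<open>Away from the breaks the step at \<open>t\<close> agrees with those just above it, or
  everything from \<open>t\<close> upwards is null.\<close>

lemma graded_rank_not_break:
  assumes "t \<notin> l ` {1..r}" shows "graded_rank C rk F M t = 0"
proof (cases "t \<le> l 1")
  case True
  then obtain i where i: "i \<in> {1..r}" "t \<le> l i" and nxt: "i < r \<Longrightarrow> l (i + 1) < t"
    using break_locate by blast
  have ti: "t < l i" using i assms by (metis image_eqI le_neq_trans)
  have same: "same_subobject C (Incl F (s, M)) (m i)" if "t \<le> s" "s \<le> l i" for s
    using break_step_same[OF i(1) that(2)] nxt that(1) by fastforce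
  have "subobject_le C (Incl F (s, M)) (Incl F (l i, M))" if "t < s" "s \<le> l i" for s
    using same_subobject_trans[OF same same_subobject_sym[OF same[OF i(2) order_refl]]] that
      homD(1-3)[OF filtration_Incl(1)[OF F M]] break_monic[of i] i
    unfolding same_subobject_def by simp
  note 1 = graded_rank_steady[OF F M ti this]
  have "rk (Omap F (t, M)) = rk (Dom C (m i))" using break_step_rk[OF i nxt] .
  moreover have "rk (Omap F (l i, M)) = rk (Dom C (m i))"
    using break_step_rk[OF i(1) order_refl] nxt ti by fastforce
  ultimately show ?thesis using 1 by simp
next
  case False
  then show ?thesis using graded_rank_null[OF F M, of t] break_step_null rk_null by simp
qed

lemma graded_rank_break_pos:
  assumes i: "i \<in> {1..r}" shows "graded_rank C rk F M (l i) > 0"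
proof -
  have "i - 1 < r" using i by auto
  then show ?thesis using graded_rank_break[OF i] break_rk_less[of "i - 1"] i by simp
qed

text \<open>The rank differences telescope along the chain from \<open>m 0\<close> to
  \<open>m r\<close>.\<close>

lemma sum_graded_rank: "(\<Sum>i\<in>{1..r}. graded_rank C rk F M (l i)) = rk M"
proof -
  have "j \<le> r \<Longrightarrow> (\<Sum>i\<in>{1..j}. graded_rank C rk F M (l i)) = rk (Dom C (m j))" for j
  proof (induction j)
    case (Suc j)
    then show ?case using graded_rank_break[of "Suc j"] by simp
  qed (simp add: break_rk_0)
  then show ?thesis using break_rk_r by simp
qed

end

section \<open>Degree and slope of a filtration in terms of its breaks\<close>

lemma filt_degree_breaks:
  fixes F :: "('l::uniquely_divisible_ordered_group, 'a, 'b) filt"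
  assumes F: "is_filtration C F" and M: "M \<in> Obj C" and br: "break_data C F M r l m"
  shows "filt_degree C rk F M = (\<Sum>i\<in>{1..r}. nsmul (graded_rank C rk F M (l i)) (l i))"
proof -
  have "{t. graded_rank C rk F M t \<noteq> 0} = l ` {1..r}"
    using graded_rank_not_break[OF assms] graded_rank_break_pos[OF assms] by force
  then show ?thesis
    unfolding filt_degree_def using sum.reindex[OF break_inj[OF assms]] by simp
qed

lemma nsmul_filt_slope:
  fixes F :: "('l::uniquely_divisible_ordered_group, 'a, 'b) filt"
  assumes "M \<in> nonzero_objects C"
  shows "nsmul (rk M) (filt_slope C rk F M) = filt_degree C rk F M"
  using assms nsmul_ndiv rk_eq_0_iff unfolding filt_slope_def nonzero_objects_def by auto

text \<open>If the step at \<open>t\<close> is everything, all breaks are at least \<open>t\<close>,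
  and the slope is their mean weighted by graded ranks.\<close>

lemma filt_slope_ge:
  fixes F :: "('l::uniquely_divisible_ordered_group, 'a, 'b) filt"
  assumes F: "is_filtration C F" and M: "M \<in> nonzero_objects C"
    and t: "same_subobject C (Incl F (t, M)) (Id C M)"
  shows "t \<le> filt_slope C rk F M"
proof -
  have MO: "M \<in> Obj C" "rk M > 0" using M rk_eq_0_iff unfolding nonzero_objects_def by auto
  obtain r l m where br: "break_data C F M r l m"
    using F M unfolding is_filtration_def has_breaks_iff by blast
  note [simp] = MO
  note B = F MO(1) br
  note I = filtration_Incl[OF F MO(1)]
  have full: "rk (Omap F (t, M)) = rk M"
    using rk_same_subobject[OF t] I monic_Id[of M] homD(2,3)[OF I(1)] by simp
  \<comment> \<open>Otherwise the step at \<open>t\<close> would be some \<open>m i\<close> with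
    \<open>i < r\<close>, whose rank is less than that of \<open>M\<close>.\<close>
  have "t \<le> l r"
  proof (rule ccontr)
    assume "\<not> t \<le> l r"
    have t1: "t \<le> l 1" using break_step_null[OF B, of t] rk_null full MO(2) by (metis leI less_irrefl)
    obtain i where i: "i \<in> {1..r}" "t \<le> l i" "i < r \<Longrightarrow> l (i + 1) < t"
      using break_locate[OF B t1] by blast
    have "i < r" using i \<open>\<not> t \<le> l r\<close> by (cases "i = r") auto
    have le: "rk (Dom C (m (i + 1))) \<le> rk M"
      using rk_strict_monic[OF break_monic(1)[OF B, of "i + 1"]] break_monic(2)[OF B, of "i + 1"] \<open>i < r\<close> by simp
    then show False using break_rk_less[OF B \<open>i < r\<close>] break_step_rk[OF B i] full by simp
  qed
  then have "t \<le> l i" if "i \<in> {1..r}" for i using break_mono[OF B, of i r] that by fastforce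
  then have "(\<Sum>i\<in>{1..r}. nsmul (graded_rank C rk F M (l i)) t) \<le> filt_degree C rk F M"
    unfolding filt_degree_breaks[OF B] by (intro sum_mono nsmul_mono) auto
  then have "nsmul (rk M) t \<le> filt_degree C rk F M"
    unfolding nsmul_sum_left[symmetric] sum_graded_rank[OF B] .
  then have "nsmul (rk M) t \<le> nsmul (rk M) (filt_slope C rk F M)" using nsmul_filt_slope[OF M, of F] by simp
  then show ?thesis using nsmul_le_iff[OF MO(2)] by blast
qed

text \<open>All breaks are below \<open>t\<close>; the mean is strictly below because the first
  break exists and has positive graded rank.\<close>

lemma filt_slope_less:
  fixes F :: "('l::uniquely_divisible_ordered_group, 'a, 'b) filt"
  assumes F: "is_filtration C F" and M: "M \<in> nonzero_objects C"
    and t: "null_object C (Omap F (t, M))"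
  shows "filt_slope C rk F M < t"
proof -
  have MO: "M \<in> Obj C" "rk M > 0" using M rk_eq_0_iff unfolding nonzero_objects_def by auto
  obtain r l m where br: "break_data C F M r l m"
    using F M unfolding is_filtration_def has_breaks_iff by blast
  note B = F MO(1) br
  have r1: "1 \<in> {1..r}" using break_r[OF B] by simp
  have "l 1 < t"
  proof (rule ccontr)
    assume "\<not> l 1 < t"
    then have t1: "t \<le> l 1" by simp
    obtain i where i: "i \<in> {1..r}" "t \<le> l i" "i < r \<Longrightarrow> l (i + 1) < t"
      using break_locate[OF B t1] by blast
    have "i - 1 < r" using i(1) by auto
    then show False using break_step_rk[OF B i] rk_null[OF t] break_rk_less[OF B, of "i - 1"] i(1) by simp
  qed
  then have less: "l i < t" if "i \<in> {1..r}" for i using break_mono[OF B, of 1 i] that by fastforce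
  have "filt_degree C rk F M < (\<Sum>i\<in>{1..r}. nsmul (graded_rank C rk F M (l i)) t)"
    unfolding filt_degree_breaks[OF B]
  proof (rule sum_strict_mono_ex1)
    show "\<forall>i\<in>{1..r}. nsmul (graded_rank C rk F M (l i)) (l i) \<le> nsmul (graded_rank C rk F M (l i)) t"
      using nsmul_mono less less_imp_le by blast
    show "\<exists>i\<in>{1..r}. nsmul (graded_rank C rk F M (l i)) (l i) < nsmul (graded_rank C rk F M (l i)) t"
      using nsmul_strict_mono[OF less[OF r1] graded_rank_break_pos[OF B r1]] r1 by blast
  qed simp
  then have "filt_degree C rk F M < nsmul (rk M) t"
    unfolding nsmul_sum_left[symmetric] sum_graded_rank[OF B] .
  then have "nsmul (rk M) (filt_slope C rk F M) < nsmul (rk M) t" using nsmul_filt_slope[OF M, of F] by simp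
  then show ?thesis using nsmul_le_iff[OF MO(2)] by (meson leD leI)
qed

lemma filt_degree_break_data:
  fixes F G :: "('l::uniquely_divisible_ordered_group, 'a, 'b) filt"
  assumes "is_filtration C F" "is_filtration C G" "M \<in> Obj C"
    "break_data C F M r l m" "break_data C G M r l m"
  shows "filt_degree C rk F M = filt_degree C rk G M"
proof -
  have "graded_rank C rk F M (l i) = graded_rank C rk G M (l i)" if "i \<in> {1..r}" for i
    using graded_rank_break[OF assms(1,3,4) that] graded_rank_break[OF assms(2,3,5) that] by simp
  then show ?thesis
    using filt_degree_breaks[OF assms(1,3,4)] filt_degree_breaks[OF assms(2,3,5)] by simp
qed

end

section \<open>Filtrations by torsion parts\<close>

text \<open>The quotient by \<open>m\<close> is killed by the epi \<open>m\<close>, so it is zero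
  and \<open>m\<close> is a kernel of a zero arrow.\<close>

lemma (in category_with_kernels_cokernels) strict_monic_epi_same_Id:
  assumes "strict_monic C m" "epi C m" shows "same_subobject C m (Id C (Cod C m))"
proof -
  obtain q where q: "short_exact C m q" using short_exact_strict_monic[OF assms(1)] .
  note D = short_exactD[OF q]
  have "zero_arrow C q"
    using epi_zero_cancel[OF assms(2) _ D(10)] hom_self[OF D(4)] D(5) by simp
  then obtain h where "h \<in> hom C (Cod C m) (Dom C m)" "m \<odot> h = Id C (Cod C m)"
    using kernel_of_zero[OF D(1)] by blast
  then show ?thesis
    unfolding same_subobject_def using subobject_le_Id D(3) Cod_in
    unfolding subobject_le_def by fastforce
qed

text \<open>The comparison isomorphisms are automatically natural: both sides of the naturality
  square agree after composition with the monic \<open>Incl G\<close>.\<close>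

lemma (in proto_abelian) filt_iso_if_same_subobject:
  assumes F: "is_filtration C F" and G: "is_filtration C G"
    and same: "\<And>t M. M \<in> Obj C \<Longrightarrow> same_subobject C (Incl F (t, M)) (Incl G (t, M))"
  shows "\<exists>\<phi>. filt_iso C F G \<phi>"
proof -
  define h where "h t M = (SOME h. h \<in> hom C (Omap F (t, M)) (Omap G (t, M)) \<and>
      Incl G (t, M) \<odot> h = Incl F (t, M) \<and> iso_arrow C h)" for t M
  have h: "h t M \<in> hom C (Omap F (t, M)) (Omap G (t, M))" "Incl G (t, M) \<odot> h t M = Incl F (t, M)"
    "iso_arrow C (h t M)" if "M \<in> Obj C" for t M
  proof -
    note FI = filtration_Incl[OF F that] and GI = filtration_Incl[OF G that]
    have "\<exists>h. h \<in> hom C (Omap F (t, M)) (Omap G (t, M)) \<and> Incl G (t, M) \<odot> h = Incl F (t, M) \<and>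
        iso_arrow C h"
      using same_subobject_iso[OF same[OF that, of t] FI(3) GI(3)] homD[OF FI(1)] homD[OF GI(1)] by metis
    from someI_ex[OF this] show "h t M \<in> hom C (Omap F (t, M)) (Omap G (t, M))"
      "Incl G (t, M) \<odot> h t M = Incl F (t, M)" "iso_arrow C (h t M)" by (auto simp: h_def)
  qed
  \<comment> \<open>Restricted to the objects because \<open>nat_trans\<close> demands extensional
    families.\<close>
  define \<phi> where "\<phi> = (\<lambda>x \<in> UNIV \<times> Obj C. h (fst x) (snd x))"
  have \<phi>: "\<phi> (t, M) = h t M" if "M \<in> Obj C" for t M using that by (simp add: \<phi>_def)
  have nat: "h t N \<odot> Amap F ((s, t), f) = Amap G ((s, t), f) \<odot> h s M"
    if f: "f \<in> hom C M N" and ts: "t \<le> s" for f M N s t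
  proof -
    note fA = homD[OF f]
    note FA = filtration_arrow[OF F f ts] and GA = filtration_arrow[OF G f ts]
    note GI = filtration_Incl[OF G fA(5)]
    have "Incl G (t, N) \<odot> (h t N \<odot> Amap F ((s, t), f)) = f \<odot> Incl F (s, M)"
      using Cmp_assoc[OF FA(1) h(1)[OF fA(5)] GI(1)] h(2)[OF fA(5)] FA(2) by simp
    also have "\<dots> = (f \<odot> Incl G (s, M)) \<odot> h s M"
      using Cmp_assoc[OF h(1)[OF fA(4)] filtration_Incl(1)[OF G fA(4)] f] h(2)[OF fA(4)] by simp
    also have "\<dots> = Incl G (t, N) \<odot> (Amap G ((s, t), f) \<odot> h s M)"
      using Cmp_assoc[OF h(1)[OF fA(4)] GA(1) GI(1)] GA(2) by simp
    finally show ?thesis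
      using monic_cancel[OF GI(3)] Cmp_in_hom[OF FA(1) h(1)[OF fA(5)]]
        Cmp_in_hom[OF h(1)[OF fA(4)] GA(1)] homD(2)[OF GI(1)] by metis
  qed
  have "\<phi> \<in> (\<Pi>\<^sub>E x \<in> UNIV \<times> Obj C. hom C (Omap F x) (Omap G x))"
    unfolding \<phi>_def by (auto simp: h(1))
  moreover have "\<phi> (Cod (prod_cat (op_order_cat UNIV) C) a) \<odot> Amap F a =
      Amap G a \<odot> \<phi> (Dom (prod_cat (op_order_cat UNIV) C) a)"
    if "a \<in> Arr (prod_cat (op_order_cat UNIV) C)" for a
  proof -
    obtain s t f where a: "a = ((s, t), f)" by (metis surj_pair)
    have f: "f \<in> Arr C" "t \<le> s" using that a by auto
    show ?thesis using nat[OF hom_self[OF f(1)] f(2)] a \<phi> Dom_in[OF f(1)] Cod_in[OF f(1)] by simp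
  qed
  ultimately have "nat_trans (prod_cat (op_order_cat UNIV) C) C F G \<phi>"
    unfolding nat_trans_def by simp
  then show ?thesis unfolding filt_iso_def using h \<phi> by (intro exI[of _ \<phi>]) simp
qed

context sloped_category
begin

lemma torsion_part_same_subobject:
  assumes "torsion_part t m" "same_subobject C m n" "strict_monic C n" "Cod C m = Cod C n"
  shows "torsion_part t n"
proof -
  have m: "strict_monic C m" "slopes_ge t (Dom C m)" using assms(1) unfolding torsion_part_def by auto
  have A: "m \<in> Arr C" "n \<in> Arr C" "monic C m" "monic C n"
    using m assms strict_monic_monic monic_in_Arr by auto
  have "slopes_ge t (Dom C n)"
    using slopes_ge_isomorphic[OF m(2)] same_subobject_isomorphic assms A by blast
  moreover have "subobject_le C f n" if "f \<in> Arr C" "Cod C f = Cod C n" "slopes_ge t (Dom C f)" for f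
  proof -
    have "subobject_le C f m" using assms(1,4) that unfolding torsion_part_def by simp
    then show ?thesis using subobject_le_trans[of f m n] assms that A unfolding same_subobject_def by simp
  qed
  ultimately show ?thesis using assms(3) unfolding torsion_part_def by blast
qed

text \<open>The torsion part of \<open>Cod C n\<close>, once contained in the subobject
  \<open>n\<close>, is also the torsion part of \<open>Dom C n\<close>. Needed for two consecutive
  members of the chain of breaks.\<close>

lemma torsion_part_factor:
  assumes "torsion_part t (n \<odot> h)" "monic C n" "h \<in> Arr C" "Cod C h = Dom C n"
  shows "torsion_part t h"
proof -
  have n: "n \<in> Arr C" using monic_in_Arr[OF assms(2)] .
  note T = assms(1)[unfolded torsion_part_def]
  have "subobject_le C f h" if f: "f \<in> Arr C" "Cod C f = Cod C h" "slopes_ge t (Dom C f)" for f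
  proof -
    have "subobject_le C (n \<odot> f) (n \<odot> h)" using T f n assms(3,4) by simp
    then obtain y where y: "y \<in> hom C (Dom C f) (Dom C h)" "n \<odot> h \<odot> y = n \<odot> f"
      unfolding subobject_le_def using f n assms(3,4) by auto
    have "n \<odot> (h \<odot> y) = n \<odot> f" using y(2) homD(1-3)[OF y(1)] n assms(3,4) Cmp_assoc_Arr[of y h n] by simp
    then have "h \<odot> y = f"
      using monic_cancel[OF assms(2), of "h \<odot> y" "Dom C f" f] f homD(1-3)[OF y(1)] assms(3,4)
      by (simp add: hom_def)
    then show ?thesis unfolding subobject_le_def using y(1) by blast
  qed
  moreover have "strict_monic C h" using strict_monic_CmpD T assms n by blast
  moreover have "slopes_ge t (Dom C h)" using T n assms(3,4) by simp
  ultimately show ?thesis unfolding torsion_part_def by blast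
qed

text \<open>The meeting point of both directions: slope filtrations with slope function
  \<open>\<mu>\<close> have this form, and filtrations of this form are slope filtrations with slope
  function \<open>\<mu>\<close>.\<close>

definition torsion_filtration :: "('l, 'a, 'b) filt \<Rightarrow> bool" where
  "torsion_filtration F \<longleftrightarrow> is_filtration C F \<and> (\<forall>t. \<forall>M \<in> Obj C. torsion_part t (Incl F (t, M)))"

lemma torsion_filtration_same:
  assumes "torsion_filtration F" "torsion_filtration G"
  shows "\<exists>\<phi>. filt_iso C F G \<phi>"
proof (rule filt_iso_if_same_subobject)
  show FG: "is_filtration C F" "is_filtration C G" using assms unfolding torsion_filtration_def by auto
  fix t M assume M: "M \<in> Obj C"
  have "Cod C (Incl F (t, M)) = Cod C (Incl G (t, M))"
    using homD(3) filtration_Incl(1)[OF FG(1) M] filtration_Incl(1)[OF FG(2) M] by metis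
  then show "same_subobject C (Incl F (t, M)) (Incl G (t, M))"
    using torsion_part_same assms M unfolding torsion_filtration_def by blast
qed

text \<open>The step \<open>N\<close> at \<open>t\<close> equals its own step at \<open>t\<close>,
  because its filtration is induced from \<open>M\<close>; by functoriality so does every epi
  quotient of \<open>N\<close>, which bounds its slope below. Dually the step of \<open>M/N\<close>
  at \<open>t\<close> is null, hence so is that of every subobject of \<open>M/N\<close>, which
  bounds its slope above.\<close>

lemma slope_filtration_torsion:
  assumes F: "F \<in> slope_filtrations C rk" and slope: "filt_slope C rk F = \<mu>"
  shows "torsion_filtration F"
  unfolding torsion_filtration_def
proof (intro conjI allI ballI)
  show fF: "is_filtration C F" using F unfolding slope_filtrations_def by blast
  fix t M assume M: "M \<in> Obj C"
  note I = filtration_Incl[OF fF M]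
  note IA = homD[OF I(1)]
  let ?N = "Omap F (t, M)"
  note IN = filtration_Incl[OF fF I(4)]
  have sub: "induced_on_sub C F (Incl F (t, M))"
    and quo: "\<And>q. is_cokernel C q (Incl F (t, M)) \<Longrightarrow> induced_on_quotient C F q"
    using F M unfolding slope_filtrations_def by auto
  \<comment> \<open>The monic \<open>Incl F (t, M)\<close> is pulled back along itself; the pair of
    identities gives a section \<open>k\<close> of the inclusion of the step of
    \<open>N\<close>.\<close>
  obtain h where pb: "is_pullback C (Incl F (t, ?N)) h (Incl F (t, M)) (Incl F (t, M))"
    using sub IA(2,3) unfolding induced_on_sub_def by metis
  have "Id C ?N \<in> hom C ?N (Dom C (Incl F (t, M)))" using Id_in_hom[OF I(4)] IA(2) by simp
  then obtain k where k: "k \<in> hom C ?N (Omap F (t, ?N))" "Incl F (t, ?N) \<odot> k = Id C ?N"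
    using pb I(4) homD(2)[OF IN(1)] unfolding is_pullback_def by metis
  have "nsmul (rk (Cod C f)) t \<le> deg (Cod C f)" if f: "epi C f" "Dom C f = ?N" for f
  proof (cases "null_object C (Cod C f)")
    case True
    then show ?thesis using rk_null deg_rk_0 null_in_Obj by fastforce
  next
    case False
    have fA: "f \<in> hom C ?N (Cod C f)" using epi_in_Arr[OF f(1)] f(2) by (simp add: hom_def)
    have Q: "Cod C f \<in> Obj C" using homD[OF fA] by blast
    note IQ = filtration_Incl[OF fF Q]
    note A = filtration_arrow[OF fF fA order_refl]
    \<comment> \<open>The epi \<open>f\<close> factors through the step of its target, so this
      inclusion is both epi and strict monic, hence everything.\<close>
    have "Incl F (t, Cod C f) \<odot> (Amap F ((t, t), f) \<odot> k) = f"
      using Cmp_assoc[OF k(1) A(1) IQ(1)] A(2) Cmp_assoc[OF k(1) IN(1) fA] k(2) Cmp_Id[OF fA] by simp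
    then have "epi C (Incl F (t, Cod C f))"
      using epi_CmpD[of "Incl F (t, Cod C f)" "Amap F ((t, t), f) \<odot> k"] f(1)
        homD[OF Cmp_in_hom[OF k(1) A(1)]] homD[OF IQ(1)] by simp
    then have "same_subobject C (Incl F (t, Cod C f)) (Id C (Cod C f))"
      using strict_monic_epi_same_Id[OF IQ(2)] homD(3)[OF IQ(1)] by simp
    then have "t \<le> \<mu> (Cod C f)"
      using filt_slope_ge[OF fF] False Q slope unfolding nonzero_objects_def by blast
    then show ?thesis using deg_ge_iff[OF Q False] by blast
  qed
  then have N: "slopes_ge t (Dom C (Incl F (t, M)))"
    unfolding slopes_ge_def using I(4) IA(2) by simp
  obtain q where q: "short_exact C (Incl F (t, M)) q" using short_exact_strict_monic[OF I(2)] .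
  note D = short_exactD[OF q]
  have qO: "Cod C q \<in> Obj C" using Cod_in[OF D(4)] .
  note IX = filtration_Incl[OF fF qO]
  \<comment> \<open>The image of the zero arrow \<open>q \<odot> Incl F (t, M)\<close> is null: its
    cokernel \<open>c\<close> has the left inverse \<open>e\<close>, so the kernel of
    \<open>c\<close> is a zero arrow.\<close>
  have "is_image C (Incl F (t, Cod C q)) (q \<odot> Incl F (t, M))"
    using quo[OF D(2)] D(5) IA(3) unfolding induced_on_quotient_def by metis
  then obtain c where c: "is_cokernel C c (q \<odot> Incl F (t, M))" "is_kernel C (Incl F (t, Cod C q)) c"
    unfolding is_image_def by blast
  have qI: "q \<odot> Incl F (t, M) \<in> Arr C" "Cod C (q \<odot> Incl F (t, M)) = Cod C q" using D by auto
  have "zero_arrow C (Id C (Cod C q) \<odot> (q \<odot> Incl F (t, M)))"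
    using D(10) qI Id_Cod_Cmp[OF qI(1)] by simp
  then obtain e where e: "e \<in> hom C (Cod C c) (Cod C q)" "e \<odot> c = Id C (Cod C q)"
    using cokernel_desc[OF c(1), of "Id C (Cod C q)"] Id_in_hom[OF qO] qI(2) by metis
  have cA: "c \<in> hom C (Cod C q) (Cod C c)" using cokernel_in_hom(1)[OF c(1)] qI(2) by simp
  have "e \<odot> (c \<odot> Incl F (t, Cod C q)) = Incl F (t, Cod C q)"
    using Cmp_assoc[OF IX(1) cA e(1)] e(2) Id_Cmp[OF IX(1)] by simp
  moreover have "zero_arrow C (e \<odot> (c \<odot> Incl F (t, Cod C q)))"
    using zero_arrow_Cmp_left[OF kernel_zero[OF c(2)]] homD[OF e(1)] homD[OF Cmp_in_hom[OF IX(1) cA]] by simp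
  ultimately have null: "null_object C (Omap F (t, Cod C q))"
    using zero_monic_null[OF _ IX(3)] homD(2)[OF IX(1)] by simp
  \<comment> \<open>It suffices to see that the image of \<open>f\<close> is null: as a quotient of
    \<open>Dom C f\<close> it would have slope at least \<open>t\<close>, as a subobject of
    \<open>Cod C q\<close> slope below \<open>t\<close>.\<close>
  have "zero_arrow C f" if f: "f \<in> Arr C" "Cod C f = Cod C q" "slopes_ge t (Dom C f)" for f
  proof -
    obtain m g c where mc: "short_exact C m c" "Cod C m = Cod C f"
      and g: "g \<in> hom C (Dom C f) (Dom C m)" "m \<odot> g = f" "epi C g"
      using image_exists[OF f(1)] by metis
    note mD = short_exactD[OF mc(1)]
    let ?S = "Dom C m"
    have S: "?S \<in> Obj C" using Dom_in[OF mD(3)] .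
    note IS = filtration_Incl[OF fF S]
    have mA: "m \<in> hom C ?S (Cod C q)" using mD mc(2) f(2) by (simp add: hom_def)
    have "null_object C ?S"
    proof (rule ccontr)
      assume nz: "\<not> null_object C ?S"
      note A = filtration_arrow[OF fF mA order_refl[of t]]
      have "zero_arrow C (Incl F (t, Cod C q))"
        using zero_arrow_null_Dom homD[OF IX(1)] null by simp
      then have "zero_arrow C (m \<odot> Incl F (t, ?S))"
        using zero_arrow_Cmp_right[of "Incl F (t, Cod C q)" "Amap F ((t, t), m)"] A(2)
          homD[OF A(1)] homD[OF IX(1)] by simp
      then have "zero_arrow C (Incl F (t, ?S))"
        using monic_zero_cancel[OF mD(8) IS(1)] by blast
      then have "null_object C (Omap F (t, ?S))"
        using zero_monic_null[OF _ IS(3)] homD(2)[OF IS(1)] by simp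
      then have "\<mu> ?S < t" using filt_slope_less[OF fF] nz S slope unfolding nonzero_objects_def by blast
      moreover have "slopes_ge t ?S" using slopes_ge_epi[OF _ g(3)] f(3) homD(2,3)[OF g(1)] by simp
      ultimately show False using slopes_ge_deg deg_ge_iff[OF S nz] by (metis leD)
    qed
    then have "zero_arrow C m" using zero_arrow_null_Dom mD by blast
    then show ?thesis using zero_arrow_Cmp_right[of m g] g homD[OF g(1)] by simp
  qed
  then have "slopes_less t (Cod C q)" unfolding slopes_less_def using qO by blast
  then show "torsion_part t (Incl F (t, M))" using torsion_partI[OF q N] by blast
qed

text \<open>The quotient of \<open>m i\<close> by \<open>m (i - 1)\<close> has slope exactly
  \<open>l i\<close>; then the \<open>\<mu>\<close>-degrees of the chain obey the recursion of the
  partial sums of the filtration degree.\<close>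

lemma torsion_filtration_slope:
  assumes F: "torsion_filtration F" shows "filt_slope C rk F = \<mu>"
proof
  have fF: "is_filtration C F" using F unfolding torsion_filtration_def by blast
  fix M show "filt_slope C rk F M = \<mu> M"
  proof (cases "M \<in> nonzero_objects C")
    case False
    have "\<mu> \<in> extensional (nonzero_objects C)" using slope_function unfolding slope_functions_def by blast
    then show ?thesis unfolding filt_slope_def using False by (simp add: extensional_def)
  next
    case True
    then have M: "M \<in> Obj C" "\<not> null_object C M" "rk M > 0"
      using rk_eq_0_iff unfolding nonzero_objects_def by auto
    obtain r l m where br: "break_data C F M r l m"
      using fF True unfolding is_filtration_def has_breaks_iff by blast
    note B = fF M(1) br
    note I = filtration_Incl[OF fF M(1)]
    have IT: "torsion_part t (Incl F (t, M))" for t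
      using F M(1) unfolding torsion_filtration_def by blast
    have step: "deg (Dom C (m i)) = deg (Dom C (m (i - 1))) + nsmul (graded_rank C rk F M (l i)) (l i)"
      if i: "i \<in> {1..r}" for i
    proof -
      have i': "i \<le> r" "i - 1 \<le> r" "i - 1 < r" using i by auto
      note mi = break_monic[OF B i'(1)] and mi' = break_monic[OF B i'(2)]
      have "\<forall>j \<in> {0..<r}. subobject_le C (m j) (m (j + 1))" using br unfolding break_data_def by blast
      then have "subobject_le C (m (i - 1)) (m (i - 1 + 1))" using i'(3) by simp
      then have "subobject_le C (m (i - 1)) (m i)" using i by simp
      then obtain h where h: "h \<in> hom C (Dom C (m (i - 1))) (Dom C (m i))" "m i \<odot> h = m (i - 1)" "strict_monic C h"
        using subobject_le_strict mi mi' by metis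
      note hA = homD[OF h(1)]
      obtain q where q: "short_exact C h q" using short_exact_strict_monic[OF h(3)] .
      note D = short_exactD[OF q]
      let ?Q = "Cod C q"
      have QO: "?Q \<in> Obj C" using Cod_in[OF D(4)] .
      have rkQ: "rk ?Q = graded_rank C rk F M (l i)"
        using rk_exact[OF q] graded_rank_break[OF B i] hA by simp
      then have Q: "\<not> null_object C ?Q" using graded_rank_break_pos[OF B i] rk_null by fastforce
      have "torsion_part (l i) (m i)"
        using torsion_part_same_subobject[OF IT break_step_same[OF B i order_refl]] mi
          break_less[OF B, of i "i + 1"] i homD(3)[OF I(1)] by simp
      then have "slopes_ge (l i) (Dom C (m i))" unfolding torsion_part_def by blast
      then have "slopes_ge (l i) ?Q" using slopes_ge_epi[OF _ D(9)] D(5) hA by simp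
      then have ge: "l i \<le> \<mu> ?Q" using slopes_ge_deg deg_ge_iff[OF QO Q] by blast
      have "\<mu> ?Q \<le> l i"
      proof (rule ccontr)
        assume "\<not> \<mu> ?Q \<le> l i"
        \<comment> \<open>A value above \<open>l i\<close> at which \<open>m (i - 1)\<close> is
          still the torsion part, so that the quotient is torsion-free at \<open>s\<close> although
          \<open>s \<le> \<mu> ?Q\<close>. For \<open>i = 1\<close> there is no higher break to stay
          below.\<close>
        define s where "s = (if 2 \<le> i then min (\<mu> ?Q) (l (i - 1)) else \<mu> ?Q)"
        have "l i < l (i - 1)" if "2 \<le> i" using break_less[OF B, of "i - 1" i] that i' by simp
        then have s: "l i < s" "2 \<le> i \<Longrightarrow> s \<le> l (i - 1)" "s \<le> \<mu> ?Q"
          using \<open>\<not> \<mu> ?Q \<le> l i\<close> unfolding s_def by auto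
        have "torsion_part s (m (i - 1))"
          using torsion_part_same_subobject[OF IT break_above_same[OF B i s(1,2)]] mi'
            homD(3)[OF I(1)] by simp
        then have "torsion_part s h" using torsion_part_factor[of s "m i" h] h(2) mi hA by simp
        then have "slopes_less s ?Q" using torsion_part_cokernel q by blast
        then have "deg ?Q < nsmul (rk ?Q) s" using slopes_less_deg Q by blast
        then have "\<not> s \<le> \<mu> ?Q" using deg_ge_iff[OF QO Q, of s] by (meson leD)
        with s show False by simp
      qed
      with ge have "\<mu> ?Q = l i" by simp
      then have "deg ?Q = nsmul (graded_rank C rk F M (l i)) (l i)"
        using Q rkQ unfolding degree_def by simp
      then show ?thesis using deg_exact[OF q] hA by simp
    qed
    have "j \<le> r \<Longrightarrow> (\<Sum>i\<in>{1..j}. nsmul (graded_rank C rk F M (l i)) (l i)) = deg (Dom C (m j))" for j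
    proof (induction j)
      case 0
      then show ?case using deg_rk_0 break_rk_0[OF B] Dom_in break_monic(4)[OF B, of 0] by simp
    next
      case (Suc j)
      then show ?case using step[of "Suc j"] by (simp add: add.commute)
    qed
    then have "filt_degree C rk F M = deg (Dom C (m r))" using filt_degree_breaks[OF B] by simp
    also have "\<dots> = deg M"
    proof -
      have "isomorphic C (Dom C (m r)) M"
        using same_subobject_isomorphic[of "m r" "Id C M"] br break_monic[OF B order_refl] monic_Id[OF M(1)] M(1)
        unfolding break_data_def by simp
      moreover from this have "Dom C (m r) \<in> nonzero_objects C"
        using null_isomorphic Dom_in break_monic[OF B order_refl] M unfolding nonzero_objects_def by auto
      ultimately have "\<mu> (Dom C (m r)) = \<mu> M"
        using slope_function True unfolding slope_functions_def by blast
      then show ?thesis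
        using \<open>isomorphic C (Dom C (m r)) M\<close> null_isomorphic rk_isomorphic unfolding degree_def by metis
    qed
    also have "\<dots> = nsmul (rk M) (\<mu> M)" using M unfolding degree_def by simp
    finally have "nsmul (rk M) (filt_slope C rk F M) = nsmul (rk M) (\<mu> M)"
      using nsmul_filt_slope[OF True, of F] by simp
    then show ?thesis using nsmul_eq_iff[OF M(3)] by blast
  qed
qed

end

section \<open>Torsion parts induce on subobjects and quotients\<close>

context sloped_category
begin

text \<open>If \<open>s \<le> t\<close>, the torsion part at \<open>t\<close> is its own step at
  \<open>s\<close>; if \<open>s > t\<close>, the step of \<open>N\<close> at \<open>s\<close> lies
  inside the step at \<open>t\<close> and, being in the class, inside the step of the latter at
  \<open>s\<close>.\<close>

lemma torsion_filtration_induced_on_sub: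
  assumes F: "torsion_filtration F" and N: "N \<in> Obj C"
  shows "induced_on_sub C F (Incl F (t, N))"
  unfolding induced_on_sub_def
proof
  have fF: "is_filtration C F" and T: "\<And>s M. M \<in> Obj C \<Longrightarrow> torsion_part s (Incl F (s, M))"
    using F unfolding torsion_filtration_def by auto
  note I = filtration_Incl[OF fF N]
  note IA = homD[OF I(1)]
  let ?T = "Omap F (t, N)"
  note J = filtration_Incl[OF fF I(4)]
  note JA = homD[OF J(1)]
  fix s
  note A = filtration_arrow[OF fF I(1) order_refl[of s], of t]
  note AA = homD[OF A(1)]
  have "\<exists>!h. h \<in> hom C x (Omap F (s, ?T)) \<and> Incl F (s, ?T) \<odot> h = a \<and> Amap F ((s, s), Incl F (t, N)) \<odot> h = b"
    if a: "a \<in> hom C x ?T" and b: "b \<in> hom C x (Omap F (s, N))"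
      and eq: "Incl F (t, N) \<odot> a = Incl F (s, N) \<odot> b" for x a b
  proof -
    have "subobject_le C a (Incl F (s, ?T))"
    proof (cases "s \<le> t")
      case True
      have "slopes_ge s ?T"
        using T[OF N, of t] slopes_ge_antimono[OF _ True] IA(2) unfolding torsion_part_def by simp
      then have "subobject_le C (Id C ?T) (Incl F (s, ?T))"
        using T[OF I(4), of s] I(4) JA(3) unfolding torsion_part_def by simp
      moreover have "subobject_le C a (Id C ?T)" using subobject_le_Id homD[OF a] by blast
      ultimately show ?thesis
        using subobject_le_trans[of a "Id C ?T" "Incl F (s, ?T)"] homD[OF a] JA I(4) by simp
    next
      case False
      then have ts: "t \<le> s" by simp
      note S = filtration_step[OF fF N ts]
      have "slopes_ge s (Omap F (s, N))"
        using T[OF N, of s] IA(2) unfolding torsion_part_def by simp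
      then have le: "subobject_le C (Amap F ((s, t), Id C N)) (Incl F (s, ?T))"
        using T[OF I(4), of s] homD[OF S(1)] JA(3) unfolding torsion_part_def by simp
      have "a = Amap F ((s, t), Id C N) \<odot> b"
      proof (rule monic_cancel[OF I(3)])
        show "Incl F (t, N) \<odot> a = Incl F (t, N) \<odot> (Amap F ((s, t), Id C N) \<odot> b)"
          using eq S(2) Cmp_assoc[OF b S(1) I(1)] by simp
      qed (use a Cmp_in_hom[OF b S(1)] IA(2) in auto)
      then have "subobject_le C a (Amap F ((s, t), Id C N))"
        unfolding subobject_le_def using b homD[OF a] homD[OF S(1)] by auto
      then show ?thesis using subobject_le_trans[OF _ le] homD[OF a] homD[OF S(1)] JA by simp
    qed
    then obtain h where h: "h \<in> hom C x (Omap F (s, ?T))" "Incl F (s, ?T) \<odot> h = a"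
      unfolding subobject_le_def using homD[OF a] JA by auto
    have "Amap F ((s, s), Incl F (t, N)) \<odot> h = b"
    proof (rule monic_cancel[OF I(3)])
      show "Incl F (s, N) \<odot> (Amap F ((s, s), Incl F (t, N)) \<odot> h) = Incl F (s, N) \<odot> b"
        using Cmp_assoc[OF h(1) A(1) I(1)] A(2) Cmp_assoc[OF h(1) J(1) I(1)] h(2) eq by simp
    qed (use b Cmp_in_hom[OF h(1) A(1)] IA(2) in auto)
    moreover have "h' = h" if "h' \<in> hom C x (Omap F (s, ?T))" "Incl F (s, ?T) \<odot> h' = a" for h'
      using monic_cancel[OF J(3)] that h JA(2) by metis
    ultimately show ?thesis using h by blast
  qed
  then have "is_pullback C (Incl F (s, ?T)) (Amap F ((s, s), Incl F (t, N))) (Incl F (t, N)) (Incl F (s, N))"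
    unfolding is_pullback_def using IA JA AA A(2) by auto
  then show "\<exists>h. is_pullback C (Incl F (s, Dom C (Incl F (t, N)))) h (Incl F (t, N))
      (Incl F (s, Cod C (Incl F (t, N))))"
    using IA by auto
qed

text \<open>The image of a step is in the class, so it lies in the step of the quotient. For the
  converse with \<open>s \<le> t\<close>, the preimage of the step of the quotient is an extension
  inside the class, so it lies in the step of \<open>N\<close>. With \<open>s > t\<close> the
  quotient is torsion-free at \<open>t\<close>, hence at \<open>s\<close>, and its step is
  null.\<close>

lemma torsion_filtration_induced_on_quotient:
  assumes F: "torsion_filtration F" and N: "N \<in> Obj C" and q: "is_cokernel C q (Incl F (t, N))"
  shows "induced_on_quotient C F q"
  unfolding induced_on_quotient_def
proof
  have fF: "is_filtration C F" and T: "\<And>s M. M \<in> Obj C \<Longrightarrow> torsion_part s (Incl F (s, M))"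
    using F unfolding torsion_filtration_def by auto
  note I = filtration_Incl[OF fF N]
  note IA = homD[OF I(1)]
  have nq: "short_exact C (Incl F (t, N)) q"
    unfolding short_exact_def using strict_monic_kernel_cokernel[OF I(2) q] q by blast
  note D = short_exactD[OF nq]
  let ?X = "Cod C q"
  have X: "?X \<in> Obj C" using Cod_in[OF D(4)] .
  have qA: "q \<in> hom C N ?X" using D(4,5) IA(3) by (simp add: hom_def)
  note J = filtration_Incl[OF fF X]
  note JA = homD[OF J(1)]
  have tI: "slopes_ge s (Omap F (s, N))" for s
    using T[OF N, of s] IA(2) unfolding torsion_part_def by simp
  fix s
  have f: "q \<odot> Incl F (s, N) \<in> hom C (Omap F (s, N)) ?X" using Cmp_in_hom[OF I(1) qA] .
  note fA = homD[OF f]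
  obtain m g c where mc: "short_exact C m c" "Cod C m = Cod C (q \<odot> Incl F (s, N))"
    and c: "is_cokernel C c (q \<odot> Incl F (s, N))"
    and g: "g \<in> hom C (Dom C (q \<odot> Incl F (s, N))) (Dom C m)" "m \<odot> g = q \<odot> Incl F (s, N)" "epi C g"
    using image_exists[OF fA(1)] by metis
  note mD = short_exactD[OF mc(1)]
  have "slopes_ge s (Dom C m)" using slopes_ge_epi[OF _ g(3)] homD(2,3)[OF g(1)] fA tI by simp
  then have le1: "subobject_le C m (Incl F (s, ?X))"
    using T[OF X, of s] mD mc(2) fA JA(3) unfolding torsion_part_def by simp
  have z: "zero_arrow C (c \<odot> Incl F (s, ?X))"
  proof (cases "s \<le> t")
    case True
    obtain p e k where p: "strict_monic C p" "Cod C p = Cod C (Incl F (t, N))"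
      and ke: "short_exact C k e" "Dom C k = Dom C (Incl F (t, N))" "Cod C k = Dom C p"
        "Cod C e = Dom C (Incl F (s, ?X))"
      and eq: "q \<odot> p = Incl F (s, ?X) \<odot> e"
      using preimage_short_exact[OF nq J(2)[of s] JA(3)] by blast
    note eD = short_exactD[OF ke(1)]
    have pA: "p \<in> Arr C" "Cod C p = N" using p strict_monic_monic monic_in_Arr IA by auto
    have "slopes_ge s (Dom C k)" using ke(2) IA(2) tI[of t] slopes_ge_antimono[OF _ True] by simp
    moreover have "slopes_ge s (Cod C e)"
      using ke(4) T[OF X, of s] unfolding torsion_part_def by simp
    ultimately have "slopes_ge s (Dom C p)" using slopes_ge_extension[OF ke(1)] ke(3) by simp
    then have "subobject_le C p (Incl F (s, N))"
      using T[OF N, of s] pA IA(3) unfolding torsion_part_def by simp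
    then obtain y where y: "y \<in> hom C (Dom C p) (Omap F (s, N))" "Incl F (s, N) \<odot> y = p"
      unfolding subobject_le_def using IA(2) by auto
    have cA: "c \<in> hom C ?X (Cod C c)" using mD mc(2) fA by (simp add: hom_def)
    have eA: "e \<in> hom C (Dom C p) (Omap F (s, ?X))" using eD ke JA by (simp add: hom_def)
    have "(c \<odot> Incl F (s, ?X)) \<odot> e = (c \<odot> (q \<odot> Incl F (s, N))) \<odot> y"
      using Cmp_assoc[OF eA J(1) cA] eq y(2) Cmp_assoc[OF y(1) f cA] Cmp_assoc[OF y(1) I(1) qA] by simp
    moreover have "zero_arrow C ((c \<odot> (q \<odot> Incl F (s, N))) \<odot> y)"
      using zero_arrow_Cmp_right[OF cokernel_zero[OF c]] homD[OF y(1)] homD[OF Cmp_in_hom[OF f cA]] by simp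
    ultimately have "zero_arrow C ((c \<odot> Incl F (s, ?X)) \<odot> e)" by simp
    then show ?thesis
      using epi_zero_cancel[OF eD(9)] Cmp_in_hom[OF J(1) cA] homD[OF eA] by metis
  next
    case False
    have "slopes_less t ?X" using torsion_part_cokernel[OF T[OF N] nq] .
    then have "slopes_less s ?X" using slopes_less_mono False by simp
    then have "zero_arrow C (Incl F (s, ?X))"
      using T[OF X, of s] JA unfolding torsion_part_def slopes_less_def by simp
    then show ?thesis using zero_arrow_Cmp_left mD(4,5) mc(2) fA JA by simp
  qed
  have "Incl F (s, ?X) \<in> hom C (Dom C (Incl F (s, ?X))) (Dom C c)"
    using J(1) JA mD mc(2) fA by (simp add: hom_def)
  then have "subobject_le C (Incl F (s, ?X)) m"
    using kernel_lift[OF mD(1) _ z] unfolding subobject_le_def by metis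
  with le1 have "same_subobject C m (Incl F (s, ?X))" unfolding same_subobject_def by blast
  then have "is_kernel C (Incl F (s, ?X)) c"
    using kernel_same_subobject[OF mD(1)] J(3) JA mc(2) fA by simp
  then show "is_image C (Incl F (s, Cod C q)) (q \<odot> Incl F (s, Dom C q))"
    unfolding is_image_def using c D(5) IA(3) by auto
qed

lemma torsion_filtration_slope_filtration:
  assumes "torsion_filtration F" shows "F \<in> slope_filtrations C rk"
  using assms torsion_filtration_induced_on_sub torsion_filtration_induced_on_quotient
    torsion_filtration_slope slope_function
  unfolding slope_filtrations_def torsion_filtration_def by auto

lemma torsion_part_antimono:
  assumes "torsion_part s m" "torsion_part t n" "Cod C m = Cod C n" "t \<le> s"
  shows "subobject_le C m n"
  using assms slopes_ge_antimono monic_in_Arr[OF strict_monic_monic] unfolding torsion_part_def by blast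

section \<open>Breaks and functoriality of the torsion parts\<close>

text \<open>Torsion parts decrease in \<open>t\<close>, so each is determined by its rank
  \<open>g t\<close>, and the breaks can be read off from this decreasing function with natural
  values.\<close>

lemma torsion_breaks:
  assumes M: "M \<in> Obj C" "\<not> null_object C M"
    and I: "\<And>t. torsion_part t (I t)" "\<And>t. Cod C (I t) = M"
    and F: "\<And>t. Incl F (t, M) = I t" "\<And>t. Omap F (t, M) = Dom C (I t)"
  shows "has_breaks C F M"
proof -
  define g where "g t = rk (Dom C (I t))" for t
  have IS: "strict_monic C (I t)" "slopes_ge t (Dom C (I t))" for t
    using I unfolding torsion_part_def by auto
  have IA: "I t \<in> Arr C" "monic C (I t)" "Dom C (I t) \<in> Obj C" for t
    using IS strict_monic_monic monic_in_Arr Dom_in by blast+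
  have le: "subobject_le C (I s) (I t)" if "t \<le> s" for s t
    using torsion_part_antimono[OF I(1) I(1) _ that] I(2) by simp
  have g_le: "g s \<le> g t" if "t \<le> s" for s t
    unfolding g_def using rk_subobject_le[OF le[OF that] IS(1) IS(1)] I(2) by simp
  have same: "same_subobject C (I s) (I t)" if "t \<le> s" "g s = g t" for s t
    using same_subobject_if_rk[OF le[OF that(1)] IS(1) IS(1)] I(2) that(2) unfolding g_def by simp
  \<comment> \<open>The points just after which the rank drops.\<close>
  define B where "B = {t. g t > 0 \<and> (\<forall>u > t. g u < g t)}"
  \<comment> \<open>Left continuity: the least slope \<open>b\<close> of the step at
    \<open>t\<close> is the last index at which this step persists.\<close>
  have ex_B: "\<exists>b \<in> B. t \<le> b \<and> g b = g t" if pos: "g t > 0" for t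
  proof -
    have "\<not> null_object C (Dom C (I t))" using pos rk_null unfolding g_def by fastforce
    then obtain b where b: "\<And>u. slopes_ge u (Dom C (I t)) \<longleftrightarrow> u \<le> b" using min_slope_exists IA(3) by metis
    have tb: "t \<le> b" using b IS(2) by blast
    have "slopes_ge b (Dom C (I t))" using b by simp
    then have "subobject_le C (I t) (I b)" using I(1)[of b] I(2) IA unfolding torsion_part_def by simp
    then have "g t \<le> g b" unfolding g_def using rk_subobject_le IS(1) I(2) by metis
    then have gb: "g b = g t" using g_le[OF tb] by simp
    have "g u < g b" if "b < u" for u
    proof (rule ccontr)
      assume "\<not> g u < g b"
      then have "g u = g t" using g_le[of t u] gb tb that by simp
      then have "isomorphic C (Dom C (I u)) (Dom C (I t))"
        using same_subobject_isomorphic[OF same] IA(2) I(2) tb that by simp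
      then have "slopes_ge u (Dom C (I t))" using slopes_ge_isomorphic[OF IS(2)] by blast
      then show False using b that by simp
    qed
    then have "b \<in> B" unfolding B_def using gb pos by simp
    then show ?thesis using tb gb by blast
  qed
  \<comment> \<open>At its least slope the whole of \<open>M\<close> is a step, which yields a break
    \<open>b0\<close> of full rank.\<close>
  obtain s where s: "\<And>t. slopes_ge t M \<longleftrightarrow> t \<le> s" using min_slope_exists[OF M] by blast
  have "slopes_ge s M" using s by simp
  then have "subobject_le C (Id C M) (I s)" using I(1)[of s] I(2) M(1) unfolding torsion_part_def by simp
  then have "rk M \<le> g s"
    using rk_subobject_le[of "Id C M" "I s"] IS(1) I(2) strict_monic_Id M(1) ex_null_object
    unfolding g_def by auto
  moreover have g_rk: "g t \<le> rk M" for t unfolding g_def using rk_strict_monic[OF IS(1)] I(2) by metis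
  ultimately have gs: "g s = rk M" by (metis le_antisym)
  have "rk M > 0" using M rk_eq_0_iff by blast
  then obtain b0 where b0: "b0 \<in> B" "g b0 = rk M" using ex_B[of s] gs by auto
  \<comment> \<open>On \<open>B\<close> the rank strictly decreases, so \<open>B\<close> has at most
    as many elements as there are ranks up to \<open>rk M\<close>.\<close>
  have "inj_on g B" unfolding B_def by (rule linorder_inj_onI') force
  moreover have "finite (g ` B)" by (rule finite_subset[of _ "{..rk M}"]) (use g_rk in auto)
  ultimately have "finite B" using finite_imageD by blast
  then obtain r :: nat and l where r: "1 \<le> r" and lB: "l ` {1..r} = B"
    and less: "\<And>i j. 1 \<le> i \<Longrightarrow> i < j \<Longrightarrow> j \<le> r \<Longrightarrow> l j < l i"
    using enumerate_decreasing[of B] b0(1) by (metis empty_iff)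
  have mono: "l j \<le> l i" if "1 \<le> i" "i \<le> j" "j \<le> r" for i j
    using less[of i j] that by (cases "i = j") auto
  have lB': "l i \<in> B" if "1 \<le> i" "i \<le> r" for i using lB that by auto
  obtain z where z: "null_object C z" using ex_null_object by blast
  obtain o' where o': "o' \<in> hom C z M" using null_from[OF z M(1)] .
  note oA = homD[OF o']
  have oS: "strict_monic C o'" using null_strict_monic[OF z M(1) o'] .
  have full: "same_subobject C (I t) (Id C M)" if "t \<le> l r" for t
  proof -
    obtain j where "j \<in> {1..r}" "b0 = l j" using b0(1) lB by auto
    then have "l r \<le> b0" using mono[of j r] by simp
    then have "rk M \<le> g t" using g_le[of t b0] that b0(2) by simp
    then have "g t = rk M" using g_rk le_antisym by blast
    then show ?thesis
      using same_subobject_if_rk[OF subobject_le_Id, of "I t" M] IA(1) IS(1) I(2) strict_monic_Id[OF M(1) z] M(1)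
      unfolding g_def by simp
  qed
  \<comment> \<open>Breaks start at index 1, so \<open>m 0\<close> is supplied separately as an
    arrow from a null object.\<close>
  define m where "m i = (if i = 0 then o' else I (l i))" for i
  have "break_data C F M r l m"
    unfolding break_data_def
  proof (intro conjI ballI allI impI)
    show "1 \<le> r" by fact
    show "l (i + 1) < l i" if "i \<in> {1..<r}" for i using less[of i "i + 1"] that by simp
    show "strict_monic C (m i)" "Cod C (m i) = M" for i
      using IS(1) I(2) oS oA(3) unfolding m_def by auto
    show "null_object C (Dom C (m 0))" using z oA(2) unfolding m_def by simp
    show "same_subobject C (m r) (Id C M)" using full r unfolding m_def by simp
    show "same_subobject C (Incl F (t, M)) (Id C M)" if "t \<le> l r" for t using full[OF that] F by simp
    fix i
    show "subobject_le C (m i) (m (i + 1))" if "i \<in> {0..<r}"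
    proof (cases "i = 0")
      case True
      then show ?thesis using subobject_le_null[of o'] z oA IA(1) I(2) unfolding m_def by simp
    next
      case False
      then show ?thesis using le[of "l (i + 1)" "l i"] less[of i "i + 1"] that unfolding m_def by simp
    qed
    show "\<not> same_subobject C (m i) (m (i + 1))" if i: "i \<in> {0..<r}"
    proof
      have M: "monic C (m j)" "Cod C (m j) = M" for j
        using oS strict_monic_monic IA(2) I(2) oA(3) unfolding m_def by auto
      assume "same_subobject C (m i) (m (i + 1))"
      then have eq: "rk (Dom C (m i)) = rk (Dom C (m (i + 1)))" using rk_same_subobject M by simp
      have B: "l (i + 1) \<in> B" using lB' i by simp
      show False
      proof (cases "i = 0")
        case True
        then show ?thesis using eq B rk_null[OF z] oA(2) unfolding m_def B_def g_def by simp
      next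
        case False
        then have "l (i + 1) < l i" using less[of i "i + 1"] i by simp
        then have "g (l i) < g (l (i + 1))" using B unfolding B_def by blast
        then show ?thesis using eq False unfolding m_def g_def by simp
      qed
    qed
  next
    fix i t assume i: "i \<in> {1..<r}" and t: "l (i + 1) < t \<and> t \<le> l i"
    have "g (l i) > 0" using lB'[of i] i unfolding B_def by simp
    then have "g t > 0" using g_le[of t "l i"] t by simp
    then obtain b where "b \<in> B" "t \<le> b" "g b = g t" using ex_B by blast
    then obtain j where j: "j \<in> {1..r}" "t \<le> l j" "g (l j) = g t" using lB by auto
    \<comment> \<open>A break that carries the same step as \<open>t\<close> lies at or above
      \<open>t\<close>, so it cannot come after \<open>l i\<close> in the decreasing order.\<close>
    have "j \<le> i"
    proof (rule ccontr)
      assume "\<not> j \<le> i"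
      then have "l j \<le> l (i + 1)" using mono[of "i + 1" j] j by simp
      also have "l (i + 1) < t" using t by simp
      finally show False using j(2) by simp
    qed
    then have "g t \<le> g (l i)" using g_le[OF mono[of j i]] j i by simp
    then have "g (l i) = g t" using g_le[of t "l i"] t by simp
    then show "same_subobject C (Incl F (t, M)) (m i)"
      using same_subobject_sym[OF same[of t "l i"]] t i F unfolding m_def by simp
  next
    fix t assume "l 1 < t"
    have "g t = 0"
    proof (rule ccontr)
      assume "g t \<noteq> 0"
      then obtain b where "b \<in> B" "t \<le> b" using ex_B by blast
      then obtain j where "j \<in> {1..r}" "t \<le> l j" using lB by auto
      then show False using mono[of 1 j] \<open>l 1 < t\<close> by simp
    qed
    then show "null_object C (Omap F (t, M))" using F rk_eq_0_iff IA(3) unfolding g_def by simp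
  qed
  then show ?thesis unfolding has_breaks_iff by blast
qed

text \<open>The inclusions are arbitrary choices, but the arrows between steps are then forced, the
  inclusions being monic; so identities and composites are preserved strictly.\<close>

lemma torsion_filtration_exists: "\<exists>F. torsion_filtration F"
proof -
  define n where "n t M = (SOME n. torsion_part t n \<and> Cod C n = M)" for t M
  have n: "torsion_part t (n t M)" "Cod C (n t M) = M" if "M \<in> Obj C" for t M
  proof -
    have "\<exists>n. torsion_part t n \<and> Cod C n = M" using torsion_part_exists[OF that] by metis
    from someI_ex[OF this] show "torsion_part t (n t M)" "Cod C (n t M) = M" unfolding n_def by auto
  qed
  have nS: "strict_monic C (n t M)" "slopes_ge t (Dom C (n t M))" if "M \<in> Obj C" for t M
    using n[OF that] unfolding torsion_part_def by auto
  have nA: "monic C (n t M)" "n t M \<in> hom C (Dom C (n t M)) M" if "M \<in> Obj C" for t M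
    using strict_monic_monic[OF nS(1)[OF that]] monic_in_Arr n(2)[OF that] by (auto simp: hom_def)
  let ?P = "\<lambda>s t f h. h \<in> hom C (Dom C (n s (Dom C f))) (Dom C (n t (Cod C f))) \<and>
      n t (Cod C f) \<odot> h = f \<odot> n s (Dom C f)"
  define a where "a s t f = (SOME h. ?P s t f h)" for s t f
  have a: "a s t f \<in> hom C (Dom C (n s M)) (Dom C (n t N))" "n t N \<odot> a s t f = f \<odot> n s M"
    if f: "f \<in> hom C M N" and ts: "t \<le> s" for s t f M N
  proof -
    note fA = homD[OF f]
    have fn: "f \<odot> n s M \<in> hom C (Dom C (n s M)) N" using Cmp_in_hom[OF nA(2)[OF fA(4)] f] .
    \<comment> \<open>The source is in the class at \<open>s\<close>, hence at the smaller
      \<open>t\<close>, so the composite factors through the torsion part of \<open>N\<close> even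
      though it need not be monic.\<close>
    have "slopes_ge t (Dom C (f \<odot> n s M))"
      using slopes_ge_antimono[OF nS(2)[OF fA(4)] ts] homD[OF fn] by simp
    then have "subobject_le C (f \<odot> n s M) (n t N)"
      using n[OF fA(5), of t] homD[OF fn] unfolding torsion_part_def by simp
    then have "\<exists>h. ?P s t f h" unfolding subobject_le_def using homD[OF fn] fA by auto
    from someI_ex[OF this] show "a s t f \<in> hom C (Dom C (n s M)) (Dom C (n t N))"
      "n t N \<odot> a s t f = f \<odot> n s M" unfolding a_def using fA by auto
  qed
  have a_unique: "a s t f = h"
    if "f \<in> hom C M N" "t \<le> s" "h \<in> hom C (Dom C (n s M)) (Dom C (n t N))" "n t N \<odot> h = f \<odot> n s M"
    for s t f h M N
    using monic_cancel[OF nA(1)[OF homD(5)[OF that(1)]] a(1)[OF that(1,2)] that(3)] a(2)[OF that(1,2)] that(4)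
    by simp
  define F :: "('l, 'a, 'b) filt" where
    "F = \<lparr> Omap = (\<lambda>x. Dom C (n (fst x) (snd x))), Amap = (\<lambda>x. a (fst (fst x)) (snd (fst x)) (snd x)),
           Incl = (\<lambda>x \<in> UNIV \<times> Obj C. n (fst x) (snd x)) \<rparr>"
  have FO: "Omap F (t, M) = Dom C (n t M)" for t M by (simp add: F_def)
  have FA: "Amap F ((s, t), f) = a s t f" for s t f by (simp add: F_def)
  have FI: "Incl F (t, M) = n t M" if "M \<in> Obj C" for t M using that by (simp add: F_def)
  let ?L = "prod_cat (op_order_cat (UNIV :: 'l set)) C"
  have "is_func ?L C F"
    unfolding is_func_def
  proof (intro conjI ballI impI)
    fix x assume "x \<in> Obj ?L"
    then obtain t M where x: "x = (t, M)" and M: "M \<in> Obj C" by auto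
    show "Omap F x \<in> Obj C" using x FO homD(4)[OF nA(2)[OF M]] by simp
    have "a t t (Id C M) = Id C (Dom C (n t M))"
      by (rule a_unique[OF Id_in_hom[OF M] order_refl])
        (use Id_in_hom homD[OF nA(2)[OF M]] Id_Cmp[OF nA(2)[OF M]] Cmp_Id[OF nA(2)[OF M]] in auto)
    then show "Amap F (Id ?L x) = Id C (Omap F x)" using x FO FA by simp
  next
    fix x assume "x \<in> Arr ?L"
    then obtain s t f where x: "x = ((s, t), f)" and f: "f \<in> Arr C" "t \<le> s" by auto
    show "Amap F x \<in> hom C (Omap F (Dom ?L x)) (Omap F (Cod ?L x))"
      using a(1)[OF hom_self[OF f(1)] f(2)] x FO FA by simp
  next
    fix x y assume "x \<in> Arr ?L" "y \<in> Arr ?L" "Cod ?L x = Dom ?L y"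
    then obtain s t u f g where x: "x = ((s, t), f)" and y: "y = ((t, u), g)"
      and f: "f \<in> Arr C" "t \<le> s" and g: "g \<in> Arr C" "u \<le> t" and fg: "Cod C f = Dom C g" by auto
    have f': "f \<in> hom C (Dom C f) (Cod C f)" and g': "g \<in> hom C (Cod C f) (Cod C g)"
      using f g fg by (auto simp: hom_def)
    note af = a[OF f' f(2)] and ag = a[OF g' g(2)]
    note fO = homD(4)[OF f'] and gO = homD(4,5)[OF g']
    have "a s u (g \<odot> f) = a t u g \<odot> a s t f"
    proof (rule a_unique[OF Cmp_in_hom[OF f' g']])
      show "u \<le> s" using f g by simp
      show "a t u g \<odot> a s t f \<in> hom C (Dom C (n s (Dom C f))) (Dom C (n u (Cod C g)))"
        using Cmp_in_hom[OF af(1) ag(1)] .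
      show "n u (Cod C g) \<odot> (a t u g \<odot> a s t f) = g \<odot> f \<odot> n s (Dom C f)"
        using Cmp_assoc[OF af(1) ag(1) nA(2)[OF gO(2)]] ag(2) Cmp_assoc[OF af(1) nA(2)[OF gO(1)] g']
          af(2) Cmp_assoc[OF nA(2)[OF fO] f' g'] by simp
    qed
    then show "Amap F (y \<odot>\<^bsub>?L\<^esub> x) = Amap F y \<odot> Amap F x" using x y FA by simp
  qed
  moreover have "nat_trans ?L C F snd_func (Incl F)"
    unfolding nat_trans_def
  proof (intro conjI ballI)
    show "Incl F \<in> (\<Pi>\<^sub>E x \<in> Obj ?L. hom C (Omap F x) (Omap snd_func x))"
      unfolding F_def by (auto simp: nA(2))
    fix x assume "x \<in> Arr ?L"
    then obtain s t f where x: "x = ((s, t), f)" and f: "f \<in> Arr C" "t \<le> s" by auto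
    show "Incl F (Cod ?L x) \<odot> Amap F x = Amap snd_func x \<odot> Incl F (Dom ?L x)"
      using a(2)[OF hom_self[OF f(1)] f(2)] x FA FI Dom_in[OF f(1)] Cod_in[OF f(1)] by simp
  qed
  moreover have "has_breaks C F M" if "M \<in> nonzero_objects C" for M
    using that torsion_breaks[of M "\<lambda>t. n t M" F] n FI FO unfolding nonzero_objects_def by simp
  ultimately have "is_filtration C F" unfolding is_filtration_def using nS(1) FI by simp
  then show ?thesis unfolding torsion_filtration_def using n FI by (intro exI[of _ F]) simp
qed

end

section \<open>Isomorphisms of filtrations and invariance of the slope\<close>

context ranked_category
begin

lemma filt_iso_same:
  assumes F: "is_filtration C F" and G: "is_filtration C G" and \<phi>: "filt_iso C F G \<phi>" and M: "M \<in> Obj C"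
  shows "same_subobject C (Incl F (t, M)) (Incl G (t, M))"
proof -
  note FI = filtration_Incl[OF F M] and GI = filtration_Incl[OF G M]
  have "\<phi> \<in> (\<Pi>\<^sub>E x \<in> UNIV \<times> Obj C. hom C (Omap F x) (Omap G x))"
    using \<phi> unfolding filt_iso_def nat_trans_def by simp
  then have p: "\<phi> (t, M) \<in> hom C (Omap F (t, M)) (Omap G (t, M))" using M by auto
  have c: "Incl G (t, M) \<odot> \<phi> (t, M) = Incl F (t, M)" "iso_arrow C (\<phi> (t, M))"
    using \<phi> M unfolding filt_iso_def by auto
  obtain k where k: "k \<in> hom C (Omap G (t, M)) (Omap F (t, M))" "\<phi> (t, M) \<odot> k = Id C (Omap G (t, M))"
    using iso_arrowE[OF c(2)] homD[OF p] by metis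
  have "Incl F (t, M) \<odot> k = Incl G (t, M)"
    using Cmp_assoc[OF k(1) p GI(1)] c(1) k(2) Cmp_Id[OF GI(1)] by simp
  then show ?thesis
    unfolding same_subobject_def subobject_le_def using p c(1) k(1) homD[OF FI(1)] homD[OF GI(1)] by auto
qed

text \<open>Each component is determined by the monic \<open>Incl G\<close>; outside the objects
  extensionality decides.\<close>

lemma filt_iso_unique:
  fixes F G :: "('l::linorder, 'a, 'b) filt"
  assumes G: "is_filtration C G" and \<phi>: "filt_iso C F G \<phi>" and \<psi>: "filt_iso C F G \<psi>"
  shows "\<phi> = \<psi>"
proof (rule PiE_ext)
  show P: "\<phi> \<in> (\<Pi>\<^sub>E x \<in> UNIV \<times> Obj C. hom C (Omap F x) (Omap G x))"
    "\<psi> \<in> (\<Pi>\<^sub>E x \<in> UNIV \<times> Obj C. hom C (Omap F x) (Omap G x))"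
    using \<phi> \<psi> unfolding filt_iso_def nat_trans_def by auto
  fix x :: "'l \<times> 'a" assume "x \<in> UNIV \<times> Obj C"
  then obtain t M where x: "x = (t, M)" and M: "M \<in> Obj C" by auto
  note GI = filtration_Incl[OF G M]
  have "Incl G (t, M) \<odot> \<phi> (t, M) = Incl G (t, M) \<odot> \<psi> (t, M)"
    using \<phi> \<psi> M unfolding filt_iso_def by simp
  moreover have "\<phi> (t, M) \<in> hom C (Omap F (t, M)) (Omap G (t, M))"
    "\<psi> (t, M) \<in> hom C (Omap F (t, M)) (Omap G (t, M))" using P M by auto
  ultimately show "\<phi> x = \<psi> x" using monic_cancel[OF GI(3)] homD(2)[OF GI(1)] x by metis
qed

lemma break_data_same:
  fixes F G :: "('l::linorder, 'a, 'b) filt"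
  assumes F: "is_filtration C F" and G: "is_filtration C G" and M: "M \<in> Obj C"
    and same: "\<And>t. same_subobject C (Incl F (t, M)) (Incl G (t, M))"
    and br: "break_data C F M r l m"
  shows "break_data C G M r l m"
proof -
  note FI = filtration_Incl[OF F M] and GI = filtration_Incl[OF G M]
  have "same_subobject C (Incl G (t, M)) n"
    if "same_subobject C (Incl F (t, M)) n" "n \<in> Arr C" "Cod C n = M" for t n
    using same_subobject_trans[OF same_subobject_sym[OF same] that(1)] that(2,3) homD[OF FI(1)] homD[OF GI(1)]
    by simp
  moreover have "null_object C (Omap G (t, M))" if "null_object C (Omap F (t, M))" for t
    using that null_isomorphic same_subobject_isomorphic[OF same[of t] FI(3) GI(3)]
      homD[OF FI(1)] homD[OF GI(1)] by simp
  moreover have "m i \<in> Arr C" if "i \<le> r" for i using break_monic(4)[OF F M br that] .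
  ultimately show ?thesis using br M unfolding break_data_def by simp
qed

text \<open>No colimit has to be transported: the same breaks and chain serve both filtrations, and
  graded ranks are differences of ranks along the chain.\<close>

lemma filt_slope_same:
  fixes F G :: "('l::uniquely_divisible_ordered_group, 'a, 'b) filt"
  assumes F: "is_filtration C F" and G: "is_filtration C G"
    and same: "\<And>t M. M \<in> Obj C \<Longrightarrow> same_subobject C (Incl F (t, M)) (Incl G (t, M))"
  shows "filt_slope C rk F = filt_slope C rk G"
proof -
  have "filt_degree C rk F M = filt_degree C rk G M" if nz: "M \<in> nonzero_objects C" for M
  proof -
    have M: "M \<in> Obj C" using nz unfolding nonzero_objects_def by simp
    obtain r l m where br: "break_data C F M r l m"
      using F nz unfolding is_filtration_def has_breaks_iff by blast
    then show ?thesis using filt_degree_break_data[OF F G M br break_data_same[OF F G M same[OF M] br]] by simp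
  qed
  then show ?thesis unfolding filt_slope_def by (auto simp: restrict_def)
qed

end

theorem theorem4p2p3:
  fixes C :: "('o, 'm) cat" and rk :: "'o \<Rightarrow> nat"
  assumes "proto_abelian C" and "rank_function C rk"
  shows
    "let \<F> = (slope_filtrations C rk ::
                  ('l::uniquely_divisible_ordered_group, 'o, 'm) filt set);
         R = slope_filtration_iso_rel C rk
     in equiv \<F> R
      \<and> (\<forall>(F, G) \<in> R. \<exists>!\<phi>. filt_iso C F G \<phi>)
      \<and> (\<lambda>F. filt_slope C rk F) respects R
      \<and> bij_betw (\<lambda>X. the_elem (filt_slope C rk ` X)) (\<F> // R) (slope_functions C rk)"
proof -
  interpret ranked_category C rk
    using assms by (simp add: ranked_category_def ranked_category_axioms_def)
  let ?F = "slope_filtrations C rk :: ('l, 'o, 'm) filt set"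
  let ?R = "slope_filtration_iso_rel C rk :: ('l, 'o, 'm) filt rel"
  have filt: "is_filtration C F" if "F \<in> ?F" for F using that unfolding slope_filtrations_def by blast
  \<comment> \<open>Replaces isomorphism of filtrations by equality of all steps as subobjects, so
    that the equivalence laws need no composition of natural transformations.\<close>
  have R_iff: "(F, G) \<in> ?R \<longleftrightarrow> F \<in> ?F \<and> G \<in> ?F \<and>
      (\<forall>t. \<forall>M \<in> Obj C. same_subobject C (Incl F (t, M)) (Incl G (t, M)))" for F G
    using filt filt_iso_same[of F G] filt_iso_if_same_subobject[of F G]
    unfolding slope_filtration_iso_rel_def by blast
  have equiv: "equiv ?F ?R"
  proof (rule equivI)
    show "?R \<subseteq> ?F \<times> ?F" unfolding slope_filtration_iso_rel_def by blast
    show "refl_on ?F ?R"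
      unfolding refl_on_def R_iff same_subobject_def
      using subobject_le_refl homD(1)[OF filtration_Incl(1)[OF filt]] by blast
    show "sym ?R" unfolding sym_def R_iff using same_subobject_sym by blast
    show "trans ?R"
      unfolding trans_def R_iff
    proof (intro allI impI conjI ballI)
      fix F G H t M
      assume FG: "F \<in> ?F \<and> G \<in> ?F \<and> (\<forall>t. \<forall>M \<in> Obj C. same_subobject C (Incl F (t, M)) (Incl G (t, M)))"
        and GH: "G \<in> ?F \<and> H \<in> ?F \<and> (\<forall>t. \<forall>M \<in> Obj C. same_subobject C (Incl G (t, M)) (Incl H (t, M)))"
        and M: "M \<in> Obj C"
      then show "same_subobject C (Incl F (t, M)) (Incl H (t, M))"
        using same_subobject_trans[of "Incl F (t, M)" "Incl G (t, M)" "Incl H (t, M)"]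
          homD(1,3)[OF filtration_Incl(1)[OF filt M]] by simp
    qed auto
  qed
  have unique: "\<exists>!\<phi>. filt_iso C F G \<phi>" if "(F, G) \<in> ?R" for F G
    using that filt_iso_unique[OF filt] unfolding slope_filtration_iso_rel_def by blast
  have respects: "filt_slope C rk F = filt_slope C rk G" if "(F, G) \<in> ?R" for F G
    using that filt_slope_same filt unfolding R_iff by blast
  \<comment> \<open>The slope is constant on a class, so its image is a singleton and
    \<open>the_elem\<close> is well defined there.\<close>
  have slope_of_class: "the_elem (filt_slope C rk ` (?R `` {F})) = filt_slope C rk F" if "F \<in> ?F" for F
  proof -
    have "\<forall>G \<in> ?R `` {F}. filt_slope C rk G = filt_slope C rk F" using respects[of F] by simp
    then have "filt_slope C rk ` (?R `` {F}) = {filt_slope C rk F}"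
      using equiv_class_self[OF equiv that] by blast
    then show ?thesis by simp
  qed
  have "bij_betw (\<lambda>X. the_elem (filt_slope C rk ` X)) (?F // ?R) (slope_functions C rk)"
    unfolding bij_betw_def
  proof
    show "inj_on (\<lambda>X. the_elem (filt_slope C rk ` X)) (?F // ?R)"
    proof (rule inj_onI, elim quotientE)
      fix X Y F G
      assume XY: "the_elem (filt_slope C rk ` X) = the_elem (filt_slope C rk ` Y)"
        and F: "F \<in> ?F" "X = ?R `` {F}" and G: "G \<in> ?F" "Y = ?R `` {G}"
      have eq: "filt_slope C rk G = filt_slope C rk F" using XY F G slope_of_class by simp
      \<comment> \<open>The common slope function of \<open>F\<close> and \<open>G\<close> serves as
        \<open>\<mu>\<close>; both consist of its torsion parts, hence are isomorphic.\<close>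
      interpret sloped_category C rk "filt_slope C rk F"
        by unfold_locales (use F in \<open>simp add: slope_filtrations_def\<close>)
      have "\<exists>\<phi>. filt_iso C F G \<phi>"
        using torsion_filtration_same slope_filtration_torsion F(1) G(1) eq by blast
      then have "(F, G) \<in> ?R" using F(1) G(1) unfolding slope_filtration_iso_rel_def by blast
      then show "X = Y" using equiv_class_eq[OF equiv] F(2) G(2) by blast
    qed
    show "(\<lambda>X. the_elem (filt_slope C rk ` X)) ` (?F // ?R) = slope_functions C rk"
    proof
      show "(\<lambda>X. the_elem (filt_slope C rk ` X)) ` (?F // ?R) \<subseteq> slope_functions C rk"
        using slope_of_class unfolding slope_filtrations_def by (auto elim!: quotientE)
      show "slope_functions C rk \<subseteq> (\<lambda>X. the_elem (filt_slope C rk ` X)) ` (?F // ?R)"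
      proof
        fix \<mu> :: "'o \<Rightarrow> 'l" assume "\<mu> \<in> slope_functions C rk"
        then interpret sloped_category C rk \<mu> by unfold_locales
        obtain F where "torsion_filtration F" using torsion_filtration_exists by blast
        then have F: "F \<in> ?F" "filt_slope C rk F = \<mu>"
          using torsion_filtration_slope_filtration torsion_filtration_slope by auto
        then have "\<mu> = the_elem (filt_slope C rk ` (?R `` {F}))" using slope_of_class by simp
        then show "\<mu> \<in> (\<lambda>X. the_elem (filt_slope C rk ` X)) ` (?F // ?R)"
          using quotientI[OF F(1)] by blast
      qed
    qed
  qed
  moreover have "(\<lambda>F. filt_slope C rk F) respects ?R"
    using respects unfolding congruent_def by blast
  ultimately show ?thesis unfolding Let_def using equiv unique by blast
qed

end
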